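(* Assume that $(A_1)$–$(A_3)$ hold and that $\varepsilon>0$ is sufficiently small. Then the random dynamical system $\hat\phi^\varepsilon$ generated by $$d\hat x^\varepsilon=S\hat x^\varepsilon dt+g_1(\hat x^\varepsilon,\hat y^\varepsilon+\sigma\eta^{\frac1\varepsilon}(\theta_t\omega))dt,\qquad d\hat y^\varepsilon=\tfrac1\varepsilon F\hat y^\varepsilon dt+\tfrac1\varepsilon g_2(\hat x^\varepsilon,\hat y^\varepsilon+\sigma\eta^{\frac1\varepsilon}(\theta_t\omega))dt$$ has an invariant manifold $$\mathcal M^\varepsilon(\omega)=\{(x_0,\hat h^\varepsilon(\omega,x_0)):x_0\in\mathbb R^{n_1}\},$$ where $\hat h^\varepsilon:\Omega\times\mathbb R^{n_1}\to\mathbb R^{n_2}$ is a function that is Lipschitz continuous in its second argument, with Lipschitz constant satisfying $$\mathrm{Lip}\,\hat h^\varepsilon(\omega,\cdot)\le-\frac{K}{\gamma+\gamma_f}\,\frac{1}{1-\rho(\varepsilon)},\qquad\omega\in\Omega .$$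
   Context: Setting. $|\cdot|$ is the Euclidean norm, $n=n_1+n_2$, $\sigma>0$, $1<\alpha<2$. $S$ is an $n_1\times n_1$ matrix all of whose eigenvalues have non-negative real part, $F$ is an $n_2\times n_2$ matrix all of whose eigenvalues have negative real part, and $g_i:\mathbb R^{n_1}\times\mathbb R^{n_2}\to\mathbb R^{n_i}$ ($i=1,2$) are Lipschitz continuous with $g_i(0,0)=0$. Hypotheses. $(A_1)$: there are constants $\gamma_s>0$ and $\gamma_f<0$ such that $|e^{St}x|\le e^{\gamma_st}|x|$ for $t\le0$, $x\in\mathbb R^{n_1}$, and $|e^{Ft}y|\le e^{\gamma_ft}|y|$ for $t\ge0$, $y\in\mathbb R^{n_2}$. $(A_2)$: there is $K>0$ with $|g_i(x_1,y_1)-g_i(x_2,y_2)|\le K(|x_1-x_2|+|y_1-y_2|)$ for all $(x_j,y_j)\in\mathbb R^n$, $i=1,2$. $(A_3)$: $K<-\gamma_f$. A number $\gamma>0$ with $K<-(\gamma+\gamma_f)$ is fixed, and $\beta=-\gamma/\varepsilon$. Put $\rho(\varepsilon):=\frac{\varepsilon K}{\gamma+\varepsilon\gamma_s}-\frac{K}{\gamma+\gamma_f}$. Noise. $\Omega=\mathcal D_0(\mathbb R,\mathbb R^{n_2})$ is the space of càdlàg functions $\omega:\mathbb R\to\mathbb R^{n_2}$ with $\omega(0)=0$, with the Borel $\sigma$-algebra of the Skorokhod topology; $\mathbb P$ is the law making $L_t^\alpha(\omega)=\omega(t)$ a two-sided $\alpha$-stable Lévy process; $\theta_t\omega=\omega(\cdot+t)-\omega(t)$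 is the shift flow, which preserves $\mathbb P$. $\Omega$ is replaced, without change of notation, by a $\theta$-invariant subset of full measure on which $\eta^{\frac1\varepsilon}(\omega)=\varepsilon^{-\frac1\alpha}\int_{-\infty}^0e^{-Fs/\varepsilon}dL_s^\alpha(\omega)$ is defined, $t\mapsto\eta^{\frac1\varepsilon}(\theta_t\omega)$ is the càdlàg stationary solution of $d\eta=\frac1\varepsilon F\eta\,dt+\varepsilon^{-1/\alpha}dL_t^\alpha$ (with sublinear growth in $t$), and the system in the claim is solvable for every initial condition. Random dynamical systems. A random dynamical system on $\mathbb R^n$ over $\theta$ is a jointly measurable map $\phi:\mathbb R\times\Omega\times\mathbb R^n\to\mathbb R^n$ with $\phi(0,\omega,\cdot)=\mathrm{id}$ and $\phi(t+s,\omega,\cdot)=\phi(t,\theta_s\omega,\phi(s,\omega,\cdot))$. $\hat\phi^\varepsilon(t,\omega,(x_0,y_0))=(\hat x^\varepsilon(t),\hat y^\varepsilon(t))$ is the solution of the system in the claim starting at $(x_0,y_0)$ at $t=0$. A random set is a family of nonempty closed sets $M(\omega)\subset\mathbb R^n$ such that $\omega\mapsto\inf_{z'\in M(\omega)}|z-z'|$ is a random variable for each $z\in\mathbb R^n$; it is (positively) invariant if $\phi(t,\omega,M(\omega))\subseteq M(\theta_t\omega)$. A (Lipschitz) invariant manifold is an invariant random set that is the graph $\{(x,h(\omega,x)):x\in\mathbb R^{n_1}\}$ of a function $h$ with $x\mapsto h(\omega,x)$ Lipschitz for every $\omega$ and $\omega\mapsto h(\omega,x)$ a random variable for every $x$.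 Invariance of $\mathcal M^\varepsilon$ is asserted in the form $\hat\phi^\varepsilon(s,\omega,\mathcal M^\varepsilon(\omega))\subset\mathcal M^\varepsilon(\theta_s\omega)$ for $s\ge0$. Definition of the manifold. $C_\beta^-$ is the Banach space of continuous $(\phi^s,\phi^f):(-\infty,0]\to\mathbb R^{n_1}\times\mathbb R^{n_2}$ with finite norm $\sup_{t\le0}|e^{-\beta t}\phi^s_t|+\sup_{t\le0}|e^{-\beta t}\phi^f_t|$, and $$\mathcal M^\varepsilon(\omega)=\{(x_0,y_0)\in\mathbb R^n:\hat\phi^\varepsilon(\cdot,\omega,(x_0,y_0))\in C_\beta^-\}.$$ *)

theory Defs
  imports "HOL-Probability.Probability"
begin

section \<open>Matrices\<close>

text \<open>Complex eigenvalues of a real matrix.\<close>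

definition eigenvalue :: "real ^ 'n ^ 'n \<Rightarrow> complex \<Rightarrow> bool" where
  "eigenvalue A c \<longleftrightarrow> (\<exists>v. v \<noteq> 0 \<and> map_matrix complex_of_real A *v v = c *s v)"

definition mexp :: "real ^ 'n ^ 'n \<Rightarrow> real ^ 'n ^ 'n" where
  "mexp A = (\<Sum>k. (1 / fact k) *\<^sub>R (((**) A ^^ k) (mat 1)))"


section \<open>The path space\<close>

definition cadlag :: "(real \<Rightarrow> 'a::topological_space) \<Rightarrow> bool" where
  "cadlag w \<longleftrightarrow> (\<forall>t. continuous (at_right t) w \<and> (\<exists>l. (w \<longlongrightarrow> l) (at_left t)))"

definition cadlag_paths :: "(real \<Rightarrow> 'a::real_normed_vector) set" where
  "cadlag_paths = {w. cadlag w \<and> w 0 = 0}"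

text \<open>
  The Skorokhod J1 topology on paths over the whole line. It is metrizable, and a sequence
  \<open>w\<^sub>k\<close> converges to \<open>w\<close> iff there are increasing bijections \<open>l\<^sub>k\<close> of the line with
  \<open>l\<^sub>k(s) - s \<rightarrow> 0\<close> uniformly in \<open>s\<close> and \<open>w\<^sub>k(l\<^sub>k(s)) - w(s) \<rightarrow> 0\<close> uniformly on
  each interval \<open>[-T, T]\<close>. The sets \<open>skorokhod_nbhd w T e\<close> are the corresponding basic
  neighbourhoods (not necessarily open themselves).
\<close>

definition skorokhod_nbhd ::
    "(real \<Rightarrow> 'a::real_normed_vector) \<Rightarrow> real \<Rightarrow> real \<Rightarrow> (real \<Rightarrow> 'a) set" where
  "skorokhod_nbhd w T e = {w' \<in> cadlag_paths. \<exists>l::real \<Rightarrow> real. strict_mono l \<and> surj l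
      \<and> (\<forall>s. \<bar>l s - s\<bar> < e) \<and> (\<forall>s. \<bar>s\<bar> \<le> T \<longrightarrow> norm (w' (l s) - w s) < e)}"

definition skorokhod_topology :: "(real \<Rightarrow> 'a::real_normed_vector) topology" where
  "skorokhod_topology = topology (\<lambda>U. U \<subseteq> cadlag_paths
      \<and> (\<forall>w\<in>U. \<exists>T>0. \<exists>e>0. skorokhod_nbhd w T e \<subseteq> U))"

lemma skorokhod_nbhd_mono:
  "T' \<le> T \<Longrightarrow> e \<le> e' \<Longrightarrow> skorokhod_nbhd w T e \<subseteq> skorokhod_nbhd w T' e'"
  unfolding skorokhod_nbhd_def by (auto; meson less_le_trans order_trans)

lemma openin_skorokhod_topology:
  "openin skorokhod_topology U \<longleftrightarrow>
     U \<subseteq> cadlag_paths \<and> (\<forall>w\<in>U. \<exists>T>0. \<exists>e>0. skorokhod_nbhd w T e \<subseteq> U)"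
proof -
  let ?L = "\<lambda>U::(real \<Rightarrow> 'a) set. U \<subseteq> cadlag_paths
      \<and> (\<forall>w\<in>U. \<exists>T>0. \<exists>e>0. skorokhod_nbhd w T e \<subseteq> U)"
  have "?L (U \<inter> V)" if U: "?L U" and V: "?L V" for U V
  proof (intro conjI ballI)
    show "U \<inter> V \<subseteq> cadlag_paths" using U by blast
    fix w assume w: "w \<in> U \<inter> V"
    obtain T e where 1: "T > 0" "e > 0" "skorokhod_nbhd w T e \<subseteq> U" using U w by blast
    obtain T' e' where 2: "T' > 0" "e' > 0" "skorokhod_nbhd w T' e' \<subseteq> V" using V w by blast
    have "skorokhod_nbhd w (max T T') (min e e') \<subseteq> U \<inter> V"
      using skorokhod_nbhd_mono[of T "max T T'" "min e e'" e w]
        skorokhod_nbhd_mono[of T' "max T T'" "min e e'" e' w] 1 2 by fastforce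
    then show "\<exists>T>0. \<exists>e>0. skorokhod_nbhd w T e \<subseteq> U \<inter> V"
      using 1 2 by (intro exI[of _ "max T T'"] conjI exI[of _ "min e e'"]) auto
  qed
  moreover have "?L (\<Union>\<K>)" if K: "\<forall>K\<in>\<K>. ?L K" for \<K>
  proof (intro conjI ballI)
    show "\<Union>\<K> \<subseteq> cadlag_paths" using K by blast
    fix w assume "w \<in> \<Union>\<K>"
    then obtain X where X: "X \<in> \<K>" "w \<in> X" by blast
    then obtain T e where "T > 0" "e > 0" "skorokhod_nbhd w T e \<subseteq> X" using K by blast
    then show "\<exists>T>0. \<exists>e>0. skorokhod_nbhd w T e \<subseteq> \<Union>\<K>" using X by blast
  qed
  ultimately have "istopology ?L"
    unfolding istopology_def by blast
  then show ?thesis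
    unfolding skorokhod_topology_def by (simp add: topology_inverse')
qed

definition skorokhod_borel :: "(real \<Rightarrow> 'a::real_normed_vector) measure" where
  "skorokhod_borel = sigma cadlag_paths {U. openin skorokhod_topology U}"

definition path_shift :: "real \<Rightarrow> (real \<Rightarrow> 'a::ab_group_add) \<Rightarrow> real \<Rightarrow> 'a" where
  "path_shift t w = (\<lambda>s. w (s + t) - w t)"


section \<open>Stable Levy noise\<close>

text \<open>
  \<open>P\<close> makes the coordinate process a two-sided \<open>\<alpha>\<close>-stable Levy process. Stability is meant in
  the wide sense, i.e. up to a drift \<open>c\<close>; strictly stable is the case \<open>c = 0\<close>. Paths are cadlag
  and start at \<open>0\<close> because \<open>P\<close> lives on \<open>cadlag_paths\<close>.
\<close>

definition stable_levy_law :: "real \<Rightarrow> (real \<Rightarrow> real ^ 'n) measure \<Rightarrow> bool" where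
  "stable_levy_law \<alpha> P \<longleftrightarrow> prob_space P \<and> space P = cadlag_paths \<and> sets P = sets skorokhod_borel
     \<and> (\<forall>n (t::nat \<Rightarrow> real). (\<forall>i<n. t i < t (Suc i)) \<longrightarrow>
          prob_space.indep_vars P (\<lambda>_. borel) (\<lambda>i w. w (t (Suc i)) - w (t i)) {..<n})
     \<and> (\<forall>s t. s \<le> t \<longrightarrow> distr P borel (\<lambda>w. w t - w s) = distr P borel (\<lambda>w. w (t - s)))
     \<and> (\<forall>t. \<forall>e>0. ((\<lambda>s. measure P {w \<in> space P. norm (w s - w t) > e}) \<longlongrightarrow> 0) (at t))
     \<and> (\<forall>a>0. \<exists>c. \<forall>t\<ge>0. distr P borel (\<lambda>w. w (a * t)) =
          distr P borel (\<lambda>w. (a powr (1 / \<alpha>)) *\<^sub>R w t + t *\<^sub>R c))"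

text \<open>
  Stochastic integrals of smooth deterministic integrands against the noise are taken pathwise,
  as Riemann--Stieltjes integrals (limits over the mesh of the tagged division), and on
  \<open>(-\<infinity>, 0]\<close> as limits of the integrals over \<open>[a, 0]\<close>.
\<close>

definition has_stieltjes_integral ::
    "(real \<Rightarrow> real ^ 'n ^ 'm) \<Rightarrow> (real \<Rightarrow> real ^ 'n) \<Rightarrow> real ^ 'm \<Rightarrow> real \<Rightarrow> real \<Rightarrow> bool" where
  "has_stieltjes_integral f w I a b \<longleftrightarrow> (\<forall>e>0. \<exists>d>0. \<forall>p.
     p tagged_division_of {a..b} \<and> (\<lambda>x. ball x d) fine p \<longrightarrow>
       norm ((\<Sum>(x, k)\<in>p. f x *v (w (Sup k) - w (Inf k))) - I) < e)"

definition has_past_integral ::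
    "(real \<Rightarrow> real ^ 'n ^ 'm) \<Rightarrow> (real \<Rightarrow> real ^ 'n) \<Rightarrow> real ^ 'm \<Rightarrow> bool" where
  "has_past_integral f w I \<longleftrightarrow>
     (\<exists>J. (\<forall>a\<le>0. has_stieltjes_integral f w (J a) a 0) \<and> (J \<longlongrightarrow> I) at_bot)"

definition ou_kernel :: "real \<Rightarrow> real ^ 'n ^ 'n \<Rightarrow> real \<Rightarrow> real ^ 'n ^ 'n" where
  "ou_kernel \<epsilon> F s = mexp ((- s / \<epsilon>) *\<^sub>R F)"

definition \<eta> :: "real \<Rightarrow> real \<Rightarrow> real ^ 'n ^ 'n \<Rightarrow> (real \<Rightarrow> real ^ 'n) \<Rightarrow> real ^ 'n" where
  "\<eta> \<alpha> \<epsilon> F w = (\<epsilon> powr (- 1 / \<alpha>)) *\<^sub>R (THE I. has_past_integral (ou_kernel \<epsilon> F) w I)"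

definition stationary_process :: "'w measure \<Rightarrow> (real \<Rightarrow> 'w \<Rightarrow> 'a::topological_space) \<Rightarrow> bool" where
  "stationary_process M X \<longleftrightarrow> (\<forall>r J. finite J \<longrightarrow>
     distr M (Pi\<^sub>M J (\<lambda>_. borel)) (\<lambda>w. \<lambda>t\<in>J. X (t + r) w) =
     distr M (Pi\<^sub>M J (\<lambda>_. borel)) (\<lambda>w. \<lambda>t\<in>J. X t w))"


section \<open>The slow-fast system\<close>

text \<open>
  \<open>z = (x, y)\<close> is a solution on the whole line. The vector field jumps with the noise, so the
  differential equations are read in integrated form.
\<close>

definition solution ::
    "real ^ 'm ^ 'm \<Rightarrow> real ^ 'n ^ 'n \<Rightarrow> ((real ^ 'm) \<times> (real ^ 'n) \<Rightarrow> real ^ 'm) \<Rightarrow>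
     ((real ^ 'm) \<times> (real ^ 'n) \<Rightarrow> real ^ 'n) \<Rightarrow> real \<Rightarrow> real \<Rightarrow> real \<Rightarrow> (real \<Rightarrow> real ^ 'n) \<Rightarrow>
     (real ^ 'm) \<times> (real ^ 'n) \<Rightarrow> (real \<Rightarrow> (real ^ 'm) \<times> (real ^ 'n)) \<Rightarrow> bool" where
  "solution S F g1 g2 \<sigma> \<alpha> \<epsilon> w z0 z \<longleftrightarrow> z 0 = z0 \<and> (\<forall>s t. s \<le> t \<longrightarrow>
     ((\<lambda>u. S *v fst (z u) + g1 (fst (z u), snd (z u) + \<sigma> *\<^sub>R \<eta> \<alpha> \<epsilon> F (path_shift u w)))
        has_integral (fst (z t) - fst (z s))) {s..t} \<and>
     ((\<lambda>u. (1 / \<epsilon>) *\<^sub>R (F *v snd (z u))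
          + (1 / \<epsilon>) *\<^sub>R g2 (fst (z u), snd (z u) + \<sigma> *\<^sub>R \<eta> \<alpha> \<epsilon> F (path_shift u w)))
        has_integral (snd (z t) - snd (z s))) {s..t})"

definition flow ::
    "real ^ 'm ^ 'm \<Rightarrow> real ^ 'n ^ 'n \<Rightarrow> ((real ^ 'm) \<times> (real ^ 'n) \<Rightarrow> real ^ 'm) \<Rightarrow>
     ((real ^ 'm) \<times> (real ^ 'n) \<Rightarrow> real ^ 'n) \<Rightarrow> real \<Rightarrow> real \<Rightarrow> real \<Rightarrow>
     real \<Rightarrow> (real \<Rightarrow> real ^ 'n) \<Rightarrow> (real ^ 'm) \<times> (real ^ 'n) \<Rightarrow> (real ^ 'm) \<times> (real ^ 'n)" where
  "flow S F g1 g2 \<sigma> \<alpha> \<epsilon> t w z0 = (THE z. solution S F g1 g2 \<sigma> \<alpha> \<epsilon> w z0 z) t"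

text \<open>
  The standing conditions on the set \<open>\<Omega>\<close> of full measure to which the path space is restricted;
  the equation \<open>d\<eta> = (1/\<epsilon>) F \<eta> dt + \<epsilon>\<^bsup>-1/\<alpha>\<^esup> dL\<close> is again read in integrated form.
\<close>

definition admissible_paths ::
    "real ^ 'm ^ 'm \<Rightarrow> real ^ 'n ^ 'n \<Rightarrow> ((real ^ 'm) \<times> (real ^ 'n) \<Rightarrow> real ^ 'm) \<Rightarrow>
     ((real ^ 'm) \<times> (real ^ 'n) \<Rightarrow> real ^ 'n) \<Rightarrow> real \<Rightarrow> real \<Rightarrow> real \<Rightarrow>
     (real \<Rightarrow> real ^ 'n) measure \<Rightarrow> (real \<Rightarrow> real ^ 'n) set \<Rightarrow> bool" where
  "admissible_paths S F g1 g2 \<sigma> \<alpha> \<epsilon> P \<Omega> \<longleftrightarrow>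
     \<Omega> \<in> sets P \<and> measure P \<Omega> = 1 \<and> (\<forall>t. path_shift t ` \<Omega> = \<Omega>)
     \<and> stationary_process (restrict_space P \<Omega>) (\<lambda>t w. \<eta> \<alpha> \<epsilon> F (path_shift t w))
     \<and> (\<forall>w\<in>\<Omega>.
          (\<exists>I. has_past_integral (ou_kernel \<epsilon> F) w I)
          \<and> cadlag (\<lambda>t. \<eta> \<alpha> \<epsilon> F (path_shift t w))
          \<and> (\<forall>s t. s \<le> t \<longrightarrow>
               ((\<lambda>u. (1 / \<epsilon>) *\<^sub>R (F *v \<eta> \<alpha> \<epsilon> F (path_shift u w))) has_integral
                  (\<eta> \<alpha> \<epsilon> F (path_shift t w) - \<eta> \<alpha> \<epsilon> F (path_shift s w)
                     - (\<epsilon> powr (- 1 / \<alpha>)) *\<^sub>R (w t - w s))) {s..t})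
          \<and> ((\<lambda>t. (1 / t) *\<^sub>R \<eta> \<alpha> \<epsilon> F (path_shift t w)) \<longlongrightarrow> 0) at_top
          \<and> ((\<lambda>t. (1 / t) *\<^sub>R \<eta> \<alpha> \<epsilon> F (path_shift t w)) \<longlongrightarrow> 0) at_bot
          \<and> (\<forall>z0. \<exists>z. solution S F g1 g2 \<sigma> \<alpha> \<epsilon> w z0 z))"


section \<open>Random dynamical systems and invariant manifolds\<close>

definition random_dynamical_system ::
    "'w measure \<Rightarrow> (real \<Rightarrow> 'w \<Rightarrow> 'w) \<Rightarrow> (real \<Rightarrow> 'w \<Rightarrow> 'z::topological_space \<Rightarrow> 'z) \<Rightarrow> bool" where
  "random_dynamical_system M \<theta> \<phi> \<longleftrightarrow>
     (\<lambda>(t, w, z). \<phi> t w z) \<in> borel_measurable (borel \<Otimes>\<^sub>M (M \<Otimes>\<^sub>M borel))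
     \<and> (\<forall>w\<in>space M. \<forall>z. \<phi> 0 w z = z)
     \<and> (\<forall>t s. \<forall>w\<in>space M. \<forall>z. \<phi> (t + s) w z = \<phi> t (\<theta> s w) (\<phi> s w z))"

definition random_set :: "'w measure \<Rightarrow> ('w \<Rightarrow> 'z::metric_space set) \<Rightarrow> bool" where
  "random_set M A \<longleftrightarrow> (\<forall>w\<in>space M. closed (A w) \<and> A w \<noteq> {})
     \<and> (\<forall>z. (\<lambda>w. infdist z (A w)) \<in> borel_measurable M)"

definition invariant_random_set ::
    "'w measure \<Rightarrow> (real \<Rightarrow> 'w \<Rightarrow> 'w) \<Rightarrow> (real \<Rightarrow> 'w \<Rightarrow> 'z \<Rightarrow> 'z) \<Rightarrow> ('w \<Rightarrow> 'z::metric_space set) \<Rightarrow> bool"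
    where
  "invariant_random_set M \<theta> \<phi> A \<longleftrightarrow> random_set M A
     \<and> (\<forall>t\<ge>0. \<forall>w\<in>space M. \<phi> t w ` A w \<subseteq> A (\<theta> t w))"

definition lipschitz_invariant_manifold ::
    "'w measure \<Rightarrow> (real \<Rightarrow> 'w \<Rightarrow> 'w) \<Rightarrow> (real \<Rightarrow> 'w \<Rightarrow> 'x \<times> 'y \<Rightarrow> 'x \<times> 'y) \<Rightarrow>
     ('w \<Rightarrow> ('x::metric_space \<times> 'y::metric_space) set) \<Rightarrow> ('w \<Rightarrow> 'x \<Rightarrow> 'y) \<Rightarrow> bool" where
  "lipschitz_invariant_manifold M \<theta> \<phi> A h \<longleftrightarrow> invariant_random_set M \<theta> \<phi> A
     \<and> (\<forall>w\<in>space M. A w = {(x, h w x) | x. True} \<and> (\<exists>C. C-lipschitz_on UNIV (h w)))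
     \<and> (\<forall>x. (\<lambda>w. h w x) \<in> borel_measurable M)"

text \<open>\<open>C\<^sub>\<beta>\<^sup>-\<close>: only the values on \<open>(-\<infinity>, 0]\<close> are constrained.\<close>

definition C_minus :: "real \<Rightarrow> (real \<Rightarrow> 'x::real_normed_vector \<times> 'y::real_normed_vector) set" where
  "C_minus \<beta> = {f. continuous_on {..0} f
     \<and> bdd_above ((\<lambda>t. norm (exp (- \<beta> * t) *\<^sub>R fst (f t))) ` {..0})
     \<and> bdd_above ((\<lambda>t. norm (exp (- \<beta> * t) *\<^sub>R snd (f t))) ` {..0})}"

definition slow_manifold ::
    "(real \<Rightarrow> 'w \<Rightarrow> 'x::real_normed_vector \<times> 'y::real_normed_vector \<Rightarrow> 'x \<times> 'y) \<Rightarrow> real \<Rightarrow>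
     'w \<Rightarrow> ('x \<times> 'y) set" where
  "slow_manifold \<phi> \<beta> w = {z0. (\<lambda>t. \<phi> t w z0) \<in> C_minus \<beta>}"

definition \<rho> :: "real \<Rightarrow> real \<Rightarrow> real \<Rightarrow> real \<Rightarrow> real \<Rightarrow> real" where
  "\<rho> K \<gamma> \<gamma>s \<gamma>f \<epsilon> = \<epsilon> * K / (\<gamma> + \<epsilon> * \<gamma>s) - K / (\<gamma> + \<gamma>f)"

end

theory Submission
  imports Defs "HOL-Real_Asymp.Real_Asymp"
begin

text \<open>
  The manifold is found by the Lyapunov--Perron method. By variation of constants, a solution lies
  in \<open>C\<^sub>\<beta>\<^sup>-\<close> iff it is a fixed point of the operator that integrates the slow
  nonlinearity from \<open>0\<close> to \<open>t\<close> against \<open>exp (S (t - s))\<close> and the fast one from \<open>-\<infinity>\<close> to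
  \<open>t\<close> against \<open>exp (F (t - s) / \<epsilon>) / \<epsilon>\<close>. In the norm weighted by \<open>exp (\<gamma> \<bar>t\<bar> / \<epsilon>)\<close> this is a
  contraction with constant \<open>\<rho> < 1\<close>, so for each slow initial value there is exactly one fixed point,
  whose fast value at time \<open>0\<close> is \<open>h\<close>. Picard iteration for the flow is a contraction of the same
  form, with the oriented indicator of \<open>[0, t]\<close> as kernel. In both cases the iterates are Lebesgue
  integrals, hence jointly measurable in the path, so measurability passes to the limit; the
  sublinear growth of \<open>\<eta>\<close> makes the inhomogeneity finite in the weighted norm.
\<close>

section \<open>The matrix exponential\<close>

text \<open>The noise path jumps, so the vector field is not continuous in time. Solutions are
  Henstock-Kurzweil integral identities, while the fixed points are Lebesgue integrals against a
  kernel; a product rule for a smooth matrix function and a merely integrated vector function links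
  the two. The constants arise from estimating the components separately. The slow integral
  contributes K/(\<gamma>s + \<gamma>/\<epsilon>) = \<epsilon>K/(\<gamma> + \<epsilon>\<gamma>s),
  the fast one -K/(\<gamma> + \<gamma>f), and \<open>\<rho>\<close> is their sum. The whole fixed
  point depends on the slow initial value with constant 1/(1 - \<open>\<rho>\<close>). The fast
  component carries no initial data, so it depends on that value only through the fast integral,
  which multiplies by the fast share: this is the bound on the Lipschitz constant. The fast share is
  below 1 by the gap condition and free of \<epsilon>, the slow share is at most
  \<epsilon>K/\<gamma>, hence \<open>\<rho>\<close> < 1 for small \<epsilon>. The stationary process
  is given by a definite description, so its measurability has to be recovered from explicit finite
  sums over coordinates of the path.\<close>

lemma bounded_bilinear_matrix_vector_mult:
  "bounded_bilinear (\<lambda>(A::real^'n^'m) x. A *v x)"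
  unfolding bilinear_conv_bounded_bilinear[symmetric] bilinear_def linear_iff
  by (simp add: matrix_vector_right_distrib matrix_vector_mult_add_rdistrib
      matrix_vector_mult_scaleR scaleR_matrix_vector_assoc)

lemma matrix_matrix_mult_scaleR:
  fixes A :: "real^'n^'m" and B :: "real^'k^'n"
  shows "(c *\<^sub>R A) ** B = c *\<^sub>R (A ** B)" "A ** (c *\<^sub>R B) = c *\<^sub>R (A ** B)"
  by (simp_all add: matrix_matrix_mult_def vec_eq_iff sum_distrib_left mult_ac)

lemma bounded_bilinear_matrix_matrix_mult:
  "bounded_bilinear (\<lambda>(A::real^'n^'m) (B::real^'k^'n). A ** B)"
  unfolding bilinear_conv_bounded_bilinear[symmetric] bilinear_def linear_iff
  by (simp add: matrix_add_ldistrib matrix_matrix_mult_scaleR)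
    (simp add: matrix_matrix_mult_def vec_eq_iff sum.distrib algebra_simps)

lemma measurable_matrix_vector_mult:
  assumes "F \<in> borel_measurable M" "x \<in> borel_measurable M"
  shows "(\<lambda>w. (F w :: real^'i^'j) *v x w) \<in> borel_measurable M"
  by (rule borel_measurable_continuous_Pair[OF assms, of "(*v)"])
    (auto intro!: bounded_bilinear.continuous_on[OF bounded_bilinear_matrix_vector_mult] continuous_intros)

lemma bounded_matrix_vector_mult:
  fixes F :: "'a \<Rightarrow> real^'n^'m"
  assumes "bounded (F ` X)" "bounded (x ` X)"
  shows "bounded ((\<lambda>q. F q *v x q) ` X)"
proof -
  obtain D where D: "D \<ge> 0" "\<And>(A::real^'n^'m) x. norm (A *v x) \<le> norm A * norm x * D"
    using bounded_bilinear.nonneg_bounded[OF bounded_bilinear_matrix_vector_mult] by blast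
  obtain B1 B2 where B: "\<And>q. q \<in> X \<Longrightarrow> norm (F q) \<le> B1" "\<And>q. q \<in> X \<Longrightarrow> norm (x q) \<le> B2"
    using assms unfolding bounded_iff by blast
  have "norm (F q *v x q) \<le> B1 * B2 * D" if "q \<in> X" for q
  proof -
    have "norm (F q *v x q) \<le> norm (F q) * norm (x q) * D" by (rule D)
    also have "\<dots> \<le> B1 * B2 * D"
      using B[OF that] D(1) order_trans[OF norm_ge_zero B(1)[OF that]]
      by (intro mult_right_mono mult_mono) auto
    finally show ?thesis .
  qed
  then show ?thesis unfolding bounded_iff by blast
qed

section \<open>Exponential series: derivative and group law\<close>

lemma summable_exp_bound:
  fixes x :: "nat \<Rightarrow> 'a::banach"
  assumes "\<And>n. norm (x n) \<le> B * C ^ n"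
  shows "summable (\<lambda>n. (1 / fact n) *\<^sub>R x n)"
proof (rule summable_comparison_test')
  have "summable (\<lambda>n. B * (inverse (fact n) * C ^ n))"
    by (intro summable_mult summable_exp)
  then show "summable (\<lambda>n. B * C ^ n / fact n)"
    by (simp add: field_simps)
  show "norm ((1 / fact n) *\<^sub>R x n) \<le> B * C ^ n / fact n" if "n \<ge> 0" for n
    using assms[of n] by (simp add: divide_right_mono)
qed

text \<open>Inner products with basis vectors reduce termwise differentiation to real power series.
  The shifted coefficients \<open>x (Suc n)\<close> are what \<open>diffs\<close> makes of
  \<open>x n \<bullet> b / fact n\<close>.\<close>

lemma exp_series_has_vector_derivative:
  fixes x :: "nat \<Rightarrow> 'a::euclidean_space"
  assumes "\<And>n. norm (x n) \<le> B * C ^ n" "C \<ge> 0"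
  shows "((\<lambda>t. \<Sum>n. (1 / fact n) *\<^sub>R (t ^ n *\<^sub>R x n)) has_vector_derivative
    (\<Sum>n. (1 / fact n) *\<^sub>R (t ^ n *\<^sub>R x (Suc n)))) (at t)"
proof -
  have s0: "summable (\<lambda>n. (1 / fact n) *\<^sub>R (t ^ n *\<^sub>R x n))" for t
  proof (rule summable_exp_bound)
    show "norm (t ^ n *\<^sub>R x n) \<le> B * (\<bar>t\<bar> * C) ^ n" for n
      using mult_left_mono[OF assms(1)[of n], of "\<bar>t\<bar> ^ n"]
      by (simp add: power_abs power_mult_distrib mult_ac)
  qed
  have s1: "summable (\<lambda>n. (1 / fact n) *\<^sub>R (t ^ n *\<^sub>R x (Suc n)))" for t
  proof (rule summable_exp_bound)
    show "norm (t ^ n *\<^sub>R x (Suc n)) \<le> (B * C) * (\<bar>t\<bar> * C) ^ n" for n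
      using mult_left_mono[OF assms(1)[of "Suc n"], of "\<bar>t\<bar> ^ n"]
      by (simp add: power_abs power_mult_distrib mult_ac)
  qed
  show ?thesis
    unfolding has_vector_derivative_def
  proof (subst has_derivative_componentwise_within, intro ballI)
    fix b :: 'a assume "b \<in> Basis"
    define c where "c n = x n \<bullet> b / fact n" for n
    have e0: "(\<Sum>n. (1 / fact n) *\<^sub>R (t ^ n *\<^sub>R x n)) \<bullet> b = (\<Sum>n. c n * t ^ n)" for t
      using bounded_linear.suminf[OF bounded_linear_inner_left s0, of t b]
      by (simp add: c_def mult_ac)
    have e1: "(\<Sum>n. (1 / fact n) *\<^sub>R (t ^ n *\<^sub>R x (Suc n))) \<bullet> b = (\<Sum>n. diffs c n * t ^ n)" for t
      using bounded_linear.suminf[OF bounded_linear_inner_left s1, of t b]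
      by (simp add: c_def diffs_def mult_ac del: of_nat_Suc) 
    have "summable (\<lambda>n. c n * t ^ n)" for t
      using bounded_linear.summable[OF bounded_linear_inner_left s0, of t b]
      by (simp add: c_def mult_ac)
    then have "((\<lambda>t. \<Sum>n. c n * t ^ n) has_field_derivative (\<Sum>n. diffs c n * t ^ n)) (at t)"
      by (rule termdiffs_strong_converges_everywhere)
    then show "((\<lambda>t. (\<Sum>n. (1 / fact n) *\<^sub>R (t ^ n *\<^sub>R x n)) \<bullet> b) has_derivative
        (\<lambda>h. (h *\<^sub>R (\<Sum>n. (1 / fact n) *\<^sub>R (t ^ n *\<^sub>R x (Suc n)))) \<bullet> b)) (at t)"
      unfolding e0 inner_scaleR_left e1 has_field_derivative_def
      by (simp add: mult.commute[of _ "\<Sum>n. diffs c n * t ^ n"])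
  qed
qed

text \<open>The product enters only as a bounded bilinear map with constant \<open>D\<close>, whence
  the ratio \<open>norm A * D\<close>.\<close>

lemma matrix_power_bound:
  fixes A :: "real^'n^'n"
  obtains B C where "C \<ge> 0" "\<And>k. norm (((**) A ^^ k) (mat 1)) \<le> B * C ^ k"
proof -
  interpret bounded_bilinear "\<lambda>(A::real^'n^'n) (B::real^'n^'n). A ** B"
    by (rule bounded_bilinear_matrix_matrix_mult)
  obtain D where D: "D \<ge> 0" "\<And>(a::real^'n^'n) (b::real^'n^'n). norm (a ** b) \<le> norm a * norm b * D"
    using nonneg_bounded by (metis (full_types))
  have "norm (((**) A ^^ k) (mat 1)) \<le> norm (mat 1 :: real^'n^'n) * (norm A * D) ^ k" for k
  proof (induction k)
    case (Suc k)
    have "norm (((**) A ^^ Suc k) (mat 1)) \<le> norm A * norm (((**) A ^^ k) (mat 1)) * D"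
      using D(2) by simp
    also have "\<dots> \<le> norm A * (norm (mat 1 :: real^'n^'n) * (norm A * D) ^ k) * D"
      using Suc D(1) by (intro mult_right_mono mult_left_mono) auto
    finally show ?case by (simp add: mult_ac)
  qed simp
  with D(1) show ?thesis by (intro that[of "norm A * D"]) auto
qed

lemma matrix_power_scaleR:
  fixes A :: "real^'n^'n"
  shows "((**) (t *\<^sub>R A) ^^ k) (mat 1) = t ^ k *\<^sub>R ((**) A ^^ k) (mat 1)"
  by (induction k) (simp_all add: matrix_matrix_mult_scaleR)

lemma matrix_power_commute:
  fixes A :: "real^'n^'n"
  shows "((**) A ^^ k) (mat 1) ** A = A ** ((**) A ^^ k) (mat 1)"
  by (induction k) (simp_all add: matrix_mul_assoc[symmetric])

lemma mexp_0: "mexp (0 :: real^'n^'n) = mat 1"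
proof -
  have "((**) (0::real^'n^'n) ^^ k) (mat 1) = (if k = 0 then mat 1 else 0)" for k
    by (cases k) (simp_all add: matrix_matrix_mult_def vec_eq_iff)
  then have "mexp (0 :: real^'n^'n) = (\<Sum>k. if k = 0 then mat 1 else 0)"
    unfolding mexp_def by (intro suminf_cong) auto
  also have "\<dots> = (\<Sum>k\<in>{0::nat}. if k = 0 then mat 1 else 0)"
    by (rule suminf_finite) auto
  finally show ?thesis by simp
qed

lemma
  fixes A :: "real^'n^'n"
  shows mexp_has_vector_derivative:
      "((\<lambda>t. mexp (t *\<^sub>R A)) has_vector_derivative (A ** mexp (t *\<^sub>R A))) (at t)"
    and mexp_commute: "A ** mexp (t *\<^sub>R A) = mexp (t *\<^sub>R A) ** A"
proof -
  interpret bounded_bilinear "\<lambda>(A::real^'n^'n) (B::real^'n^'n). A ** B"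
    by (rule bounded_bilinear_matrix_matrix_mult)
  define x where "x k = ((**) A ^^ k) (mat 1)" for k
  obtain B C where BC: "C \<ge> 0" "\<And>k. norm (x k) \<le> B * C ^ k"
    using matrix_power_bound unfolding x_def by metis
  have e: "mexp (t *\<^sub>R A) = (\<Sum>n. (1 / fact n) *\<^sub>R (t ^ n *\<^sub>R x n))" for t
    unfolding mexp_def x_def matrix_power_scaleR ..
  have s: "summable (\<lambda>n. (1 / fact n) *\<^sub>R (t ^ n *\<^sub>R x n))" for t
  proof (rule summable_exp_bound)
    show "norm (t ^ n *\<^sub>R x n) \<le> B * (\<bar>t\<bar> * C) ^ n" for n
      using mult_left_mono[OF BC(2)[of n], of "\<bar>t\<bar> ^ n"]
      by (simp add: power_abs power_mult_distrib mult_ac)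
  qed
  have l: "A ** mexp (t *\<^sub>R A) = (\<Sum>n. (1 / fact n) *\<^sub>R (t ^ n *\<^sub>R x (Suc n)))"
    using bounded_linear.suminf[OF bounded_linear_right s]
    by (simp add: e matrix_matrix_mult_scaleR x_def)
  show "A ** mexp (t *\<^sub>R A) = mexp (t *\<^sub>R A) ** A"
    unfolding l using bounded_linear.suminf[OF bounded_linear_left[of A] s[of t]]
    by (simp add: e matrix_matrix_mult_scaleR x_def matrix_power_commute)
  show "((\<lambda>t. mexp (t *\<^sub>R A)) has_vector_derivative (A ** mexp (t *\<^sub>R A))) (at t)"
    unfolding l unfolding e by (rule exp_series_has_vector_derivative[OF BC(2,1)])
qed

lemma continuous_on_mexp: "continuous_on X (\<lambda>t. mexp (t *\<^sub>R (A::real^'n^'n)))"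
  using mexp_has_vector_derivative[of A]
  by (meson continuous_on_eq_continuous_within has_vector_derivative_at_within
      has_vector_derivative_continuous)

text \<open>\<open>?q\<close> joins the two sides, at \<open>r = 0\<close> and \<open>r = t\<close>.
  It is constant because the two terms of its derivative cancel, \<open>A\<close> commuting with its
  exponential.\<close>

lemma mexp_add:
  fixes A :: "real^'n^'n"
  shows "mexp ((s + t) *\<^sub>R A) = mexp (s *\<^sub>R A) ** mexp (t *\<^sub>R A)"
proof -
  let ?E = "\<lambda>t. mexp (t *\<^sub>R A)" and ?q = "\<lambda>r. mexp ((s + t - r) *\<^sub>R A) ** mexp (r *\<^sub>R A)"
  have "(?q has_vector_derivative 0) (at r)" for r
  proof -
    have "((\<lambda>r. ?E (s + t - r)) has_vector_derivative
        (- 1) *\<^sub>R (A ** ?E (s + t - r))) (at r)"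
    proof -
      have "((\<lambda>r. s + t - r) has_vector_derivative - 1) (at r)"
        by (auto intro!: derivative_eq_intros)
      from vector_diff_chain_at[OF this mexp_has_vector_derivative]
      show ?thesis by (simp add: o_def)
    qed
    from bounded_bilinear.has_vector_derivative[OF bounded_bilinear_matrix_matrix_mult
        this mexp_has_vector_derivative[of A r]]
    have "(?q has_vector_derivative
      (?E (s + t - r) ** (A ** ?E r) + ((- 1) *\<^sub>R (A ** ?E (s + t - r))) ** ?E r)) (at r)" .
    moreover have "?E (s + t - r) ** (A ** ?E r) = (A ** ?E (s + t - r)) ** ?E r"
      by (metis matrix_mul_assoc mexp_commute)
    ultimately show ?thesis
      by (simp add: bounded_bilinear.minus_left[OF bounded_bilinear_matrix_matrix_mult])
  qed
  then have "\<exists>c. \<forall>r\<in>UNIV. ?q r = c"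
    by (intro has_derivative_zero_constant) (auto simp: has_vector_derivative_def)
  then have "?q t = ?q 0" by (metis UNIV_I)
  then show ?thesis by (simp add: mexp_0)
qed

section \<open>Integrated differential equations\<close>

text \<open>The common end of the arguments below in which an estimate reproduces itself with a
  smaller factor and is iterated indefinitely.\<close>

lemma le_geometric_imp_nonpos:
  fixes x :: real
  assumes "\<And>k. x \<le> B * q ^ k" "0 \<le> q" "q < 1"
  shows "x \<le> 0"
proof -
  have "(\<lambda>k. B * q ^ k) \<longlonglongrightarrow> B * 0"
    using assms by (intro tendsto_mult_left LIMSEQ_realpow_zero)
  then show ?thesis
    using assms(1) by (intro LIMSEQ_le_const) auto
qed

text \<open>Bisection: two halves with squared lengths \<open>((t - s) / 2)^2\<close> add up to half
  the original bound, so every level of halving gains a factor 1/2.\<close>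

lemma quadratic_increment_imp_eq:
  fixes f :: "real \<Rightarrow> 'a::real_normed_vector"
  assumes "\<And>s t. a \<le> s \<Longrightarrow> s \<le> t \<Longrightarrow> t \<le> b \<Longrightarrow> norm (f t - f s) \<le> C * (t - s)^2" "a \<le> b"
  shows "f a = f b"
proof -
  have "norm (f t - f s) \<le> C * (t - s)^2 * (1/2)^k" if "a \<le> s" "s \<le> t" "t \<le> b" for k s t
    using that
  proof (induction k arbitrary: s t)
    case 0
    then show ?case using assms(1) by simp
  next
    case (Suc k)
    let ?m = "(s + t) / 2"
    have "norm (f t - f s) \<le> norm (f t - f ?m) + norm (f ?m - f s)"
      using norm_triangle_ineq[of "f t - f ?m" "f ?m - f s"] by simp
    also have "\<dots> \<le> C * (t - ?m)^2 * (1/2)^k + C * (?m - s)^2 * (1/2)^k"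
      using Suc.prems by (intro add_mono Suc.IH) auto
    also have "\<dots> = C * (t - s)^2 * (1/2)^Suc k"
      by (simp add: field_simps power2_eq_square)
    finally show ?case .
  qed
  then have "norm (f b - f a) \<le> C * (b - a)^2 * (1/2)^k" for k
    using assms(2) by blast
  then have "norm (f b - f a) \<le> 0"
    by (rule le_geometric_imp_nonpos) auto
  then show ?thesis by simp
qed

lemma bounded_borel_set_integrable:
  fixes f :: "real \<Rightarrow> 'a::euclidean_space"
  assumes [measurable]: "f \<in> borel_measurable borel" and "bounded (f ` {a..b})"
  shows "set_integrable lborel {a..b} f"
proof -
  obtain B where B: "\<And>x. x \<in> {a..b} \<Longrightarrow> norm (f x) \<le> B"
    using assms(2) unfolding bounded_iff by blast
  have 1: "set_integrable lborel {a..b} (\<lambda>_. B)"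
    unfolding set_integrable_def by (cases "a \<le> b") auto
  show ?thesis
    by (rule set_integrable_bound[OF 1]) (use B in \<open>auto simp: set_borel_measurable_def intro: order_trans[OF _ abs_ge_self]\<close>)
qed

lemma bounded_borel_integrable_on:
  fixes f :: "real \<Rightarrow> 'a::euclidean_space"
  assumes "f \<in> borel_measurable borel" and "bounded (f ` {a..b})"
  shows "f integrable_on {a..b}"
  using bounded_borel_set_integrable[OF assms] set_borel_integral_eq_integral(1) by blast

text \<open>Continuity is not part of being a solution; it comes from continuity of the indefinite
  integral of the right-hand side.\<close>

lemma has_integral_increments_continuous_on:
  fixes v :: "real \<Rightarrow> 'a::euclidean_space"
  assumes "\<And>s t. a \<le> s \<Longrightarrow> s \<le> t \<Longrightarrow> t \<le> b \<Longrightarrow> (c has_integral v t - v s) {s..t}"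
  shows "continuous_on {a..b} v"
proof (cases "a \<le> b")
  case True
  have "continuous_on {a..b} (\<lambda>t. v a + integral {a..t} c)"
    using assms[of a b] True by (intro continuous_intros indefinite_integral_continuous_1) auto
  moreover have "v a + integral {a..t} c = v t" if "t \<in> {a..b}" for t
    using assms[of a t] that by (simp add: integral_unique)
  ultimately show ?thesis
    by (metis (no_types, lifting) continuous_on_cong)
qed simp

text \<open>The remainder of \<open>\<Phi> v\<close> over \<open>[s, t]\<close> is
  \<open>\<integral> ((\<Phi> t - \<Phi> r) c r - \<Phi>' r (v r - v s)) dr\<close>, which is quadratic in \<open>t - s\<close>;
  so no differentiability of \<open>v\<close> is needed.\<close>

lemma integral_product_rule:
  fixes \<Phi> \<Phi>' :: "real \<Rightarrow> real^'n^'m" and v c :: "real \<Rightarrow> real^'n"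
  assumes \<Phi>: "\<And>r. (\<Phi> has_vector_derivative \<Phi>' r) (at r)" "continuous_on UNIV \<Phi>'"
    and c: "c \<in> borel_measurable borel" "bounded (c ` {a..b})"
    and v: "\<And>s t. a \<le> s \<Longrightarrow> s \<le> t \<Longrightarrow> t \<le> b \<Longrightarrow> (c has_integral v t - v s) {s..t}"
    and "a \<le> b"
  shows "((\<lambda>r. \<Phi>' r *v v r + \<Phi> r *v c r) has_integral (\<Phi> b *v v b - \<Phi> a *v v a)) {a..b}"
proof -
  interpret mv: bounded_bilinear "\<lambda>(A::real^'n^'m) x. A *v x"
    by (rule bounded_bilinear_matrix_vector_mult)
  obtain D where D: "D \<ge> 0" "\<And>(A::real^'n^'m) x. norm (A *v x) \<le> norm A * norm x * D"
    using mv.nonneg_bounded by blast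
  have cv: "continuous_on {a..b} v"
    by (rule has_integral_increments_continuous_on) (fact v)
  have c\<Phi>: "continuous_on X \<Phi>" for X
    using \<Phi>(1) by (meson continuous_on_eq_continuous_within has_vector_derivative_at_within
      has_vector_derivative_continuous)
  have c\<Phi>': "continuous_on X \<Phi>'" for X
    using \<Phi>(2) continuous_on_subset by blast
  obtain M1 where M1: "\<And>r. r \<in> {a..b} \<Longrightarrow> norm (c r) \<le> M1"
    using c(2) unfolding bounded_iff by blast
  have "bounded (\<Phi>' ` {a..b})"
    by (intro compact_imp_bounded compact_continuous_image c\<Phi>') auto
  then obtain M2 where M2: "\<And>r. r \<in> {a..b} \<Longrightarrow> norm (\<Phi>' r) \<le> M2"
    unfolding bounded_iff by blast
  have M0: "M1 \<ge> 0" "M2 \<ge> 0"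
    using M1[of a] M2[of a] \<open>a \<le> b\<close> norm_ge_zero order_trans by (auto, blast+)
  have [measurable]: "\<Phi> \<in> borel_measurable borel"
    by (intro borel_measurable_continuous_onI c\<Phi>)
  note [measurable] = c(1)
  have mv_meas: "(\<lambda>r. \<Phi> r *v c r) \<in> borel_measurable borel"
    by (intro measurable_matrix_vector_mult c(1)) measurable
  have cc: "c integrable_on {s..t}" if "a \<le> s" "t \<le> b" for s t
    by (rule bounded_borel_integrable_on) (use c that in \<open>auto intro: bounded_subset\<close>)
  have \<Phi>c: "(\<lambda>r. \<Phi> r *v c r) integrable_on {s..t}" if "a \<le> s" "t \<le> b" for s t
  proof (rule bounded_borel_integrable_on[OF mv_meas])
    have "bounded (\<Phi> ` {a..b})"
      by (intro compact_imp_bounded compact_continuous_image c\<Phi>) auto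
    then have "bounded ((\<lambda>r. \<Phi> r *v c r) ` {a..b})"
      using c(2) by (rule bounded_matrix_vector_mult)
    then show "bounded ((\<lambda>r. \<Phi> r *v c r) ` {s..t})"
      by (rule bounded_subset) (use that in auto)
  qed
  have \<Phi>v: "(\<lambda>r. \<Phi>' r *v v r) integrable_on {s..t}" if "a \<le> s" "t \<le> b" for s t
    using that by (intro integrable_continuous_real mv.continuous_on c\<Phi>' continuous_on_subset[OF cv]) auto
  define f where "f r = \<Phi>' r *v v r + \<Phi> r *v c r" for r
  have f: "f integrable_on {s..t}" if "a \<le> s" "t \<le> b" for s t
    unfolding f_def using \<Phi>c \<Phi>v that by (intro integrable_add) auto
  define H where "H t = \<Phi> t *v v t - integral {a..t} f" for t
  have "H a = H b"
  proof (rule quadratic_increment_imp_eq)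
    fix s t assume st: "a \<le> s" "s \<le> t" "t \<le> b"
    have "integral {a..t} f = integral {a..s} f + integral {s..t} f"
      using st f by (simp add: Henstock_Kurzweil_Integration.integral_combine)
    then have "H t - H s = \<Phi> t *v v t - \<Phi> s *v v s - integral {s..t} f"
      by (simp add: H_def)
    moreover have 1: "((\<lambda>r. \<Phi>' r *v v s) has_integral \<Phi> t *v v s - \<Phi> s *v v s) {s..t}"
    proof (rule fundamental_theorem_of_calculus[OF st(2)])
      fix r
      show "((\<lambda>r. \<Phi> r *v v s) has_vector_derivative \<Phi>' r *v v s) (at r within {s..t})"
        by (rule bounded_linear.has_vector_derivative[OF mv.bounded_linear_left
            has_vector_derivative_at_within[OF \<Phi>(1)]])
    qed
    moreover have 2: "((\<lambda>r. \<Phi> t *v c r) has_integral \<Phi> t *v (v t - v s)) {s..t}"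
      using has_integral_linear[OF v[OF st] matrix_vector_mul_bounded_linear] by (simp add: o_def)
    moreover have 3: "(f has_integral integral {s..t} f) {s..t}"
      using f st by auto
    ultimately have I: "((\<lambda>r. (\<Phi>' r *v v s + \<Phi> t *v c r) - f r) has_integral H t - H s) {s..t}"
      using has_integral_diff[OF has_integral_add[OF 1 2] 3] by (simp add: mv.diff_right)
    have e: "(\<Phi>' r *v v s + \<Phi> t *v c r) - f r = \<Phi>' r *v (v s - v r) + (\<Phi> t - \<Phi> r) *v c r" for r
      by (simp add: f_def mv.diff_right mv.diff_left)
    \<comment> \<open>\<open>M1\<close> bounds \<open>c\<close> and hence the slope of
      \<open>v\<close>; \<open>M2\<close> bounds \<open>\<Phi>'\<close> and hence the slope of
      \<open>\<Phi>\<close>. Each of the two terms of the integrand is therefore at most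
      \<open>M1 * M2 * D * (t - s)\<close>, and integration supplies the second factor
      \<open>t - s\<close>.\<close>
    have "norm (H t - H s) \<le> (2 * M1 * M2 * D * (t - s)) * measure lborel {s..t}"
      using I unfolding e
    proof (rule has_integral_bound_real[where S="{}", rotated 2])
      show "0 \<le> 2 * M1 * M2 * D * (t - s)" using M0 D(1) st by simp
      fix r assume "r \<in> {s..t} - {}"
      then have r: "s \<le> r" "r \<le> t" "a \<le> r" "r \<le> b" using st by auto
      have "norm (v r - v s) \<le> M1 * measure lborel {s..r}"
        using v[OF st(1) r(1,4)] M0 M1 r st
        by (intro has_integral_bound_real[of M1 "{}" c]) auto
      then have 1: "norm (v s - v r) \<le> M1 * (t - s)"
        using r M0 mult_left_mono[of "r - s" "t - s" M1] by (simp add: norm_minus_commute)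
      have "norm (\<Phi> t - \<Phi> r) \<le> M2 * measure lborel {r..t}"
      proof (rule has_integral_bound_real[of M2 "{}" \<Phi>'])
        show "(\<Phi>' has_integral \<Phi> t - \<Phi> r) {r..t}"
          using r \<Phi>(1) by (intro fundamental_theorem_of_calculus) (auto intro: has_vector_derivative_at_within)
      qed (use M0 M2 r st in auto)
      then have 2: "norm (\<Phi> t - \<Phi> r) \<le> M2 * (t - s)"
        using r M0 mult_left_mono[of "t - r" "t - s" M2] by simp
      have "norm (\<Phi>' r *v (v s - v r) + (\<Phi> t - \<Phi> r) *v c r)
          \<le> norm (\<Phi>' r) * norm (v s - v r) * D + norm (\<Phi> t - \<Phi> r) * norm (c r) * D"
        using norm_triangle_mono[OF D(2) D(2)] .
      also have "\<dots> \<le> M2 * (M1 * (t - s)) * D + (M2 * (t - s)) * M1 * D"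
        using 1 2 M1[of r] M2[of r] r st D(1) M0
        by (intro add_mono mult_right_mono mult_mono) auto
      also have "\<dots> = 2 * M1 * M2 * D * (t - s)" by (simp add: algebra_simps)
      finally show "norm (\<Phi>' r *v (v s - v r) + (\<Phi> t - \<Phi> r) *v c r) \<le> 2 * M1 * M2 * D * (t - s)" .
    qed auto
    then show "norm (H t - H s) \<le> (2 * M1 * M2 * D) * (t - s)^2"
      using st by (simp add: power2_eq_square mult_ac)
  qed fact
  then have "integral {a..b} f = \<Phi> b *v v b - \<Phi> a *v v a"
    by (simp add: H_def algebra_simps)
  then show ?thesis
    using f[of a b] unfolding f_def by (auto simp: has_integral_iff)
qed

section \<open>Uniqueness for Lipschitz equations in integrated form\<close>

lemma linear_integral_inequality_forward:
  fixes d :: "real \<Rightarrow> 'a::euclidean_space"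
  assumes "continuous_on {0..b} d" "L > 0"
    and d: "\<And>t. 0 \<le> t \<Longrightarrow> t \<le> b \<Longrightarrow> (h has_integral d t) {0..t}"
    and h: "\<And>u. 0 \<le> u \<Longrightarrow> u \<le> b \<Longrightarrow> norm (h u) \<le> L * norm (d u)"
    and "0 \<le> t" "t \<le> b"
  shows "d t = 0"
proof -
  have "bounded (d ` {0..b})"
    using assms(1) by (intro compact_imp_bounded compact_continuous_image) auto
  then obtain B where "\<forall>x\<in>d ` {0..b}. norm x \<le> B"
    unfolding bounded_iff by blast
  then have B: "norm (d t) \<le> B" if "0 \<le> t" "t \<le> b" for t
    using that by simp
  have B0: "B \<ge> 0" using B[of 0] assms norm_ge_zero[of "d 0"] by linarith
  have "norm (d t) \<le> (B * exp (2 * L * t)) * (1/2)^k" if "0 \<le> t" "t \<le> b" for k t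
    using that
  proof (induction k arbitrary: t)
    case 0
    then show ?case
      using B[OF 0] B0 mult_left_mono[of 1 "exp (2 * L * t)" B] \<open>L > 0\<close> by simp
  next
    case (Suc k)
    \<comment> \<open>The weight \<open>exp (2 * L * t)\<close> is chosen so that integrating
      \<open>L\<close> times it gives at most half of it: each use of the inequality gains a factor
      1/2. The explicit majorant \<open>?g\<close> stands in for the norm of \<open>h\<close>, whose
      integrability is not given.\<close>
    let ?g = "\<lambda>u. L * (B * exp (2 * L * u) * (1/2)^k)"
    have g: "(?g has_integral B * exp (2 * L * t) * (1/2)^Suc k - B * exp (2 * L * 0) * (1/2)^Suc k) {0..t}"
      using Suc.prems
      by (intro fundamental_theorem_of_calculus)
        (auto intro!: derivative_eq_intros simp: has_real_derivative_iff_has_vector_derivative[symmetric])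
    have "norm (integral {0..t} h) \<le> integral {0..t} ?g"
    proof (rule Henstock_Kurzweil_Integration.integral_norm_bound_integral)
      show "h integrable_on {0..t}" "?g integrable_on {0..t}"
        using d[OF Suc.prems] g by blast+
      fix u assume u: "u \<in> {0..t}"
      have "norm (h u) \<le> L * norm (d u)"
        using u Suc.prems by (intro h) auto
      also have "\<dots> \<le> ?g u"
        using u Suc.prems \<open>L > 0\<close> by (intro mult_left_mono Suc.IH) auto
      finally show "norm (h u) \<le> ?g u" .
    qed
    also have "integral {0..t} ?g \<le> B * exp (2 * L * t) * (1/2)^Suc k"
      using integral_unique[OF g] B0 by simp
    finally show ?case
      using integral_unique[OF d[OF Suc.prems]] by simp
  qed
  then have "norm (d t) \<le> (B * exp (2 * L * t)) * (1/2)^k" for k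
    using assms by blast
  then have "norm (d t) \<le> 0" by (rule le_geometric_imp_nonpos) auto
  then show ?thesis by simp
qed

text \<open>Regularity in time enters only through the integrability contained in the two integral
  identities, so \<open>G\<close> may jump in \<open>u\<close>, as the noise makes it do.\<close>

lemma integrated_ode_unique:
  fixes G :: "real \<Rightarrow> 'a::euclidean_space \<Rightarrow> 'a"
  assumes G: "\<And>u x y. norm (G u x - G u y) \<le> L * norm (x - y)"
    and z: "\<And>s t. a \<le> s \<Longrightarrow> s \<le> t \<Longrightarrow> t \<le> b \<Longrightarrow> ((\<lambda>u. G u (z u)) has_integral z t - z s) {s..t}"
    and z': "\<And>s t. a \<le> s \<Longrightarrow> s \<le> t \<Longrightarrow> t \<le> b \<Longrightarrow> ((\<lambda>u. G u (z' u)) has_integral z' t - z' s) {s..t}"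
    and "z 0 = z' 0" "a \<le> 0" "0 \<le> b" "a \<le> t" "t \<le> b"
  shows "z t = z' t"
proof -
  define L' where "L' = \<bar>L\<bar> + 1"
  have L': "L' > 0" "norm (G u x - G u y) \<le> L' * norm (x - y)" for u x y
    using G[of u x y] by (auto simp: L'_def intro!: order_trans[OF G] mult_right_mono)
  have c: "continuous_on {a..b} (\<lambda>t. z t - z' t)"
    by (intro continuous_intros has_integral_increments_continuous_on[of a b "\<lambda>u. G u (z u)"]
        has_integral_increments_continuous_on[of a b "\<lambda>u. G u (z' u)"] z z')
  have d: "((\<lambda>u. G u (z u) - G u (z' u)) has_integral (z t - z' t) - (z s - z' s)) {s..t}"
    if "a \<le> s" "s \<le> t" "t \<le> b" for s t
    using has_integral_diff[OF z[OF that] z'[OF that]] by (simp add: algebra_simps)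
  show ?thesis
  proof (cases "t \<ge> 0")
    case True
    have "z t - z' t = 0"
    proof (rule linear_integral_inequality_forward[OF _ L'(1)])
      show "((\<lambda>u. G u (z u) - G u (z' u)) has_integral z t - z' t) {0..t}" if "0 \<le> t" "t \<le> b" for t
        using d[of 0 t] that assms by simp
      show "continuous_on {0..b} (\<lambda>t. z t - z' t)"
        by (rule continuous_on_subset[OF c]) (use assms in auto)
    qed (use L' assms True in auto)
    then show ?thesis by simp
  next
    case False
    \<comment> \<open>Reflection of time reduces \<open>t < 0\<close> to the forward case; the
      double minus presents the goal as the reflected difference at \<open>- t\<close>.\<close>
    have "z (- (- t)) - z' (- (- t)) = 0"
    proof (rule linear_integral_inequality_forward[OF _ L'(1),
          of "- a" "\<lambda>t. z (- t) - z' (- t)" "\<lambda>u. - (G (- u) (z (- u)) - G (- u) (z' (- u)))" "- t"])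
      show "((\<lambda>u. - (G (- u) (z (- u)) - G (- u) (z' (- u)))) has_integral z (- t) - z' (- t)) {0..t}"
        if "0 \<le> t" "t \<le> - a" for t
      proof -
        have "((\<lambda>u. G u (z u) - G u (z' u)) has_integral - (z (- t) - z' (- t))) {- t..- 0}"
          using d[of "- t" 0] that assms by simp
        then have "((\<lambda>u. G (- u) (z (- u)) - G (- u) (z' (- u))) has_integral - (z (- t) - z' (- t))) {0..t}"
          by (subst (asm) has_integral_reflect_real[symmetric]) simp
        from has_integral_neg[OF this] show ?thesis by simp
      qed
      have "continuous_on {0..- a} ((\<lambda>t. z t - z' t) \<circ> uminus)"
        by (intro continuous_on_compose continuous_intros continuous_on_subset[OF c])
          (use assms in auto)
      then show "continuous_on {0..- a} (\<lambda>t. z (- t) - z' (- t))" by (simp add: o_def)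
      show "norm (- (G (- u) (z (- u)) - G (- u) (z' (- u)))) \<le> L' * norm (z (- u) - z' (- u))" for u
        using L'(2) by (simp only: norm_minus_cancel)
    qed (use assms False in auto)
    then show ?thesis by simp
  qed
qed

section \<open>Weighted contractions\<close>

text \<open>The Lipschitz condition on the nonlinearities and the norm of \<open>C_minus\<close> add
  the norms of the two components. In this norm the contraction constant is exactly
  \<open>q1 + q2\<close>; the Euclidean norm of pairs would spoil it.\<close>

definition sum_norm :: "'a::real_normed_vector \<times> 'b::real_normed_vector \<Rightarrow> real" where
  "sum_norm z = norm (fst z) + norm (snd z)"

lemma sum_norm_nonneg [simp]: "0 \<le> sum_norm z"
  by (simp add: sum_norm_def)

lemma sum_norm_0 [simp]: "sum_norm 0 = 0"
  by (simp add: sum_norm_def)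

lemma sum_norm_triangle: "sum_norm (a + b) \<le> sum_norm a + sum_norm b"
  unfolding sum_norm_def using norm_triangle_ineq[of "fst a" "fst b"] norm_triangle_ineq[of "snd a" "snd b"]
  by simp

lemma sum_norm_triangle_diff: "sum_norm (a - b) \<le> sum_norm (a - c) + sum_norm (c - b)"
  using sum_norm_triangle[of "a - c" "c - b"] by simp

lemma sum_norm_minus_commute: "sum_norm (a - b) = sum_norm (b - a)"
  by (simp add: sum_norm_def norm_minus_commute)

lemma norm_le_sum_norm: "norm z \<le> sum_norm z"
  by (metis norm_Pair_le prod.collapse sum_norm_def)

lemma sum_norm_le_norm: "sum_norm z \<le> 2 * norm z"
  using norm_fst_le[of "fst z" "snd z"] norm_snd_le[of "snd z" "fst z"] by (simp add: sum_norm_def)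

lemma sum_norm_eq_0_iff [simp]: "sum_norm z = 0 \<longleftrightarrow> z = 0"
  by (auto simp: sum_norm_def add_nonneg_eq_0_iff prod_eq_iff)

definition weighted_bounded :: "(real \<Rightarrow> real) \<Rightarrow> (real \<Rightarrow> 'a::real_normed_vector \<times> 'b::real_normed_vector) \<Rightarrow> bool" where
  "weighted_bounded p z \<longleftrightarrow> (\<exists>D. \<forall>t. sum_norm (z t) \<le> D * p t)"

text \<open>Each component has its own Lipschitz bound in terms of the whole state, so that slow and
  fast contributions can be followed separately. The growth condition at 0 keeps the integral
  operator inside the weighted space.\<close>

definition admissible_field ::
    "real \<Rightarrow> (real \<Rightarrow> real) \<Rightarrow> (real \<Rightarrow> (real^'m) \<times> (real^'n) \<Rightarrow> (real^'m) \<times> (real^'n)) \<Rightarrow> bool" where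
  "admissible_field K p f \<longleftrightarrow>
     (\<lambda>(s, z). f s z) \<in> borel_measurable (borel \<Otimes>\<^sub>M borel)
     \<and> (\<forall>s a b. norm (fst (f s a) - fst (f s b)) \<le> K * sum_norm (a - b))
     \<and> (\<forall>s a b. norm (snd (f s a) - snd (f s b)) \<le> K * sum_norm (a - b))
     \<and> (\<exists>D. \<forall>s. sum_norm (f s 0) \<le> D * p s)"

text \<open>\<open>k_le\<close> is a Schur test: the weight \<open>p\<close> is reproduced by the
  kernel up to a factor. Keeping \<open>q1\<close> and \<open>q2\<close> apart preserves the fast
  share, which reappears in the Lipschitz constant of the manifold.\<close>

locale weighted_kernel =
  fixes \<kappa>1 :: "real \<Rightarrow> real \<Rightarrow> real^'m^'m" and \<kappa>2 :: "real \<Rightarrow> real \<Rightarrow> real^'n^'n"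
    and k1 k2 :: "real \<Rightarrow> real \<Rightarrow> real" and p :: "real \<Rightarrow> real" and K q1 q2 :: real
  assumes \<kappa>_measurable [measurable]:
      "(\<lambda>(t, s). \<kappa>1 t s) \<in> borel_measurable (borel \<Otimes>\<^sub>M borel)"
      "(\<lambda>(t, s). \<kappa>2 t s) \<in> borel_measurable (borel \<Otimes>\<^sub>M borel)"
    and \<kappa>_le: "norm (\<kappa>1 t s *v x) \<le> k1 t s * norm x" "norm (\<kappa>2 t s *v y) \<le> k2 t s * norm y"
    and k_nonneg: "k1 t s \<ge> 0" "k2 t s \<ge> 0"
    and k_integrable: "integrable lborel (\<lambda>s. k1 t s * p s)" "integrable lborel (\<lambda>s. k2 t s * p s)"
    and k_le: "K * (\<integral>s. k1 t s * p s \<partial>lborel) \<le> q1 * p t" "K * (\<integral>s. k2 t s * p s \<partial>lborel) \<le> q2 * p t"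
    and p_pos: "p t > 0"
    and q: "q1 + q2 < 1" "q1 \<ge> 0" "q2 \<ge> 0" and K_pos: "K > 0"
begin

definition kop :: "(real \<Rightarrow> (real^'m) \<times> (real^'n)) \<Rightarrow> (real \<Rightarrow> (real^'m) \<times> (real^'n) \<Rightarrow> (real^'m) \<times> (real^'n)) \<Rightarrow>
    (real \<Rightarrow> (real^'m) \<times> (real^'n)) \<Rightarrow> real \<Rightarrow> (real^'m) \<times> (real^'n)" where
  "kop c f z t = c t + (\<integral>s. \<kappa>1 t s *v fst (f s (z s)) \<partial>lborel, \<integral>s. \<kappa>2 t s *v snd (f s (z s)) \<partial>lborel)"

section \<open>Estimates for the kernel operator\<close>

lemma field_bound:
  assumes "admissible_field K p f" "weighted_bounded p z"
  obtains D where "D \<ge> 0" "\<And>s. norm (fst (f s (z s))) \<le> D * p s" "\<And>s. norm (snd (f s (z s))) \<le> D * p s"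
proof -
  obtain D1 where D1: "\<And>s. sum_norm (f s 0) \<le> D1 * p s"
    using assms(1) by (auto simp: admissible_field_def)
  obtain D2 where D2: "\<And>s. sum_norm (z s) \<le> D2 * p s"
    using assms(2) by (auto simp: weighted_bounded_def)
  have L: "norm (fst (f s a) - fst (f s 0)) \<le> K * sum_norm a" "norm (snd (f s a) - snd (f s 0)) \<le> K * sum_norm a" for s a
    using assms(1) by (metis admissible_field_def diff_zero)+
  have D0: "norm (fst (f s 0)) \<le> D1 * p s" "norm (snd (f s 0)) \<le> D1 * p s" for s
    using D1[of s] norm_ge_zero[of "fst (f s 0)"] norm_ge_zero[of "snd (f s 0)"] unfolding sum_norm_def by linarith+
  show ?thesis
  proof (rule that[of "\<bar>K * D2 + D1\<bar>"])
    fix s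
    have K: "K * sum_norm (z s) \<le> K * (D2 * p s)" using D2[of s] K_pos by simp
    have le: "K * (D2 * p s) + D1 * p s \<le> \<bar>K * D2 + D1\<bar> * p s"
      using mult_right_mono[OF abs_ge_self[of "K * D2 + D1"], of "p s"] p_pos[of s] by (simp add: algebra_simps)
    show "norm (fst (f s (z s))) \<le> \<bar>K * D2 + D1\<bar> * p s"
      using L(1)[of s "z s"] D0(1)[of s] K le norm_triangle_sub[of "fst (f s (z s))" "fst (f s 0)"] by linarith
    show "norm (snd (f s (z s))) \<le> \<bar>K * D2 + D1\<bar> * p s"
      using L(2)[of s "z s"] D0(2)[of s] K le norm_triangle_sub[of "snd (f s (z s))" "snd (f s 0)"] by linarith
  qed simp
qed

text \<open>The factor \<open>K\<close> stays on the left because \<open>k_le\<close> bounds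
  \<open>K\<close> times the integral of the kernel.\<close>

lemma kernel_integral_bound:
  assumes [measurable]: "h1 \<in> borel_measurable borel" "h2 \<in> borel_measurable borel"
    and h: "\<And>s. norm (h1 s) \<le> D * p s" "\<And>s. norm (h2 s) \<le> D * p s" and "D \<ge> 0"
  shows "integrable lborel (\<lambda>s. \<kappa>1 t s *v h1 s)" "norm (\<integral>s. \<kappa>1 t s *v h1 s \<partial>lborel) * K \<le> D * q1 * p t"
    "integrable lborel (\<lambda>s. \<kappa>2 t s *v h2 s)" "norm (\<integral>s. \<kappa>2 t s *v h2 s \<partial>lborel) * K \<le> D * q2 * p t"
proof -
  have m1: "(\<lambda>s. \<kappa>1 t s) \<in> borel_measurable lborel" "(\<lambda>s. \<kappa>2 t s) \<in> borel_measurable lborel"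
    by measurable
  have b1: "norm (\<kappa>1 t s *v h1 s) \<le> D * (k1 t s * p s)" for s
    using order_trans[OF \<kappa>_le(1) mult_left_mono[OF h(1) k_nonneg(1)]] by (simp add: mult_ac)
  have b2: "norm (\<kappa>2 t s *v h2 s) \<le> D * (k2 t s * p s)" for s
    using order_trans[OF \<kappa>_le(2) mult_left_mono[OF h(2) k_nonneg(2)]] by (simp add: mult_ac)
  have i: "integrable lborel (\<lambda>s. D * (k1 t s * p s))" "integrable lborel (\<lambda>s. D * (k2 t s * p s))"
    by (intro integrable_mult_right k_integrable)+
  show 1: "integrable lborel (\<lambda>s. \<kappa>1 t s *v h1 s)"
    by (rule Bochner_Integration.integrable_bound[OF i(1)])
      (use b1 in \<open>auto intro!: measurable_matrix_vector_mult m1 AE_I2 intro: order_trans[OF _ abs_ge_self]\<close>)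
  show 2: "integrable lborel (\<lambda>s. \<kappa>2 t s *v h2 s)"
    by (rule Bochner_Integration.integrable_bound[OF i(2)])
      (use b2 in \<open>auto intro!: measurable_matrix_vector_mult m1 AE_I2 intro: order_trans[OF _ abs_ge_self]\<close>)
  have "norm (\<integral>s. \<kappa>1 t s *v h1 s \<partial>lborel) \<le> D * (\<integral>s. k1 t s * p s \<partial>lborel)"
    using Bochner_Integration.integral_norm_bound_integral[OF 1 i(1)] b1 by simp
  from mult_right_mono[OF this less_imp_le[OF K_pos]]
  have "norm (\<integral>s. \<kappa>1 t s *v h1 s \<partial>lborel) * K \<le> D * (K * (\<integral>s. k1 t s * p s \<partial>lborel))"
    by (simp add: mult_ac)
  also have "\<dots> \<le> D * (q1 * p t)"
    by (rule mult_left_mono[OF k_le(1) \<open>D \<ge> 0\<close>])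
  finally show "norm (\<integral>s. \<kappa>1 t s *v h1 s \<partial>lborel) * K \<le> D * q1 * p t"
    by (simp add: mult_ac)
  have "norm (\<integral>s. \<kappa>2 t s *v h2 s \<partial>lborel) \<le> D * (\<integral>s. k2 t s * p s \<partial>lborel)"
    using Bochner_Integration.integral_norm_bound_integral[OF 2 i(2)] b2 by simp
  from mult_right_mono[OF this less_imp_le[OF K_pos]]
  have "norm (\<integral>s. \<kappa>2 t s *v h2 s \<partial>lborel) * K \<le> D * (K * (\<integral>s. k2 t s * p s \<partial>lborel))"
    by (simp add: mult_ac)
  also have "\<dots> \<le> D * (q2 * p t)"
    by (rule mult_left_mono[OF k_le(2) \<open>D \<ge> 0\<close>])
  finally show "norm (\<integral>s. \<kappa>2 t s *v h2 s \<partial>lborel) * K \<le> D * q2 * p t"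
    by (simp add: mult_ac)
qed

lemma measurable_field:
  assumes "admissible_field K p f" "z \<in> borel_measurable borel"
  shows "(\<lambda>s. f s (z s)) \<in> borel_measurable borel"
    "(\<lambda>s. fst (f s (z s))) \<in> borel_measurable borel" "(\<lambda>s. snd (f s (z s))) \<in> borel_measurable borel"
proof -
  have [measurable]: "(\<lambda>(s, z). f s z) \<in> borel_measurable (borel \<Otimes>\<^sub>M borel)"
    using assms by (simp add: admissible_field_def)
  note [measurable] = assms(2)
  show *: "(\<lambda>s. f s (z s)) \<in> borel_measurable borel" by measurable
  show "(\<lambda>s. fst (f s (z s))) \<in> borel_measurable borel"
    by (rule measurable_compose[OF * borel_measurable_continuous_onI]) (intro continuous_intros)
  show "(\<lambda>s. snd (f s (z s))) \<in> borel_measurable borel"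
    by (rule measurable_compose[OF * borel_measurable_continuous_onI]) (intro continuous_intros)
qed

lemma kop_integrable:
  assumes "admissible_field K p f" "z \<in> borel_measurable borel" "weighted_bounded p z"
  shows "integrable lborel (\<lambda>s. \<kappa>1 t s *v fst (f s (z s)))" "integrable lborel (\<lambda>s. \<kappa>2 t s *v snd (f s (z s)))"
proof -
  obtain D where D: "D \<ge> 0" "\<And>s. norm (fst (f s (z s))) \<le> D * p s" "\<And>s. norm (snd (f s (z s))) \<le> D * p s"
    using field_bound[OF assms(1,3)] by blast
  note b = kernel_integral_bound[OF measurable_field(2,3)[OF assms(1,2)] D(2,3,1)]
  show "integrable lborel (\<lambda>s. \<kappa>1 t s *v fst (f s (z s)))" "integrable lborel (\<lambda>s. \<kappa>2 t s *v snd (f s (z s)))"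
    by (fact b(1) b(3))+
qed

lemma kop_weighted_bounded:
  assumes f: "admissible_field K p f" and z: "z \<in> borel_measurable borel" "weighted_bounded p z"
    and "weighted_bounded p c"
  shows "weighted_bounded p (kop c f z)"
proof -
  obtain C where C: "\<And>t. sum_norm (c t) \<le> C * p t" using assms(4) by (auto simp: weighted_bounded_def)
  obtain D where D: "D \<ge> 0" "\<And>s. norm (fst (f s (z s))) \<le> D * p s" "\<And>s. norm (snd (f s (z s))) \<le> D * p s"
    using field_bound[OF f z(2)] by blast
  note b = kernel_integral_bound[OF measurable_field(2,3)[OF f z(1)] D(2,3,1)]
  have "sum_norm (kop c f z t) \<le> (C + (D * q1 + D * q2) / K) * p t" for t
  proof -
    have "sum_norm (kop c f z t) \<le> C * p t + (norm (\<integral>s. \<kappa>1 t s *v fst (f s (z s)) \<partial>lborel)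
        + norm (\<integral>s. \<kappa>2 t s *v snd (f s (z s)) \<partial>lborel))"
      unfolding kop_def by (rule order_trans[OF sum_norm_triangle]) (use C in \<open>simp add: sum_norm_def\<close>)
    moreover have "norm (\<integral>s. \<kappa>1 t s *v fst (f s (z s)) \<partial>lborel) \<le> D * q1 * p t / K"
      "norm (\<integral>s. \<kappa>2 t s *v snd (f s (z s)) \<partial>lborel) \<le> D * q2 * p t / K"
      using b(2,4)[of t] K_pos by (simp_all add: pos_le_divide_eq)
    ultimately show ?thesis by (simp add: field_simps add_divide_distrib)
  qed
  then show ?thesis unfolding weighted_bounded_def by blast
qed

text \<open>The sum gives the contraction. The second component alone, with \<open>q2\<close> in
  place of \<open>q1 + q2\<close>, gives the sharper bound used for the manifold.\<close>

lemma kop_diff: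
  assumes f: "admissible_field K p f" and z: "z \<in> borel_measurable borel" "weighted_bounded p z"
    and z': "z' \<in> borel_measurable borel" "weighted_bounded p z'"
    and D: "\<And>t. sum_norm (z t - z' t) \<le> D * p t"
  shows "norm (fst (kop c f z t) - fst (kop c' f z' t)) \<le> norm (fst (c t) - fst (c' t)) + q1 * D * p t"
    "norm (snd (kop c f z t) - snd (kop c' f z' t)) \<le> norm (snd (c t) - snd (c' t)) + q2 * D * p t"
    "sum_norm (kop c f z t - kop c' f z' t) \<le> sum_norm (c t - c' t) + (q1 + q2) * D * p t"
proof -
  have "0 \<le> D * p 0" using order_trans[OF sum_norm_nonneg D[of 0]] .
  then have D0: "D \<ge> 0" using p_pos[of 0] by (simp add: zero_le_mult_iff)
  let ?h1 = "\<lambda>s. fst (f s (z s)) - fst (f s (z' s))" and ?h2 = "\<lambda>s. snd (f s (z s)) - snd (f s (z' s))"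
  have h: "norm (?h1 s) \<le> (K * D) * p s" "norm (?h2 s) \<le> (K * D) * p s" for s
  proof -
    have "K * sum_norm (z s - z' s) \<le> (K * D) * p s" using D[of s] K_pos by simp
    moreover have "norm (?h1 s) \<le> K * sum_norm (z s - z' s)" "norm (?h2 s) \<le> K * sum_norm (z s - z' s)"
      using f unfolding admissible_field_def by blast+
    ultimately show "norm (?h1 s) \<le> (K * D) * p s" "norm (?h2 s) \<le> (K * D) * p s"
      by (blast intro: order_trans)+
  qed
  have m: "?h1 \<in> borel_measurable borel" "?h2 \<in> borel_measurable borel"
    using measurable_field[OF f z(1)] measurable_field[OF f z'(1)] by measurable
  note b = kernel_integral_bound[OF m h]
  note i = kop_integrable[OF f z] kop_integrable[OF f z']
  have e1: "fst (kop c f z t) - fst (kop c' f z' t) = (fst (c t) - fst (c' t)) + (\<integral>s. \<kappa>1 t s *v ?h1 s \<partial>lborel)"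
    using i by (simp add: kop_def matrix_vector_mult_diff_distrib)
  have e2: "snd (kop c f z t) - snd (kop c' f z' t) = (snd (c t) - snd (c' t)) + (\<integral>s. \<kappa>2 t s *v ?h2 s \<partial>lborel)"
    using i by (simp add: kop_def matrix_vector_mult_diff_distrib)
  have "norm (\<integral>s. \<kappa>1 t s *v ?h1 s \<partial>lborel) * K \<le> (q1 * D * p t) * K"
    "norm (\<integral>s. \<kappa>2 t s *v ?h2 s \<partial>lborel) * K \<le> (q2 * D * p t) * K"
    using b(2,4)[of t] D0 K_pos by (simp_all add: mult_ac)
  then have b': "norm (\<integral>s. \<kappa>1 t s *v ?h1 s \<partial>lborel) \<le> q1 * D * p t" "norm (\<integral>s. \<kappa>2 t s *v ?h2 s \<partial>lborel) \<le> q2 * D * p t"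
    using K_pos by simp_all
  show 1: "norm (fst (kop c f z t) - fst (kop c' f z' t)) \<le> norm (fst (c t) - fst (c' t)) + q1 * D * p t"
    unfolding e1 using b'(1) by (intro order_trans[OF norm_triangle_ineq]) simp
  show 2: "norm (snd (kop c f z t) - snd (kop c' f z' t)) \<le> norm (snd (c t) - snd (c' t)) + q2 * D * p t"
    unfolding e2 using b'(2) by (intro order_trans[OF norm_triangle_ineq]) simp
  show "sum_norm (kop c f z t - kop c' f z' t) \<le> sum_norm (c t - c' t) + (q1 + q2) * D * p t"
    using 1 2 by (simp add: sum_norm_def algebra_simps)
qed

lemma weighted_bounded_diff:
  assumes "weighted_bounded p z" "weighted_bounded p z'"
  obtains D where "\<And>t. sum_norm (z t - z' t) \<le> D * p t"
proof -
  obtain C C' where "\<And>t. sum_norm (z t) \<le> C * p t" "\<And>t. sum_norm (z' t) \<le> C' * p t"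
    using assms unfolding weighted_bounded_def by blast
  then have "sum_norm (z t - z' t) \<le> (C + C') * p t" for t
    using sum_norm_triangle_diff[of "z t" "z' t" 0] add_mono[of "sum_norm (z t)" "C * p t" "sum_norm (z' t)" "C' * p t"]
    by (simp add: sum_norm_def distrib_right)
  then show ?thesis by (rule that)
qed

lemma fixed_point_diff:
  assumes f: "admissible_field K p f" and z: "z \<in> borel_measurable borel" "weighted_bounded p z"
    and z': "z' \<in> borel_measurable borel" "weighted_bounded p z'"
    and fp: "\<And>t. z t = kop c f z t" "\<And>t. z' t = kop c' f z' t"
    and \<delta>: "\<And>t. sum_norm (c t - c' t) \<le> \<delta> * p t"
  shows "sum_norm (z t - z' t) \<le> \<delta> / (1 - (q1 + q2)) * p t"
proof -
  obtain D where D: "\<And>t. sum_norm (z t - z' t) \<le> D * p t"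
    using weighted_bounded_diff[OF z(2) z'(2)] by blast
  let ?r = "q1 + q2"
  \<comment> \<open>\<open>B\<close> is the fixed point of the affine map by which
    \<open>kop_diff\<close> improves a bound; the excess \<open>D - B\<close> of any initial bound
    shrinks by \<open>?r\<close> in each round.\<close>
  define B where "B = \<delta> / (1 - ?r)"
  have B: "B = \<delta> + ?r * B"
    using q(1) by (simp add: B_def field_simps)
  have "sum_norm (z t - z' t) \<le> (B + (D - B) * ?r ^ k) * p t" for k t
  proof (induction k arbitrary: t)
    case 0
    then show ?case using D by simp
  next
    case (Suc k)
    have "sum_norm (z t - z' t) \<le> sum_norm (c t - c' t) + ?r * (B + (D - B) * ?r ^ k) * p t"
      using kop_diff(3)[OF f z z' Suc.IH, of c t c'] unfolding fp(1)[symmetric] fp(2)[symmetric] .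
    also have "\<dots> \<le> \<delta> * p t + ?r * (B + (D - B) * ?r ^ k) * p t"
      using \<delta> by simp
    also have "\<dots> = ((\<delta> + ?r * B) + (D - B) * ?r ^ Suc k) * p t"
      by (simp add: algebra_simps)
    finally show ?case by (simp only: B[symmetric])
  qed
  then have "sum_norm (z t - z' t) - B * p t \<le> ((D - B) * p t) * ?r ^ k" for k
    by (simp add: algebra_simps)
  then have "sum_norm (z t - z' t) - B * p t \<le> 0"
    by (rule le_geometric_imp_nonpos) (use q in auto)
  then show ?thesis by (simp add: B_def)
qed

lemma fixed_point_unique:
  assumes f: "admissible_field K p f" and z: "z \<in> borel_measurable borel" "weighted_bounded p z"
    and z': "z' \<in> borel_measurable borel" "weighted_bounded p z'"
    and fp: "\<And>t. z t = kop c f z t" "\<And>t. z' t = kop c f z' t"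
  shows "z t = z' t"
  using fixed_point_diff[OF f z z' fp, of 0 t] sum_norm_nonneg[of "z t - z' t"]
  by (simp add: antisym)

section \<open>Iteration, measurability in a parameter, and existence of the fixed point\<close>

primrec iterate :: "(real \<Rightarrow> (real^'m) \<times> (real^'n)) \<Rightarrow> (real \<Rightarrow> (real^'m) \<times> (real^'n) \<Rightarrow> (real^'m) \<times> (real^'n)) \<Rightarrow>
    nat \<Rightarrow> real \<Rightarrow> (real^'m) \<times> (real^'n)" where
  "iterate c f 0 = (\<lambda>t. 0)"
| "iterate c f (Suc k) = kop c f (iterate c f k)"

text \<open>A pointwise \<open>lim\<close> rather than a chosen element of a function space:
  \<open>lim\<close> preserves measurability even at points where the iterates diverge, which makes
  joint measurability in a parameter immediate.\<close>

definition fixed_point :: "(real \<Rightarrow> (real^'m) \<times> (real^'n)) \<Rightarrow> (real \<Rightarrow> (real^'m) \<times> (real^'n) \<Rightarrow> (real^'m) \<times> (real^'n)) \<Rightarrow>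
    real \<Rightarrow> (real^'m) \<times> (real^'n)" where
  "fixed_point c f t = lim (\<lambda>k. iterate c f k t)"

text \<open>The parameter space \<open>N\<close> is left open: for the manifold it carries the noise
  path, for the flow the pair of path and initial value.\<close>

lemma kop_measurable_param:
  assumes [measurable]: "(\<lambda>(w, t). c w t) \<in> borel_measurable (N \<Otimes>\<^sub>M borel)"
    "(\<lambda>(w, s, z). f w s z) \<in> borel_measurable (N \<Otimes>\<^sub>M (borel \<Otimes>\<^sub>M borel))"
    "(\<lambda>(w, t). z w t) \<in> borel_measurable (N \<Otimes>\<^sub>M borel)"
  shows "(\<lambda>(w, t). kop (c w) (f w) (z w) t) \<in> borel_measurable (N \<Otimes>\<^sub>M borel)"
proof -
  have z': "(\<lambda>x. z (fst (fst x)) (snd x)) \<in> borel_measurable ((N \<Otimes>\<^sub>M borel) \<Otimes>\<^sub>M lborel)"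
    using measurable_compose[OF _ assms(3), of "\<lambda>x. (fst (fst x), snd x)" "(N \<Otimes>\<^sub>M borel) \<Otimes>\<^sub>M lborel"] by simp
  have f': "(\<lambda>x. f (fst (fst x)) (snd x) (z (fst (fst x)) (snd x))) \<in> borel_measurable ((N \<Otimes>\<^sub>M borel) \<Otimes>\<^sub>M lborel)"
    using measurable_compose[OF _ assms(2), of "\<lambda>x. (fst (fst x), snd x, z (fst (fst x)) (snd x))" "(N \<Otimes>\<^sub>M borel) \<Otimes>\<^sub>M lborel"] z'
    by simp
  have 1: "(\<lambda>((w, t), s). \<kappa>1 t s *v fst (f w s (z w s))) \<in> borel_measurable ((N \<Otimes>\<^sub>M borel) \<Otimes>\<^sub>M lborel)"
    unfolding split_beta
  proof (rule measurable_matrix_vector_mult)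
    show "(\<lambda>w. \<kappa>1 (snd (fst w)) (snd w)) \<in> borel_measurable ((N \<Otimes>\<^sub>M borel) \<Otimes>\<^sub>M lborel)"
      by measurable
    show "(\<lambda>w. fst (f (fst (fst w)) (snd w) (z (fst (fst w)) (snd w)))) \<in> borel_measurable ((N \<Otimes>\<^sub>M borel) \<Otimes>\<^sub>M lborel)"
      by (rule measurable_compose[OF f' borel_measurable_continuous_onI]) (intro continuous_intros)
  qed
  have 2: "(\<lambda>((w, t), s). \<kappa>2 t s *v snd (f w s (z w s))) \<in> borel_measurable ((N \<Otimes>\<^sub>M borel) \<Otimes>\<^sub>M lborel)"
    unfolding split_beta
  proof (rule measurable_matrix_vector_mult)
    show "(\<lambda>w. \<kappa>2 (snd (fst w)) (snd w)) \<in> borel_measurable ((N \<Otimes>\<^sub>M borel) \<Otimes>\<^sub>M lborel)"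
      by measurable
    show "(\<lambda>w. snd (f (fst (fst w)) (snd w) (z (fst (fst w)) (snd w)))) \<in> borel_measurable ((N \<Otimes>\<^sub>M borel) \<Otimes>\<^sub>M lborel)"
      by (rule measurable_compose[OF f' borel_measurable_continuous_onI]) (intro continuous_intros)
  qed
  have i1: "(\<lambda>(w, t). \<integral>s. \<kappa>1 t s *v fst (f w s (z w s)) \<partial>lborel) \<in> borel_measurable (N \<Otimes>\<^sub>M borel)"
    unfolding split_beta by (rule lborel.borel_measurable_lebesgue_integral) (use 1 in \<open>simp add: split_beta'\<close>)
  have i2: "(\<lambda>(w, t). \<integral>s. \<kappa>2 t s *v snd (f w s (z w s)) \<partial>lborel) \<in> borel_measurable (N \<Otimes>\<^sub>M borel)"
    unfolding split_beta by (rule lborel.borel_measurable_lebesgue_integral) (use 2 in \<open>simp add: split_beta'\<close>)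
  show ?thesis
    unfolding kop_def split_beta
    using assms(1) i1 i2 by (intro borel_measurable_add borel_measurable_Pair) (auto simp: split_beta')
qed

lemma iterate_measurable_param:
  assumes "(\<lambda>(w, t). c w t) \<in> borel_measurable (N \<Otimes>\<^sub>M borel)"
    "(\<lambda>(w, s, z). f w s z) \<in> borel_measurable (N \<Otimes>\<^sub>M (borel \<Otimes>\<^sub>M borel))"
  shows "(\<lambda>(w, t). iterate (c w) (f w) k t) \<in> borel_measurable (N \<Otimes>\<^sub>M borel)"
proof (induction k)
  case (Suc k)
  show ?case using kop_measurable_param[OF assms Suc] by simp
qed simp

lemma fixed_point_measurable_param:
  assumes "(\<lambda>(w, t). c w t) \<in> borel_measurable (N \<Otimes>\<^sub>M borel)"
    "(\<lambda>(w, s, z). f w s z) \<in> borel_measurable (N \<Otimes>\<^sub>M (borel \<Otimes>\<^sub>M borel))"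
  shows "(\<lambda>(w, t). fixed_point (c w) (f w) t) \<in> borel_measurable (N \<Otimes>\<^sub>M borel)"
  unfolding fixed_point_def split_beta
  by (rule borel_measurable_lim_metric) (use iterate_measurable_param[OF assms] in \<open>simp add: split_beta'\<close>)

text \<open>Banach's argument carried out pointwise in \<open>t\<close>, with explicit geometric
  rates in the weighted norm. The limit inherits measurability from the iterates, and the distance
  to the zeroth iterate gives its weighted bound.\<close>

lemma fixed_point:
  assumes f: "admissible_field K p f" and c: "c \<in> borel_measurable borel" "weighted_bounded p c"
  shows fixed_point_measurable: "fixed_point c f \<in> borel_measurable borel"
    and fixed_point_weighted_bounded: "weighted_bounded p (fixed_point c f)"
    and fixed_point_eq: "fixed_point c f t = kop c f (fixed_point c f) t"
proof -
  let ?it = "iterate c f" and ?r = "q1 + q2"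
  have m: "?it k \<in> borel_measurable borel" for k
  proof -
    \<comment> \<open>A one-point parameter space turns the parametrised statement into
      measurability in \<open>t\<close> alone.\<close>
    have "(\<lambda>(w::unit, t). ?it k t) \<in> borel_measurable (count_space UNIV \<Otimes>\<^sub>M borel)"
      by (rule iterate_measurable_param) (use f c(1) in \<open>auto simp: split_beta' admissible_field_def\<close>)
    from measurable_compose[OF _ this, of "\<lambda>t. ((), t)" borel] show ?thesis by simp
  qed
  have wb: "weighted_bounded p (?it k)" for k
    by (induction k) (use f c m kop_weighted_bounded in \<open>auto simp: weighted_bounded_def[of p "\<lambda>_. 0"] intro!: exI[of _ 0]\<close>)
  obtain D where D: "\<And>t. sum_norm (?it 0 t - ?it 1 t) \<le> D * p t"
    using weighted_bounded_diff[OF wb wb] by blast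
  have "0 \<le> D * p 0" using order_trans[OF sum_norm_nonneg D[of 0]] .
  then have D0: "D \<ge> 0" using p_pos[of 0] by (simp add: zero_le_mult_iff)
  have step: "sum_norm (?it k t - ?it (Suc k) t) \<le> (D * ?r ^ k) * p t" for k t
  proof (induction k arbitrary: t)
    case 0
    then show ?case using D by simp
  next
    case (Suc k)
    show ?case
      using kop_diff(3)[OF f m wb m wb Suc.IH, of c t c] by (simp add: mult_ac)
  qed
  have far: "sum_norm (?it k t - ?it (k + j) t) \<le> (D / (1 - ?r) * ?r ^ k) * p t" for k j t
  proof -
    \<comment> \<open>Retaining the term \<open>?r ^ (k + j)\<close> makes the geometric partial sum
      exact, so that the induction on \<open>j\<close> closes; it is dropped afterwards.\<close>
    have "sum_norm (?it k t - ?it (k + j) t) \<le> (D / (1 - ?r) * (?r ^ k - ?r ^ (k + j))) * p t"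
    proof (induction j)
      case (Suc j)
      have "sum_norm (?it k t - ?it (k + Suc j) t)
        \<le> (D / (1 - ?r) * (?r ^ k - ?r ^ (k + j))) * p t + (D * ?r ^ (k + j)) * p t"
        using sum_norm_triangle_diff[of "?it k t" "?it (k + Suc j) t" "?it (k + j) t"] Suc.IH step[of "k + j" t]
        by simp
      also have "\<dots> = (D / (1 - ?r) * (?r ^ k - ?r ^ (k + Suc j))) * p t"
        using q(1) by (simp add: field_simps)
      finally show ?case .
    qed simp
    also have "\<dots> \<le> (D / (1 - ?r) * ?r ^ k) * p t"
      using p_pos[of t] D0 q by (intro mult_right_mono mult_left_mono) auto
    finally show ?thesis .
  qed
  have "Cauchy (\<lambda>k. ?it k t)" for t
  proof (rule metric_CauchyI)
    fix e :: real assume "e > 0"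
    have "(\<lambda>k. D / (1 - ?r) * ?r ^ k * p t) \<longlonglongrightarrow> D / (1 - ?r) * 0 * p t"
      using q by (intro tendsto_mult tendsto_const LIMSEQ_realpow_zero) auto
    then have "eventually (\<lambda>k. D / (1 - ?r) * ?r ^ k * p t < e / 2) sequentially"
      by (rule order_tendstoD) (use \<open>e > 0\<close> in simp)
    then obtain N where N: "D / (1 - ?r) * ?r ^ N * p t < e / 2"
      unfolding eventually_sequentially by blast
    have d: "dist (?it N t) (?it n t) < e / 2" if "n \<ge> N" for n
    proof -
      have "dist (?it N t) (?it n t) \<le> sum_norm (?it N t - ?it (N + (n - N)) t)"
        using that norm_le_sum_norm by (simp add: dist_norm)
      also have "\<dots> < e / 2" using far[of N t "n - N"] N by (rule le_less_trans)
      finally show ?thesis .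
    qed
    have "dist (?it m t) (?it n t) < e" if "m \<ge> N" "n \<ge> N" for m n
      using dist_triangle_half_r[of "?it N t" "?it m t" e "?it n t"] d[OF that(1)] d[OF that(2)] by simp
    then show "\<exists>M. \<forall>m\<ge>M. \<forall>n\<ge>M. dist (?it m t) (?it n t) < e" by blast
  qed
  then have lim: "(\<lambda>k. ?it k t) \<longlonglongrightarrow> fixed_point c f t" for t
    unfolding fixed_point_def by (intro convergent_LIMSEQ_iff[THEN iffD1] Cauchy_convergent)
  have cs: "isCont sum_norm z" for z :: "(real^'m) \<times> (real^'n)"
    unfolding sum_norm_def by (intro continuous_intros)
  have near: "sum_norm (?it k t - fixed_point c f t) \<le> (D / (1 - ?r) * ?r ^ k) * p t" for k t
  proof (rule LIMSEQ_le_const2)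
    show "(\<lambda>j. sum_norm (?it k t - ?it (j + k) t)) \<longlonglongrightarrow> sum_norm (?it k t - fixed_point c f t)"
      by (intro isCont_tendsto_compose[OF cs] tendsto_intros LIMSEQ_ignore_initial_segment lim)
    show "\<exists>N. \<forall>j\<ge>N. sum_norm (?it k t - ?it (j + k) t) \<le> (D / (1 - ?r) * ?r ^ k) * p t"
      using far[of k t] by (simp add: add.commute)
  qed
  show m': "fixed_point c f \<in> borel_measurable borel"
    by (rule borel_measurable_LIMSEQ_metric[OF m lim])
  show wb': "weighted_bounded p (fixed_point c f)"
    unfolding weighted_bounded_def using near[of 0] by (auto simp: sum_norm_def intro!: exI[of _ "D / (1 - ?r)"])
  \<comment> \<open>The defect is split at \<open>?it (Suc k)\<close>, which is close to the limit
    and is also \<open>kop\<close> of \<open>?it k\<close>, hence close to \<open>kop\<close> of the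
    limit.\<close>
  have "sum_norm (fixed_point c f t - kop c f (fixed_point c f) t) \<le> (2 * (D / (1 - ?r) * ?r) * p t) * ?r ^ k" for k
  proof -
    have "sum_norm (?it (Suc k) t - kop c f (fixed_point c f) t) \<le> ?r * (D / (1 - ?r) * ?r ^ k) * p t"
      using kop_diff(3)[OF f m wb m' wb' near, where c=c and c'=c and t=t] by simp
    moreover have "sum_norm (fixed_point c f t - ?it (Suc k) t) \<le> (D / (1 - ?r) * ?r ^ Suc k) * p t"
      using near[where k="Suc k" and t=t] by (simp add: sum_norm_minus_commute)
    moreover note sum_norm_triangle_diff[of "fixed_point c f t" "kop c f (fixed_point c f) t" "?it (Suc k) t"]
    ultimately have "sum_norm (fixed_point c f t - kop c f (fixed_point c f) t)
        \<le> (D / (1 - ?r) * ?r ^ Suc k) * p t + ?r * (D / (1 - ?r) * ?r ^ k) * p t"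
      by linarith
    also have "\<dots> = (2 * (E * ?r) * p t) * ?r ^ k" if "E = D / (1 - ?r)" for E
      unfolding that[symmetric] by (simp add: algebra_simps)
    finally show ?thesis by blast
  qed
  then have "sum_norm (fixed_point c f t - kop c f (fixed_point c f) t) \<le> 0"
    by (rule le_geometric_imp_nonpos) (use q in auto)
  then have "sum_norm (fixed_point c f t - kop c f (fixed_point c f) t) = 0"
    using sum_norm_nonneg by (rule order_antisym)
  then show "fixed_point c f t = kop c f (fixed_point c f) t" by simp
qed

end

section \<open>The noise\<close>

text \<open>Around each time, values on the left are near the left limit and values on the right
  near the value itself; finitely many such neighbourhoods cover the interval.\<close>

lemma cadlag_bounded:
  fixes w :: "real \<Rightarrow> 'a::real_normed_vector"
  assumes "cadlag w"
  shows "bounded (w ` {a..b})"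
proof -
  have "\<exists>U. open U \<and> t \<in> U \<and> bounded (w ` U)" for t
  proof -
    obtain l where l: "(w \<longlongrightarrow> l) (at_left t)" using assms unfolding cadlag_def by blast
    have r: "(w \<longlongrightarrow> w t) (at_right t)" using assms unfolding cadlag_def continuous_within by blast
    obtain c where c: "c < t" "\<And>s. c < s \<Longrightarrow> s < t \<Longrightarrow> dist (w s) l < 1"
      using tendstoD[OF l zero_less_one] unfolding eventually_at_left_field by blast
    obtain d where d: "d > t" "\<And>s. t < s \<Longrightarrow> s < d \<Longrightarrow> dist (w s) (w t) < 1"
      using tendstoD[OF r zero_less_one] unfolding eventually_at_right_field by blast
    have "w ` {c<..<d} \<subseteq> ball l 1 \<union> ball (w t) 1"
    proof
      fix y assume "y \<in> w ` {c<..<d}"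
      then obtain s where s: "c < s" "s < d" "y = w s" by auto
      consider "s < t" | "s = t" | "s > t" by linarith
      then show "y \<in> ball l 1 \<union> ball (w t) 1"
        using c(2)[of s] d(2)[of s] s by cases (auto simp: dist_commute)
    qed
    then have "bounded (w ` {c<..<d})"
      using bounded_subset by (metis bounded_Un bounded_ball)
    then show ?thesis using c(1) d(1) by (intro exI[of _ "{c<..<d}"]) auto
  qed
  then obtain U where U: "\<And>t. open (U t)" "\<And>t. t \<in> U t" "\<And>t. bounded (w ` U t)" by metis
  obtain C where C: "finite C" "{a..b} \<subseteq> (\<Union>t\<in>C. U t)"
    by (rule compactE_image[OF compact_Icc, of UNIV U]) (use U(1,2) in blast)+
  have "bounded (\<Union>t\<in>C. w ` U t)" using C(1) U(3) by (intro bounded_UN) auto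
  then show ?thesis by (rule bounded_subset) (use image_mono[OF C(2), of w] in \<open>simp add: image_UN\<close>)
qed

lemma cadlag_linear_growth:
  fixes w :: "real \<Rightarrow> 'a::real_normed_vector"
  assumes "cadlag w" and top: "((\<lambda>t. (1 / t) *\<^sub>R w t) \<longlongrightarrow> 0) at_top"
    and bot: "((\<lambda>t. (1 / t) *\<^sub>R w t) \<longlongrightarrow> 0) at_bot"
  obtains C where "\<And>t. norm (w t) \<le> C * (1 + \<bar>t\<bar>)"
proof -
  obtain T1 where T1: "\<And>t. t \<ge> T1 \<Longrightarrow> norm ((1 / t) *\<^sub>R w t) < 1"
    using tendstoD[OF top zero_less_one] unfolding eventually_at_top_linorder by auto
  obtain T2 where T2: "\<And>t. t \<le> T2 \<Longrightarrow> norm ((1 / t) *\<^sub>R w t) < 1"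
    using tendstoD[OF bot zero_less_one] unfolding eventually_at_bot_linorder by auto
  \<comment> \<open>The cut-offs -1 and 1 keep time 0 inside the compact part, so that outside it
    the bound on \<open>(1 / t) *\<^sub>R w t\<close> may be multiplied by
    \<open>\<bar>t\<bar>\<close>.\<close>
  define a where "a = min T2 (- 1)"
  define b where "b = max T1 1"
  obtain B where B: "\<And>t. t \<in> {a..b} \<Longrightarrow> norm (w t) \<le> B"
    using cadlag_bounded[OF assms(1), of a b] unfolding bounded_iff by blast
  show ?thesis
  proof (rule that[of "\<bar>B\<bar> + 1"])
    fix t
    show "norm (w t) \<le> (\<bar>B\<bar> + 1) * (1 + \<bar>t\<bar>)"
    proof (cases "t \<in> {a..b}")
      case True
      have "norm (w t) \<le> (\<bar>B\<bar> + 1) * 1" using B[OF True] by simp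
      also have "\<dots> \<le> (\<bar>B\<bar> + 1) * (1 + \<bar>t\<bar>)" by (intro mult_left_mono) auto
      finally show ?thesis .
    next
      case False
      then have t: "t \<ge> T1 \<or> t \<le> T2" "t \<noteq> 0" by (auto simp: a_def b_def)
      then have "norm ((1 / t) *\<^sub>R w t) < 1" using T1 T2 by blast
      then have "norm (w t) < \<bar>t\<bar>" using t(2) by (simp add: field_simps)
      also have "\<bar>t\<bar> \<le> 1 * (1 + \<bar>t\<bar>)" by simp
      also have "\<dots> \<le> (\<bar>B\<bar> + 1) * (1 + \<bar>t\<bar>)" by (intro mult_right_mono) auto
      finally show ?thesis by simp
    qed
  qed
qed

text \<open>Fine tagged divisions chosen once and for all, independently of the path; they exhibit
  the Stieltjes integrals as sequential limits of finite sums.\<close>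

definition stieltjes_division :: "real \<Rightarrow> nat \<Rightarrow> (real \<times> real set) set" where
  "stieltjes_division a n =
     (SOME p. p tagged_division_of {a..0} \<and> (\<lambda>x. ball x (1 / Suc n)) fine p)"

lemma stieltjes_division:
  "stieltjes_division a n tagged_division_of {a..0}"
  "(\<lambda>x. ball x (1 / Suc n)) fine stieltjes_division a n"
proof -
  have "gauge (\<lambda>x::real. ball x (1 / Suc n))" by (intro gauge_ball) auto
  then have "\<exists>p. p tagged_division_of {a..0} \<and> (\<lambda>x. ball x (1 / Suc n)) fine p"
    by (meson fine_division_exists_real)
  from someI_ex[OF this]
  show "stieltjes_division a n tagged_division_of {a..0}"
    "(\<lambda>x. ball x (1 / Suc n)) fine stieltjes_division a n"
    unfolding stieltjes_division_def by (fact conjunct1, fact conjunct2)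
qed

definition past_sum :: "(real \<Rightarrow> real ^ 'n ^ 'm) \<Rightarrow> (real \<Rightarrow> real ^ 'n) \<Rightarrow> nat \<Rightarrow> nat \<Rightarrow> real ^ 'm" where
  "past_sum f w m n = (\<Sum>(x, k)\<in>stieltjes_division (- real m) n. f x *v (w (Sup k) - w (Inf k)))"

lemma has_stieltjes_integral_LIMSEQ:
  assumes "has_stieltjes_integral f w I (- real m) 0"
  shows "(\<lambda>n. past_sum f w m n) \<longlonglongrightarrow> I"
proof (rule LIMSEQ_I)
  fix e :: real assume "e > 0"
  with assms have "\<exists>d>0. \<forall>p. p tagged_division_of {- real m..0} \<and> (\<lambda>x. ball x d) fine p \<longrightarrow>
       norm ((\<Sum>(x, k)\<in>p. f x *v (w (Sup k) - w (Inf k))) - I) < e"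
    unfolding has_stieltjes_integral_def by simp
  then obtain d where d: "d > 0" "\<forall>p. p tagged_division_of {- real m..0} \<and> (\<lambda>x. ball x d) fine p \<longrightarrow>
       norm ((\<Sum>(x, k)\<in>p. f x *v (w (Sup k) - w (Inf k))) - I) < e"
    by (elim exE conjE)
  obtain N :: nat where N: "1 / d < N" using reals_Archimedean2 by blast
  have "norm (past_sum f w m n - I) < e" if "n \<ge> N" for n
    unfolding past_sum_def
  proof (rule d(2)[rule_format, OF conjI, OF stieltjes_division(1)])
    have "1 / d < Suc n" using N that by linarith
    then have "1 / Suc n < d" using d(1) by (simp add: field_simps)
    then show "(\<lambda>x. ball x d) fine stieltjes_division (- real m) n"
      using stieltjes_division(2)[of n "- real m"] subset_ball[of "1 / Suc n" d]
      unfolding fine_def by fastforce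
  qed
  then show "\<exists>N. \<forall>n\<ge>N. norm (past_sum f w m n - I) < e" by blast
qed

text \<open>The right-hand side does not mention \<open>I\<close>, so this also gives the uniqueness
  behind the \<open>THE\<close> in \<open>\<eta>\<close>. Integer left end points make both limits
  sequential.\<close>

lemma has_past_integral_eq_lim:
  assumes "has_past_integral f w I"
  shows "I = lim (\<lambda>m. lim (\<lambda>n. past_sum f w m n))"
proof -
  obtain J where J: "\<And>a. a \<le> 0 \<Longrightarrow> has_stieltjes_integral f w (J a) a 0" "(J \<longlongrightarrow> I) at_bot"
    using assms unfolding has_past_integral_def by blast
  have "lim (\<lambda>n. past_sum f w m n) = J (- real m)" for m
    by (intro limI has_stieltjes_integral_LIMSEQ J(1)) simp
  moreover have "(\<lambda>m. J (- real m)) \<longlonglongrightarrow> I"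
    by (rule filterlim_compose[OF J(2)])
      (simp add: filterlim_uminus_at_bot filterlim_real_sequentially)
  ultimately show ?thesis by (simp add: limI)
qed

lemma \<eta>_eq_lim:
  assumes "has_past_integral (ou_kernel \<epsilon> F) w I"
  shows "\<eta> \<alpha> \<epsilon> F w = (\<epsilon> powr (- 1 / \<alpha>)) *\<^sub>R lim (\<lambda>m. lim (\<lambda>n. past_sum (ou_kernel \<epsilon> F) w m n))"
proof -
  have "(THE I. has_past_integral (ou_kernel \<epsilon> F) w I) = I"
    using assms has_past_integral_eq_lim by (metis the_equality)
  then show ?thesis using has_past_integral_eq_lim[OF assms] by (simp add: \<eta>_def)
qed

section \<open>Measurability of the noise in path and time\<close>

lemma \<eta>_shift_measurable:
  fixes F :: "real^'n^'n"
  assumes [measurable]: "\<And>t. (\<lambda>w. w t) \<in> borel_measurable M"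
    and "\<And>w. w \<in> space M \<Longrightarrow> \<exists>I. has_past_integral (ou_kernel \<epsilon> F) (path_shift u w) I"
  shows "(\<lambda>w. \<eta> \<alpha> \<epsilon> F (path_shift u w)) \<in> borel_measurable M"
proof -
  have [measurable]: "(\<lambda>w. past_sum (ou_kernel \<epsilon> F) (path_shift u w) m n) \<in> borel_measurable M" for m n
    unfolding past_sum_def path_shift_def split_beta
  proof (rule borel_measurable_sum)
    fix i :: "real \<times> real set"
    have "(\<lambda>w. w (Sup (snd i) + u) - w u - (w (Inf (snd i) + u) - w u)) \<in> borel_measurable M"
      by measurable
    then show "(\<lambda>w. ou_kernel \<epsilon> F (fst i) *v (w (Sup (snd i) + u) - w u - (w (Inf (snd i) + u) - w u)))
        \<in> borel_measurable M"
      by (rule measurable_compose)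
        (intro borel_measurable_continuous_onI linear_continuous_on matrix_vector_mul_bounded_linear)
  qed
  have "(\<lambda>w. (\<epsilon> powr (- 1 / \<alpha>)) *\<^sub>R lim (\<lambda>m. lim (\<lambda>n. past_sum (ou_kernel \<epsilon> F) (path_shift u w) m n)))
      \<in> borel_measurable M"
    by measurable
  moreover have "\<eta> \<alpha> \<epsilon> F (path_shift u w) =
      (\<epsilon> powr (- 1 / \<alpha>)) *\<^sub>R lim (\<lambda>m. lim (\<lambda>n. past_sum (ou_kernel \<epsilon> F) (path_shift u w) m n))"
    if "w \<in> space M" for w
    using assms(2)[OF that] \<eta>_eq_lim by blast
  ultimately show ?thesis by (simp cong: measurable_cong)
qed

text \<open>Sampling at grid times to the right of \<open>t\<close>: for fixed \<open>n\<close> only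
  countably many times occur, so the sampled process is jointly measurable, and right continuity
  recovers \<open>X\<close> as the mesh shrinks.\<close>

lemma right_continuous_imp_jointly_measurable:
  fixes X :: "real \<Rightarrow> 'w \<Rightarrow> 'a::metric_space"
  assumes X: "\<And>t. X t \<in> borel_measurable M"
    and r: "\<And>t w. w \<in> space M \<Longrightarrow> continuous (at_right t) (\<lambda>t. X t w)"
  shows "(\<lambda>(t, w). X t w) \<in> borel_measurable (borel \<Otimes>\<^sub>M M)"
proof (rule borel_measurable_LIMSEQ_metric)
  \<comment> \<open>Floor plus one instead of ceiling: \<open>g n t\<close> lies strictly to the
    right of \<open>t\<close> even at grid points, as convergence along \<open>at_right t\<close>
    demands.\<close>
  define g where "g n t = (of_int (\<lfloor>t * Suc n\<rfloor> + 1) :: real) / Suc n" for n :: nat and t :: real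
  show "(\<lambda>(t, w). X (g n t) w) \<in> borel_measurable (borel \<Otimes>\<^sub>M M)" for n
  proof -
    have 1: "(\<lambda>p. X (of_int (i + 1) / Suc n) (snd p)) \<in> borel_measurable (borel \<Otimes>\<^sub>M M)" for i
      using X by measurable
    have 2: "(\<lambda>p. \<lfloor>fst p * real (Suc n)\<rfloor>) \<in> measurable (borel \<Otimes>\<^sub>M M) (count_space UNIV)"
      by (rule measurable_compose[of "\<lambda>p. fst p * real (Suc n)", OF _ measurable_real_floor]) measurable
    have "(\<lambda>p. X (of_int (\<lfloor>fst p * real (Suc n)\<rfloor> + 1) / Suc n) (snd p)) \<in> borel_measurable (borel \<Otimes>\<^sub>M M)"
      by (rule measurable_compose_countable[where f="\<lambda>i p. X (of_int (i + 1) / Suc n) (snd p)"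
            and g="\<lambda>p. \<lfloor>fst p * real (Suc n)\<rfloor>", OF 1 2])
    then show ?thesis by (simp add: g_def split_beta')
  qed
  fix p :: "real \<times> 'w" assume "p \<in> space (borel \<Otimes>\<^sub>M M)"
  then obtain t w where p: "p = (t, w)" "w \<in> space M" by (auto simp: space_pair_measure)
  have "t < of_int (\<lfloor>t * N\<rfloor> + 1) / N \<and> of_int (\<lfloor>t * N\<rfloor> + 1) / N \<le> t + 1 / N" if "N > 0" for N :: real
    using that floor_correct[of "t * N"] by (simp add: field_simps)
  then have b: "t < g n t" "g n t \<le> t + 1 / Suc n" for n
    unfolding g_def by (metis of_nat_0_less_iff zero_less_Suc)+
  have "(\<lambda>n. g n t) \<longlonglongrightarrow> t"
  proof (rule tendsto_sandwich[of "\<lambda>_. t" _ _ "\<lambda>n. t + 1 / Suc n"])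
    show "(\<lambda>n. t + 1 / Suc n) \<longlonglongrightarrow> t"
      using tendsto_add[OF tendsto_const LIMSEQ_inverse_real_of_nat, of t] by (simp add: inverse_eq_divide)
  qed (use b in \<open>auto intro!: always_eventually less_imp_le\<close>)
  then have "filterlim (\<lambda>n. g n t) (at_right t) sequentially"
    using b(1) less_imp_neq[OF b(1), symmetric] by (simp add: filterlim_at)
  from filterlim_compose[OF r[OF p(2), of t, unfolded continuous_within] this]
  show "(\<lambda>n. case p of (t, w) \<Rightarrow> X (g n t) w) \<longlonglongrightarrow> (case p of (t, w) \<Rightarrow> X t w)"
    by (simp add: p)
qed

text \<open>Evaluation at a time is in general not continuous in the Skorokhod topology.
  Measurability is instead read off from the independence of increments, since
  \<open>indep_vars\<close> contains measurability of each variable, and from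
  \<open>w 0 = 0\<close>.\<close>

lemma stable_levy_law_coordinate_measurable:
  fixes P :: "(real \<Rightarrow> real^'n) measure"
  assumes "stable_levy_law \<alpha> P"
  shows "(\<lambda>w. w t) \<in> borel_measurable P"
proof -
  interpret prob_space P using assms by (simp add: stable_levy_law_def)
  have sp: "space P = cadlag_paths" using assms by (simp add: stable_levy_law_def)
  have inc: "(\<lambda>w. w b - w a) \<in> borel_measurable P" if "a < b" for a b :: real
  proof -
    \<comment> \<open>Any sequence with first two terms \<open>a\<close> and \<open>b\<close>
      serves, as only the single increment with index 0 is used.\<close>
    let ?t = "\<lambda>i::nat. if i = 0 then a else b + real i - 1"
    have "\<forall>n (t::nat \<Rightarrow> real). (\<forall>i<n. t i < t (Suc i)) \<longrightarrow>
        indep_vars (\<lambda>_. borel) (\<lambda>i w. w (t (Suc i)) - w (t i)) {..<n}"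
      using assms unfolding stable_levy_law_def by (elim conjE)
    from this[THEN spec[of _ 1], THEN spec[of _ ?t]]
    have "indep_vars (\<lambda>_. borel) (\<lambda>i w. w (?t (Suc i)) - w (?t i)) {..<1}"
      using that by simp
    then show ?thesis unfolding indep_vars_def by (auto dest: bspec[of _ _ 0])
  qed
  consider "t = 0" | "t > 0" | "t < 0" by linarith
  then show ?thesis
  proof cases
    case 1
    have "(\<lambda>w. w t) \<in> borel_measurable P \<longleftrightarrow> (\<lambda>w. 0 :: real^'n) \<in> borel_measurable P"
      by (rule measurable_cong) (auto simp: sp cadlag_paths_def 1)
    then show ?thesis by simp
  next
    case 2
    have "(\<lambda>w. w t) \<in> borel_measurable P \<longleftrightarrow> (\<lambda>w. w t - w 0) \<in> borel_measurable P"
      by (rule measurable_cong) (auto simp: sp cadlag_paths_def)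
    then show ?thesis using inc[OF 2] by simp
  next
    case 3
    have "(\<lambda>w. w t) \<in> borel_measurable P \<longleftrightarrow> (\<lambda>w. - (w 0 - w t)) \<in> borel_measurable P"
      by (rule measurable_cong) (auto simp: sp cadlag_paths_def)
    then show ?thesis using borel_measurable_uminus[OF inc[OF 3]] by simp
  qed
qed

section \<open>Mild and integrated solutions\<close>

lemma half_open_has_integral:
  fixes h :: "real \<Rightarrow> 'a::euclidean_space"
  assumes "integrable lborel (\<lambda>r. indicator {s<..t} r *\<^sub>R h r)"
  shows "(h has_integral (\<integral>r. indicator {s<..t} r *\<^sub>R h r \<partial>lborel)) {s..t}"
proof -
  let ?I = "\<integral>r. indicator {s<..t} r *\<^sub>R h r \<partial>lborel"
  have "((\<lambda>r. if r \<in> {s<..t} then h r else 0) has_integral ?I) UNIV"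
    using has_integral_integral_lborel[OF assms] by (simp add: indicator_scaleR_eq_if)
  then have I: "(h has_integral ?I) {s<..t}"
    by (simp only: has_integral_restrict_UNIV)
  have n: "negligible {x \<in> {s<..t} - {s..t}. h x \<noteq> 0}" "negligible {x \<in> {s..t} - {s<..t}. h x \<noteq> 0}"
    by (rule negligible_subset[of "{s}"]; auto)+
  show ?thesis using I has_integral_spike_set_eq[OF n] by blast
qed

lemma mexp_measurable:
  fixes A :: "real^'n^'n"
  assumes "f \<in> borel_measurable M"
  shows "(\<lambda>x. mexp (f x *\<^sub>R A)) \<in> borel_measurable M"
  by (rule measurable_compose[OF assms]) (intro borel_measurable_continuous_onI continuous_on_mexp)

lemma bounded_mexp:
  fixes A :: "real^'n^'n" and f :: "real \<Rightarrow> real"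
  assumes "continuous_on {l..r} f"
  shows "bounded ((\<lambda>q. mexp (f q *\<^sub>R A)) ` {l..r})"
  by (intro compact_imp_bounded compact_continuous_image
      continuous_on_compose2[OF continuous_on_mexp[of UNIV A] assms]) auto

text \<open>The kernel \<open>\<iota> t s\<close> is a signed indicator of the range of integration, so that
  \<open>\<iota> t - \<iota> s\<close> is the indicator of \<open>(s, t]\<close>; this covers integrals from \<open>0\<close> to \<open>t\<close>
  (for \<open>t\<close> of either sign) as well as integrals from \<open>-\<infinity>\<close> to \<open>t\<close>.\<close>

lemma mild_imp_integrated:
  fixes A :: "real^'n^'n" and u b :: "real \<Rightarrow> real^'n"
  assumes b [measurable]: "b \<in> borel_measurable borel" and bb: "bounded (b ` {l..r})" and "l \<le> r"
    and int: "\<And>t. t \<in> {l..r} \<Longrightarrow> integrable lborel (\<lambda>s. \<iota> t s *\<^sub>R (mexp ((t - s) *\<^sub>R A) *v b s))"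
    and u: "\<And>t. t \<in> {l..r} \<Longrightarrow>
      u t = mexp (t *\<^sub>R A) *v x + (\<integral>s. \<iota> t s *\<^sub>R (mexp ((t - s) *\<^sub>R A) *v b s) \<partial>lborel)"
    and \<iota>: "\<And>s t q. l \<le> s \<Longrightarrow> s \<le> t \<Longrightarrow> t \<le> r \<Longrightarrow> \<iota> t q - \<iota> s q = indicator {s<..t} q"
  shows "((\<lambda>q. A *v u q + b q) has_integral u r - u l) {l..r}"
proof -
  \<comment> \<open>Multiplying by \<open>mexp ((- t) *\<^sub>R A)\<close> removes the linear part:
    \<open>v\<close> is an indefinite integral of \<open>c\<close>, and the product rule with
    \<open>mexp (t *\<^sub>R A)\<close> restores \<open>A\<close>.\<close>
  define v where "v t = mexp ((- t) *\<^sub>R A) *v u t" for t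
  define c where "c q = mexp ((- q) *\<^sub>R A) *v b q" for q
  have inv: "mexp (t *\<^sub>R A) *v (mexp ((- t) *\<^sub>R A) *v y) = y" "mexp ((- t) *\<^sub>R A) *v (mexp (t *\<^sub>R A) *v y) = y" for t y
  proof -
    have "mexp (t *\<^sub>R A) ** mexp ((- t) *\<^sub>R A) = mat 1" "mexp ((- t) *\<^sub>R A) ** mexp (t *\<^sub>R A) = mat 1"
      unfolding mexp_add[symmetric] by (simp_all add: mexp_0)
    then show "mexp (t *\<^sub>R A) *v (mexp ((- t) *\<^sub>R A) *v y) = y" "mexp ((- t) *\<^sub>R A) *v (mexp (t *\<^sub>R A) *v y) = y"
      by (simp_all only: matrix_vector_mul_assoc matrix_vector_mul_lid)
  qed
  have e: "mexp ((- t) *\<^sub>R A) *v (\<iota> t s *\<^sub>R (mexp ((t - s) *\<^sub>R A) *v b s)) = \<iota> t s *\<^sub>R c s" for t s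
    using mexp_add[of "- t" "t - s" A]
    by (simp add: c_def matrix_vector_mult_scaleR matrix_vector_mul_assoc)
  have ic: "integrable lborel (\<lambda>s. \<iota> t s *\<^sub>R c s)" if "t \<in> {l..r}" for t
    using integrable_bounded_linear[OF matrix_vector_mul_bounded_linear int[OF that], of "mexp ((- t) *\<^sub>R A)"]
    by (simp only: e)
  have v: "v t = x + (\<integral>s. \<iota> t s *\<^sub>R c s \<partial>lborel)" if "t \<in> {l..r}" for t
  proof -
    have "mexp ((- t) *\<^sub>R A) *v (\<integral>s. \<iota> t s *\<^sub>R (mexp ((t - s) *\<^sub>R A) *v b s) \<partial>lborel)
        = (\<integral>s. \<iota> t s *\<^sub>R c s \<partial>lborel)"
      using integral_bounded_linear[OF matrix_vector_mul_bounded_linear int[OF that], of "mexp ((- t) *\<^sub>R A)"]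
      by (simp only: e)
    then show ?thesis
      unfolding v_def u[OF that] by (simp only: matrix_vector_right_distrib inv)
  qed
  have "((\<lambda>q. (A ** mexp (q *\<^sub>R A)) *v v q + mexp (q *\<^sub>R A) *v c q) has_integral
      mexp (r *\<^sub>R A) *v v r - mexp (l *\<^sub>R A) *v v l) {l..r}"
  proof (rule integral_product_rule)
    show "((\<lambda>r. mexp (r *\<^sub>R A)) has_vector_derivative A ** mexp (q *\<^sub>R A)) (at q)" for q
      by (rule mexp_has_vector_derivative)
    show "continuous_on UNIV (\<lambda>r. A ** mexp (r *\<^sub>R A))"
      by (intro bounded_bilinear.continuous_on[OF bounded_bilinear_matrix_matrix_mult]
          continuous_on_mexp continuous_intros)
    show "c \<in> borel_measurable borel"
      unfolding c_def by (intro measurable_matrix_vector_mult mexp_measurable) measurable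
    show "bounded (c ` {l..r})"
      unfolding c_def by (intro bounded_matrix_vector_mult bounded_mexp bb continuous_intros)
    fix s t assume st: "l \<le> s" "s \<le> t" "t \<le> r"
    then have m: "s \<in> {l..r}" "t \<in> {l..r}" by auto
    have d: "\<iota> t q *\<^sub>R c q - \<iota> s q *\<^sub>R c q = indicator {s<..t} q *\<^sub>R c q" for q
      using \<iota>[OF st, of q] by (simp add: scaleR_left_diff_distrib[symmetric])
    have "v t - v s = (\<integral>q. \<iota> t q *\<^sub>R c q - \<iota> s q *\<^sub>R c q \<partial>lborel)"
      using ic m by (simp add: v)
    moreover have "integrable lborel (\<lambda>q. \<iota> t q *\<^sub>R c q - \<iota> s q *\<^sub>R c q)"
      using ic m by simp
    ultimately show "(c has_integral v t - v s) {s..t}"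
      unfolding d using half_open_has_integral by metis
  qed fact
  then show ?thesis
    by (simp only: v_def c_def inv matrix_vector_mul_assoc[symmetric])
qed

text \<open>Variation of constants: in the product rule with
  \<open>mexp ((r - q) *\<^sub>R A)\<close> the derivative of the matrix cancels the linear term
  \<open>A *v u q\<close>, leaving only \<open>b\<close>.\<close>

lemma integrated_imp_mild:
  fixes A :: "real^'n^'n" and u b :: "real \<Rightarrow> real^'n"
  assumes b [measurable]: "b \<in> borel_measurable borel" and bb: "bounded (b ` {l..r})" and "l \<le> r"
    and m [measurable]: "u \<in> borel_measurable borel"
    and u: "\<And>s t. l \<le> s \<Longrightarrow> s \<le> t \<Longrightarrow> t \<le> r \<Longrightarrow> ((\<lambda>q. A *v u q + b q) has_integral u t - u s) {s..t}"
  shows "((\<lambda>q. mexp ((r - q) *\<^sub>R A) *v b q) has_integral u r - mexp ((r - l) *\<^sub>R A) *v u l) {l..r}"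
proof -
  have cu: "continuous_on {l..r} u"
    by (rule has_integral_increments_continuous_on) (fact u)
  have "((\<lambda>q. (- (A ** mexp ((r - q) *\<^sub>R A))) *v u q + mexp ((r - q) *\<^sub>R A) *v (A *v u q + b q)) has_integral
      mexp ((r - r) *\<^sub>R A) *v u r - mexp ((r - l) *\<^sub>R A) *v u l) {l..r}"
  proof (rule integral_product_rule)
    show "((\<lambda>q. mexp ((r - q) *\<^sub>R A)) has_vector_derivative - (A ** mexp ((r - q) *\<^sub>R A))) (at q)" for q
    proof -
      have "((\<lambda>q. r - q) has_vector_derivative - 1) (at q)"
        by (auto intro!: derivative_eq_intros)
      from vector_diff_chain_at[OF this mexp_has_vector_derivative]
      show ?thesis by (simp add: o_def)
    qed
    show "continuous_on UNIV (\<lambda>q. - (A ** mexp ((r - q) *\<^sub>R A)))"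
      by (intro continuous_intros bounded_bilinear.continuous_on[OF bounded_bilinear_matrix_matrix_mult]
          continuous_on_compose2[OF continuous_on_mexp[of UNIV A]]) auto
    show "(\<lambda>q. A *v u q + b q) \<in> borel_measurable borel"
      by (intro borel_measurable_add measurable_matrix_vector_mult b m) measurable
    have "bounded (u ` {l..r})"
      using cu by (intro compact_imp_bounded compact_continuous_image) auto
    then have "bounded ((\<lambda>q. A *v u q) ` {l..r})"
      by (intro bounded_matrix_vector_mult) (auto simp: image_constant_conv)
    then show "bounded ((\<lambda>q. A *v u q + b q) ` {l..r})"
      using bb by (rule bounded_plus_comp)
  qed (fact u, fact)
  moreover have "(- (A ** mexp ((r - q) *\<^sub>R A))) *v u q + mexp ((r - q) *\<^sub>R A) *v (A *v u q + b q)
      = mexp ((r - q) *\<^sub>R A) *v b q" for q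
  proof -
    have "(- (A ** mexp ((r - q) *\<^sub>R A))) *v u q = - (mexp ((r - q) *\<^sub>R A) *v (A *v u q))"
      by (simp add: mexp_commute matrix_vector_mul_assoc
          bounded_bilinear.minus_left[OF bounded_bilinear_matrix_vector_mult])
    then show ?thesis by (simp add: matrix_vector_right_distrib)
  qed
  ultimately show ?thesis by (simp add: mexp_0)
qed

lemma has_integral_Pair:
  fixes f :: "real \<Rightarrow> 'a::euclidean_space" and g :: "real \<Rightarrow> 'b::euclidean_space"
  assumes "(f has_integral a) X" "(g has_integral b) X"
  shows "((\<lambda>x. (f x, g x)) has_integral (a, b)) X"
proof -
  have "bounded_linear (\<lambda>a::'a. (a, 0::'b))" "bounded_linear (\<lambda>b::'b. (0::'a, b))"
    by (intro bounded_linear_Pair bounded_linear_ident bounded_linear_zero)+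
  from has_integral_add[OF has_integral_linear[OF assms(1) this(1)] has_integral_linear[OF assms(2) this(2)]]
  show ?thesis by (simp add: o_def)
qed

section \<open>Exponential kernels\<close>

lemma has_bochner_integral_exp_atLeast:
  fixes m :: real
  assumes "m > 0"
  shows "has_bochner_integral lborel (\<lambda>s. indicator {t..} s * exp (- m * s)) (exp (- m * t) / m)"
proof (rule has_bochner_integral_nn_integral)
  have "(\<integral>\<^sup>+s. ennreal (exp (- m * s)) * indicator {t..} s \<partial>lborel) = ennreal (0 - (- exp (- m * t) / m))"
  proof (rule nn_integral_FTC_atLeast[where F="\<lambda>s. - exp (- m * s) / m"])
    show "((\<lambda>s. - exp (- m * s) / m) \<longlongrightarrow> 0) at_top"
      using assms by real_asymp
  qed (use assms in \<open>auto intro!: derivative_eq_intros\<close>)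
  then show "(\<integral>\<^sup>+s. ennreal (indicator {t..} s * exp (- m * s)) \<partial>lborel) = ennreal (exp (- m * t) / m)"
    by (simp add: ennreal_mult ennreal_indicator mult.commute)
qed (use assms in auto)

lemma has_bochner_integral_exp_atMost:
  fixes m :: real
  assumes "m > 0"
  shows "has_bochner_integral lborel (\<lambda>s. indicator {..t} s * exp (m * s)) (exp (m * t) / m)"
proof -
  have "has_bochner_integral lborel (\<lambda>s. indicator {- t..} (0 + - 1 * s) * exp (- m * (0 + - 1 * s)))
      ((exp (- m * (- t)) / m) /\<^sub>R \<bar>- 1\<bar>)"
    by (rule lborel_has_bochner_integral_real_affine_iff[THEN iffD1])
      (use has_bochner_integral_exp_atLeast[OF assms, of "- t"] in simp_all)
  moreover have "indicator {- t..} (0 + - 1 * s) = (indicator {..t} s :: real)" for s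
    by (auto simp: indicator_def)
  ultimately show ?thesis by simp
qed

lemma integral_bound_by_has_bochner_integral:
  fixes k g :: "real \<Rightarrow> real"
  assumes g: "has_bochner_integral lborel g I" and k: "k \<in> borel_measurable borel"
    and "\<And>s. 0 \<le> k s" "\<And>s. k s \<le> C * g s"
  shows "integrable lborel k" "(\<integral>s. k s \<partial>lborel) \<le> C * I"
proof -
  have i: "integrable lborel (\<lambda>s. C * g s)"
    using g by (auto simp: has_bochner_integral_iff)
  show 1: "integrable lborel k"
    by (rule Bochner_Integration.integrable_bound[OF i])
      (use k assms(3,4) in \<open>auto intro: order_trans[OF _ abs_ge_self]\<close>)
  have "(\<integral>s. k s \<partial>lborel) \<le> (\<integral>s. C * g s \<partial>lborel)"
    by (rule integral_mono[OF 1 i]) (use assms(4) in auto)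
  then show "(\<integral>s. k s \<partial>lborel) \<le> C * I"
    using g by (simp add: has_bochner_integral_iff)
qed

lemma linear_le_exp:
  fixes b t :: real
  assumes "b > 0"
  shows "1 + \<bar>t\<bar> \<le> (1 + 1 / b) * exp (b * \<bar>t\<bar>)"
proof -
  have "1 + \<bar>t\<bar> \<le> (1 + 1 / b) * (1 + b * \<bar>t\<bar>)"
    using assms by (simp add: field_simps)
  also have "\<dots> \<le> (1 + 1 / b) * exp (b * \<bar>t\<bar>)"
    using assms by (intro mult_left_mono exp_ge_add_one_self) auto
  finally show ?thesis .
qed

section \<open>The slow-fast system\<close>

text \<open>The kernel of the integral from 0 to \<open>t\<close>. Both branches are open on the
  left and closed on the right, so differences are exact indicators with no exceptional null
  set.\<close>

definition oriented_indicator :: "real \<Rightarrow> real \<Rightarrow> real" where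
  "oriented_indicator t s = (if 0 < s \<and> s \<le> t then 1 else if t < s \<and> s \<le> 0 then - 1 else 0)"

lemma oriented_indicator_measurable [measurable]:
  "(\<lambda>(t, s). oriented_indicator t s) \<in> borel_measurable (borel \<Otimes>\<^sub>M borel)"
  "oriented_indicator t \<in> borel_measurable borel"
  unfolding oriented_indicator_def by measurable

lemma oriented_indicator_diff:
  "s \<le> t \<Longrightarrow> oriented_indicator t q - oriented_indicator s q = indicator {s<..t} q"
  by (auto simp: oriented_indicator_def indicator_def)

lemma oriented_indicator_exp_integral:
  fixes b :: real
  assumes "b > 0"
  shows "integrable lborel (\<lambda>s. \<bar>oriented_indicator t s\<bar> * exp (b * \<bar>s\<bar>))"
    "(\<integral>s. \<bar>oriented_indicator t s\<bar> * exp (b * \<bar>s\<bar>) \<partial>lborel) \<le> exp (b * \<bar>t\<bar>) / b"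
proof -
  let ?k = "\<lambda>s. \<bar>oriented_indicator t s\<bar> * exp (b * \<bar>s\<bar>)"
  have m: "?k \<in> borel_measurable borel" by measurable
  have n: "0 \<le> ?k s" for s by simp
  have "integrable lborel ?k \<and> integral\<^sup>L lborel ?k \<le> exp (b * \<bar>t\<bar>) / b"
  proof (cases "t \<ge> 0")
    case True
    have "?k s \<le> 1 * (indicator {..t} s * exp (b * s))" for s
      using True by (auto simp: oriented_indicator_def indicator_def)
    from integral_bound_by_has_bochner_integral[OF has_bochner_integral_exp_atMost[OF assms] m n this]
    show ?thesis using True by simp
  next
    case False
    have "?k s \<le> 1 * (indicator {t..} s * exp (- b * s))" for s
      using False by (auto simp: oriented_indicator_def indicator_def)
    from integral_bound_by_has_bochner_integral[OF has_bochner_integral_exp_atLeast[OF assms] m n this]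
    show ?thesis using False by simp
  qed
  then show "integrable lborel ?k" "integral\<^sup>L lborel ?k \<le> exp (b * \<bar>t\<bar>) / b" by blast+
qed

lemma exp_bound_imp_bounded:
  fixes b :: "real \<Rightarrow> 'a::real_normed_vector"
  assumes "\<And>s. norm (b s) \<le> D * exp (c * \<bar>s\<bar>)" "D \<ge> 0" "c \<ge> 0"
  shows "bounded (b ` {l..r})"
  unfolding bounded_iff
proof (intro exI ballI)
  fix x assume "x \<in> b ` {l..r}"
  then obtain s where s: "s \<in> {l..r}" "x = b s" by auto
  have "norm (b s) \<le> D * exp (c * \<bar>s\<bar>)" by (rule assms)
  also have "\<dots> \<le> D * exp (c * (\<bar>l\<bar> + \<bar>r\<bar>))"
    using s assms(2,3) by (intro mult_left_mono) (auto intro!: mult_left_mono)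
  finally show "norm x \<le> D * exp (c * (\<bar>l\<bar> + \<bar>r\<bar>))" using s by simp
qed

lemma lipschitz_sum_norm_continuous:
  fixes g :: "'a::real_normed_vector \<times> 'b::real_normed_vector \<Rightarrow> 'c::real_normed_vector"
  assumes "\<And>p q. norm (g p - g q) \<le> K * sum_norm (p - q)" "K \<ge> 0"
  shows "continuous_on UNIV g"
proof -
  have "(2 * K)-lipschitz_on UNIV g"
  proof (rule lipschitz_onI)
    fix p q
    have "norm (g p - g q) \<le> K * sum_norm (p - q)" by (rule assms)
    also have "\<dots> \<le> K * (2 * norm (p - q))"
      by (intro mult_left_mono sum_norm_le_norm assms)
    finally show "dist (g p) (g q) \<le> 2 * K * dist p q" by (simp add: dist_norm)
  qed (use assms in simp)
  then show ?thesis by (rule lipschitz_on_continuous_on)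
qed

lemma path_shift_add: "path_shift u (path_shift s w) = path_shift (u + s) w"
  by (simp add: path_shift_def add.assoc)

text \<open>\<open>small\<close> strengthens \<open>\<rho>\<close> < 1 by dropping the positive term
  \<open>\<epsilon> * \<gamma>s\<close> from the denominator of the slow share. The conditions on
  the noise are pathwise except for measurability of the coordinates.\<close>

locale slow_fast_system =
  fixes S :: "real^'m^'m" and F :: "real^'n^'n"
    and g1 :: "(real^'m) \<times> (real^'n) \<Rightarrow> real^'m" and g2 :: "(real^'m) \<times> (real^'n) \<Rightarrow> real^'n"
    and \<sigma> \<alpha> \<epsilon> \<gamma>s \<gamma>f K \<gamma> :: real and M :: "(real \<Rightarrow> real^'n) measure"
  assumes pos: "\<epsilon> > 0" "\<gamma>s > 0" "\<gamma> > 0" "K > 0"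
    and S_bound: "\<And>t x. t \<le> 0 \<Longrightarrow> norm (mexp (t *\<^sub>R S) *v x) \<le> exp (\<gamma>s * t) * norm x"
    and F_bound: "\<And>t y. t \<ge> 0 \<Longrightarrow> norm (mexp (t *\<^sub>R F) *v y) \<le> exp (\<gamma>f * t) * norm y"
    and g_lipschitz: "\<And>p q. norm (g1 p - g1 q) \<le> K * sum_norm (p - q)"
      "\<And>p q. norm (g2 p - g2 q) \<le> K * sum_norm (p - q)"
    and g_zero: "g1 (0, 0) = 0" "g2 (0, 0) = 0"
    and gap: "K < - (\<gamma> + \<gamma>f)" and small: "\<epsilon> * K / \<gamma> < 1 + K / (\<gamma> + \<gamma>f)"
    and coordinate_measurable: "\<And>t. (\<lambda>w. w t) \<in> borel_measurable M"
    and shift_space: "\<And>t w. w \<in> space M \<Longrightarrow> path_shift t w \<in> space M"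
    and past_integral: "\<And>w. w \<in> space M \<Longrightarrow> \<exists>I. has_past_integral (ou_kernel \<epsilon> F) w I"
    and \<eta>_cadlag: "\<And>w. w \<in> space M \<Longrightarrow> cadlag (\<lambda>t. \<eta> \<alpha> \<epsilon> F (path_shift t w))"
    and \<eta>_at_top: "\<And>w. w \<in> space M \<Longrightarrow> ((\<lambda>t. (1 / t) *\<^sub>R \<eta> \<alpha> \<epsilon> F (path_shift t w)) \<longlongrightarrow> 0) at_top"
    and \<eta>_at_bot: "\<And>w. w \<in> space M \<Longrightarrow> ((\<lambda>t. (1 / t) *\<^sub>R \<eta> \<alpha> \<epsilon> F (path_shift t w)) \<longlongrightarrow> 0) at_bot"
begin

section \<open>Growth, measurability and Lipschitz bounds of the vector field\<close>

definition fast_matrix :: "real^'n^'n" where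
  "fast_matrix = (1 / \<epsilon>) *\<^sub>R F"

definition nonlinearity :: "(real \<Rightarrow> real^'n) \<Rightarrow> real \<Rightarrow> (real^'m) \<times> (real^'n) \<Rightarrow> (real^'m) \<times> (real^'n)" where
  "nonlinearity w s z =
     (g1 (fst z, snd z + \<sigma> *\<^sub>R \<eta> \<alpha> \<epsilon> F (path_shift s w)), g2 (fst z, snd z + \<sigma> *\<^sub>R \<eta> \<alpha> \<epsilon> F (path_shift s w)))"

definition vector_field :: "(real \<Rightarrow> real^'n) \<Rightarrow> real \<Rightarrow> (real^'m) \<times> (real^'n) \<Rightarrow> (real^'m) \<times> (real^'n)" where
  "vector_field w s z = (S *v fst z + fst (nonlinearity w s z),
     fast_matrix *v snd z + (1 / \<epsilon>) *\<^sub>R snd (nonlinearity w s z))"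

lemma solution_iff:
  "solution S F g1 g2 \<sigma> \<alpha> \<epsilon> w z0 z \<longleftrightarrow> z 0 = z0 \<and> (\<forall>s t. s \<le> t \<longrightarrow>
     ((\<lambda>u. vector_field w u (z u)) has_integral z t - z s) {s..t})"
proof -
  have e: "fast_matrix *v y + (1 / \<epsilon>) *\<^sub>R g = (1 / \<epsilon>) *\<^sub>R (F *v y) + (1 / \<epsilon>) *\<^sub>R g" for y g
    by (simp add: fast_matrix_def scaleR_matrix_vector_assoc)
  have "((\<lambda>u. vector_field w u (z u)) has_integral z t - z s) X \<longleftrightarrow>
     ((\<lambda>u. fst (vector_field w u (z u))) has_integral fst (z t) - fst (z s)) X \<and>
     ((\<lambda>u. snd (vector_field w u (z u))) has_integral snd (z t) - snd (z s)) X" (is "?l \<longleftrightarrow> ?r") for s t X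
  proof
    assume ?l
    from has_integral_linear[OF this bounded_linear_fst] has_integral_linear[OF this bounded_linear_snd]
    show ?r by (simp add: o_def)
  next
    assume ?r
    then show ?l using has_integral_Pair[of "\<lambda>u. fst (vector_field w u (z u))" "fst (z t) - fst (z s)" X
        "\<lambda>u. snd (vector_field w u (z u))" "snd (z t) - snd (z s)"] by (simp add: minus_prod_def)
  qed
  then show ?thesis
    unfolding solution_def by (simp add: vector_field_def nonlinearity_def e)
qed

lemma \<eta>_jointly_measurable: "(\<lambda>(t, w). \<eta> \<alpha> \<epsilon> F (path_shift t w)) \<in> borel_measurable (borel \<Otimes>\<^sub>M M)"
proof (rule right_continuous_imp_jointly_measurable)
  show "(\<lambda>w. \<eta> \<alpha> \<epsilon> F (path_shift t w)) \<in> borel_measurable M" for t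
    by (intro \<eta>_shift_measurable coordinate_measurable past_integral shift_space)
  show "continuous (at_right t) (\<lambda>t. \<eta> \<alpha> \<epsilon> F (path_shift t w))" if "w \<in> space M" for t w
    using \<eta>_cadlag[OF that] by (simp add: cadlag_def)
qed

text \<open>Linear growth becomes an exponential bound of any positive rate, because two different
  weights must absorb the noise: rate \<open>\<gamma> / \<epsilon>\<close> for the manifold and
  \<open>4 * L\<close> for the flow.\<close>

lemma \<eta>_exp_bound:
  assumes "w \<in> space M" "b > 0"
  obtains D where "D \<ge> 0" "\<And>t. norm (\<eta> \<alpha> \<epsilon> F (path_shift t w)) \<le> D * exp (b * \<bar>t\<bar>)"
proof -
  obtain C where C: "\<And>t. norm (\<eta> \<alpha> \<epsilon> F (path_shift t w)) \<le> C * (1 + \<bar>t\<bar>)"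
    using cadlag_linear_growth[OF \<eta>_cadlag \<eta>_at_top \<eta>_at_bot, OF assms(1,1,1)] by blast
  have C0: "C \<ge> 0" using order_trans[OF norm_ge_zero C[of 0]] by simp
  show ?thesis
  proof (rule that[of "C * (1 + 1 / b)"])
    show "C * (1 + 1 / b) \<ge> 0" using C0 assms(2) by simp
    show "norm (\<eta> \<alpha> \<epsilon> F (path_shift t w)) \<le> C * (1 + 1 / b) * exp (b * \<bar>t\<bar>)" for t
      using order_trans[OF C mult_left_mono[OF linear_le_exp[OF assms(2)] C0]] by (simp add: mult_ac)
  qed
qed

lemma nonlinearity_measurable:
  "(\<lambda>(w, s, z). nonlinearity w s z) \<in> borel_measurable (M \<Otimes>\<^sub>M (borel \<Otimes>\<^sub>M borel))"
proof -
  have 1: "(\<lambda>p. \<eta> \<alpha> \<epsilon> F (path_shift (fst (snd p)) (fst p))) \<in> borel_measurable (M \<Otimes>\<^sub>M (borel \<Otimes>\<^sub>M borel))"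
    using measurable_compose[OF _ \<eta>_jointly_measurable, of "\<lambda>p. (fst (snd p), fst p)" "M \<Otimes>\<^sub>M (borel \<Otimes>\<^sub>M borel)"]
    by simp
  have z: "(\<lambda>p. snd (snd p)) \<in> borel_measurable (M \<Otimes>\<^sub>M (borel \<Otimes>\<^sub>M (borel :: ((real^'m) \<times> (real^'n)) measure)))"
    by measurable
  have f: "(\<lambda>p. fst (snd (snd p))) \<in> borel_measurable (M \<Otimes>\<^sub>M (borel \<Otimes>\<^sub>M (borel :: ((real^'m) \<times> (real^'n)) measure)))"
    and s: "(\<lambda>p. snd (snd (snd p))) \<in> borel_measurable (M \<Otimes>\<^sub>M (borel \<Otimes>\<^sub>M (borel :: ((real^'m) \<times> (real^'n)) measure)))"
    by (rule measurable_compose[OF z borel_measurable_continuous_onI]; intro continuous_intros)+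
  have 2: "(\<lambda>p. (fst (snd (snd p)), snd (snd (snd p)) + \<sigma> *\<^sub>R \<eta> \<alpha> \<epsilon> F (path_shift (fst (snd p)) (fst p))))
      \<in> borel_measurable (M \<Otimes>\<^sub>M (borel \<Otimes>\<^sub>M (borel :: ((real^'m) \<times> (real^'n)) measure)))"
    using 1 f s by (intro borel_measurable_Pair borel_measurable_add borel_measurable_scaleR) auto
  have "continuous_on UNIV (\<lambda>p. (g1 p, g2 p))"
    using pos(4) by (intro continuous_on_Pair lipschitz_sum_norm_continuous[OF g_lipschitz(1)]
        lipschitz_sum_norm_continuous[OF g_lipschitz(2)]) auto
  from measurable_compose[OF 2 borel_measurable_continuous_onI[OF this]]
  show ?thesis by (simp add: nonlinearity_def split_beta')
qed

lemma vector_field_measurable: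
  "(\<lambda>(w, s, z). vector_field w s z) \<in> borel_measurable (M \<Otimes>\<^sub>M (borel \<Otimes>\<^sub>M borel))"
proof -
  have z: "(\<lambda>p. snd (snd p)) \<in> borel_measurable (M \<Otimes>\<^sub>M (borel \<Otimes>\<^sub>M (borel :: ((real^'m) \<times> (real^'n)) measure)))"
    by measurable
  have 1: "(\<lambda>p. (snd (snd p), nonlinearity (fst p) (fst (snd p)) (snd (snd p))))
      \<in> borel_measurable (M \<Otimes>\<^sub>M (borel \<Otimes>\<^sub>M (borel :: ((real^'m) \<times> (real^'n)) measure)))"
    using nonlinearity_measurable z by (intro borel_measurable_Pair) (auto simp: split_beta')
  have 2: "continuous_on UNIV (\<lambda>(z, n). (S *v fst z + fst n, fast_matrix *v snd z + (1 / \<epsilon>) *\<^sub>R snd n))"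
    unfolding split_beta'
    by (intro continuous_intros bounded_linear.continuous_on[OF matrix_vector_mul_bounded_linear])
  from measurable_compose[OF 1 borel_measurable_continuous_onI[OF 2]]
  show ?thesis by (simp add: vector_field_def split_beta')
qed

lemma nonlinearity_section_measurable:
  assumes "w \<in> space M"
  shows "(\<lambda>(s, z). nonlinearity w s z) \<in> borel_measurable (borel \<Otimes>\<^sub>M borel)"
    "(\<lambda>(s, z). vector_field w s z) \<in> borel_measurable (borel \<Otimes>\<^sub>M borel)"
  using measurable_compose[OF measurable_Pair1'[OF assms] nonlinearity_measurable]
    measurable_compose[OF measurable_Pair1'[OF assms] vector_field_measurable] by simp_all

lemma nonlinearity_lipschitz:
  "norm (fst (nonlinearity w s a) - fst (nonlinearity w s b)) \<le> K * sum_norm (a - b)"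
  "norm (snd (nonlinearity w s a) - snd (nonlinearity w s b)) \<le> K * sum_norm (a - b)"
  using g_lipschitz[of "(fst a, snd a + \<sigma> *\<^sub>R \<eta> \<alpha> \<epsilon> F (path_shift s w))" "(fst b, snd b + \<sigma> *\<^sub>R \<eta> \<alpha> \<epsilon> F (path_shift s w))"]
  by (simp_all add: nonlinearity_def sum_norm_def)

lemma nonlinearity_zero:
  assumes "w \<in> space M" "b > 0"
  obtains D where "D \<ge> 0" "\<And>s. norm (fst (nonlinearity w s 0)) \<le> D * exp (b * \<bar>s\<bar>)"
    "\<And>s. norm (snd (nonlinearity w s 0)) \<le> D * exp (b * \<bar>s\<bar>)"
proof -
  obtain D where D: "D \<ge> 0" "\<And>t. norm (\<eta> \<alpha> \<epsilon> F (path_shift t w)) \<le> D * exp (b * \<bar>t\<bar>)"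
    using \<eta>_exp_bound[OF assms] by blast
  show ?thesis
  proof (rule that[of "K * \<bar>\<sigma>\<bar> * D"])
    show "K * \<bar>\<sigma>\<bar> * D \<ge> 0" using pos D(1) by simp
    fix s
    have *: "K * (\<bar>\<sigma>\<bar> * norm (\<eta> \<alpha> \<epsilon> F (path_shift s w))) \<le> K * (\<bar>\<sigma>\<bar> * (D * exp (b * \<bar>s\<bar>)))"
      using D(2)[of s] pos by (intro mult_left_mono) auto
    show "norm (fst (nonlinearity w s 0)) \<le> K * \<bar>\<sigma>\<bar> * D * exp (b * \<bar>s\<bar>)"
      using order_trans[OF g_lipschitz(1)[of "(0, \<sigma> *\<^sub>R \<eta> \<alpha> \<epsilon> F (path_shift s w))" "(0, 0)"]] *
      by (simp add: nonlinearity_def g_zero sum_norm_def mult_ac)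
    show "norm (snd (nonlinearity w s 0)) \<le> K * \<bar>\<sigma>\<bar> * D * exp (b * \<bar>s\<bar>)"
      using order_trans[OF g_lipschitz(2)[of "(0, \<sigma> *\<^sub>R \<eta> \<alpha> \<epsilon> F (path_shift s w))" "(0, 0)"]] *
      by (simp add: nonlinearity_def g_zero sum_norm_def mult_ac)
  qed
qed

lemma nonlinearity_admissible:
  assumes "w \<in> space M"
  shows "admissible_field K (\<lambda>t. exp (\<gamma> / \<epsilon> * \<bar>t\<bar>)) (nonlinearity w)"
proof -
  have "\<gamma> / \<epsilon> > 0" using pos by simp
  then obtain D where D: "\<And>s. norm (fst (nonlinearity w s 0)) \<le> D * exp (\<gamma> / \<epsilon> * \<bar>s\<bar>)"
    "\<And>s. norm (snd (nonlinearity w s 0)) \<le> D * exp (\<gamma> / \<epsilon> * \<bar>s\<bar>)"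
    using nonlinearity_zero[OF assms] by blast
  have "sum_norm (nonlinearity w s 0) \<le> (2 * D) * exp (\<gamma> / \<epsilon> * \<bar>s\<bar>)" for s
    using D[of s] by (simp add: sum_norm_def)
  then show ?thesis
    unfolding admissible_field_def
    using nonlinearity_section_measurable(1)[OF assms] nonlinearity_lipschitz by blast
qed

text \<open>A crude common constant: the slow component needs the first and third summand, the fast
  one the second and fourth.\<close>

definition L :: real where
  "L = onorm ((*v) S) + onorm ((*v) fast_matrix) + K + K / \<epsilon>"

lemma L_pos: "L > 0"
  using pos onorm_pos_le[OF matrix_vector_mul_bounded_linear, of S]
    onorm_pos_le[OF matrix_vector_mul_bounded_linear, of fast_matrix]
  by (simp add: L_def add_nonneg_pos)

lemma vector_field_lipschitz:
  "norm (fst (vector_field w s a) - fst (vector_field w s b)) \<le> L * sum_norm (a - b)" (is ?fst)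
  "norm (snd (vector_field w s a) - snd (vector_field w s b)) \<le> L * sum_norm (a - b)" (is ?snd)
proof -
  have o: "0 \<le> onorm ((*v) S)" "0 \<le> onorm ((*v) fast_matrix)" "0 \<le> K / \<epsilon>"
    using pos by (auto intro!: onorm_pos_le)
  have S: "norm (S *v fst (a - b)) \<le> onorm ((*v) S) * sum_norm (a - b)"
    using order_trans[OF onorm[OF matrix_vector_mul_bounded_linear] mult_left_mono[OF _ o(1)]]
    by (simp add: sum_norm_def)
  have A: "norm (fast_matrix *v snd (a - b)) \<le> onorm ((*v) fast_matrix) * sum_norm (a - b)"
    using order_trans[OF onorm[OF matrix_vector_mul_bounded_linear] mult_left_mono[OF _ o(2)]]
    by (simp add: sum_norm_def)
  have nn: "norm (snd (nonlinearity w s a) - snd (nonlinearity w s b)) / \<epsilon> \<le> K / \<epsilon> * sum_norm (a - b)"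
    using divide_right_mono[OF nonlinearity_lipschitz(2)[of w s a b], of \<epsilon>] pos by simp
  have L: "C * sum_norm (a - b) \<le> L * sum_norm (a - b)" if "C \<le> L" for C
    using that by (intro mult_right_mono) auto
  have "fst (vector_field w s a) - fst (vector_field w s b)
      = S *v fst (a - b) + (fst (nonlinearity w s a) - fst (nonlinearity w s b))"
    by (simp add: vector_field_def matrix_vector_mult_diff_distrib)
  then have "norm (fst (vector_field w s a) - fst (vector_field w s b)) \<le> (onorm ((*v) S) + K) * sum_norm (a - b)"
    using norm_triangle_mono[OF S nonlinearity_lipschitz(1)[of w s a b]] by (simp add: distrib_right)
  then show ?fst using L[of "onorm ((*v) S) + K"] o by (simp add: L_def)
  have "snd (vector_field w s a) - snd (vector_field w s b)
      = fast_matrix *v snd (a - b) + (1 / \<epsilon>) *\<^sub>R (snd (nonlinearity w s a) - snd (nonlinearity w s b))"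
    by (simp add: vector_field_def matrix_vector_mult_diff_distrib scaleR_diff_right)
  then have "norm (snd (vector_field w s a) - snd (vector_field w s b)) \<le> (onorm ((*v) fast_matrix) + K / \<epsilon>) * sum_norm (a - b)"
    using norm_triangle_mono[OF A, of "(1 / \<epsilon>) *\<^sub>R (snd (nonlinearity w s a) - snd (nonlinearity w s b))" "K / \<epsilon> * sum_norm (a - b)"] nn pos
    by (simp add: distrib_right)
  then show ?snd using L[of "onorm ((*v) fast_matrix) + K / \<epsilon>"] o pos by (simp add: L_def)
qed

lemma vector_field_admissible:
  assumes "w \<in> space M"
  shows "admissible_field L (\<lambda>t. exp (4 * L * \<bar>t\<bar>)) (vector_field w)"
proof -
  have "4 * L > 0" using L_pos by simp
  then obtain D where D: "\<And>s. norm (fst (nonlinearity w s 0)) \<le> D * exp (4 * L * \<bar>s\<bar>)"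
    "\<And>s. norm (snd (nonlinearity w s 0)) \<le> D * exp (4 * L * \<bar>s\<bar>)"
    using nonlinearity_zero[OF assms] by blast
  have "sum_norm (vector_field w s 0) \<le> (D + D / \<epsilon>) * exp (4 * L * \<bar>s\<bar>)" for s
    using D(1)[of s] divide_right_mono[OF D(2)[of s], of \<epsilon>] pos
    by (simp add: sum_norm_def vector_field_def distrib_right)
  then show ?thesis
    unfolding admissible_field_def
    using nonlinearity_section_measurable(2)[OF assms] vector_field_lipschitz by blast
qed

text \<open>The rate \<open>4 * L\<close> makes the integral of the weight from 0 to
  \<open>t\<close> at most \<open>exp (4 * L * \<bar>t\<bar>) / (4 * L)\<close>. Each component thus
  contributes 1/4, and one contraction yields the solution on the whole line at once.\<close>

sublocale picard: weighted_kernel "\<lambda>t s. oriented_indicator t s *\<^sub>R (mat 1 :: real^'m^'m)"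
    "\<lambda>t s. oriented_indicator t s *\<^sub>R (mat 1 :: real^'n^'n)"
    "\<lambda>t s. \<bar>oriented_indicator t s\<bar>" "\<lambda>t s. \<bar>oriented_indicator t s\<bar>" "\<lambda>t. exp (4 * L * \<bar>t\<bar>)" L "1/4" "1/4"
proof
  show "(\<lambda>(t, s). oriented_indicator t s *\<^sub>R (mat 1 :: real^'m^'m)) \<in> borel_measurable (borel \<Otimes>\<^sub>M borel)"
    "(\<lambda>(t, s). oriented_indicator t s *\<^sub>R (mat 1 :: real^'n^'n)) \<in> borel_measurable (borel \<Otimes>\<^sub>M borel)"
    by measurable
  have "4 * L > 0" using L_pos by simp
  note * = oriented_indicator_exp_integral[OF this]
  show "integrable lborel (\<lambda>s. \<bar>oriented_indicator t s\<bar> * exp (4 * L * \<bar>s\<bar>))" for t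
    by (fact *(1))
  show "L * (\<integral>s. \<bar>oriented_indicator t s\<bar> * exp (4 * L * \<bar>s\<bar>) \<partial>lborel) \<le> 1/4 * exp (4 * L * \<bar>t\<bar>)" for t
    using mult_left_mono[OF *(2)[of t], of L] L_pos by simp
qed (use L_pos in \<open>simp_all add: scaleR_matrix_vector_assoc[symmetric]\<close>)

section \<open>The Lyapunov-Perron kernels\<close>

lemma mexp_fast_matrix_bound:
  assumes "t \<ge> 0"
  shows "norm (mexp (t *\<^sub>R fast_matrix) *v y) \<le> exp (\<gamma>f / \<epsilon> * t) * norm y"
  using F_bound[of "t / \<epsilon>" y] assms pos by (simp add: fast_matrix_def)

text \<open>The factor -1 writes the integral from 0 to \<open>t \<le> 0\<close> as minus the
  integral over \<open>(t, 0]\<close>. This kernel and \<open>fast_kernel\<close> vanish for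
  \<open>t > 0\<close>, so that functions of interest on the negative half-line fit the whole-line
  setting of \<open>weighted_kernel\<close>.\<close>

definition slow_kernel :: "real \<Rightarrow> real \<Rightarrow> real^'m^'m" where
  "slow_kernel t s = (if t < s \<and> s \<le> 0 then - 1 else 0) *\<^sub>R mexp ((t - s) *\<^sub>R S)"

definition fast_kernel :: "real \<Rightarrow> real \<Rightarrow> real^'n^'n" where
  "fast_kernel t s = (if s \<le> t \<and> t \<le> 0 then 1 / \<epsilon> else 0) *\<^sub>R mexp ((t - s) *\<^sub>R fast_matrix)"

text \<open>Against the weight of rate b = \<gamma>/\<epsilon>, the slow kernel integrates like an
  exponential of rate \<gamma>s + b. The fast one has net rate -(\<gamma>f + \<gamma>)/\<epsilon>,
  whose \<epsilon> cancels against the prefactor 1/\<epsilon>.\<close>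

sublocale lyapunov_perron: weighted_kernel slow_kernel fast_kernel
    "\<lambda>t s. if t < s \<and> s \<le> 0 then exp (\<gamma>s * (t - s)) else 0"
    "\<lambda>t s. if s \<le> t \<and> t \<le> 0 then 1 / \<epsilon> * exp (\<gamma>f / \<epsilon> * (t - s)) else 0"
    "\<lambda>t. exp (\<gamma> / \<epsilon> * \<bar>t\<bar>)" K "\<epsilon> * K / (\<gamma> + \<epsilon> * \<gamma>s)" "- (K / (\<gamma> + \<gamma>f))"
proof
  have m: "(\<lambda>p. mexp ((fst p - snd p) *\<^sub>R A)) \<in> borel_measurable (borel \<Otimes>\<^sub>M borel)" for A :: "real^'i^'i"
    by (rule mexp_measurable) measurable
  show "(\<lambda>(t, s). slow_kernel t s) \<in> borel_measurable (borel \<Otimes>\<^sub>M borel)"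
    unfolding slow_kernel_def split_beta' by (rule borel_measurable_scaleR[OF _ m]) measurable
  show "(\<lambda>(t, s). fast_kernel t s) \<in> borel_measurable (borel \<Otimes>\<^sub>M borel)"
    unfolding fast_kernel_def split_beta' by (rule borel_measurable_scaleR[OF _ m]) measurable
  show "norm (slow_kernel t s *v x) \<le> (if t < s \<and> s \<le> 0 then exp (\<gamma>s * (t - s)) else 0) * norm x" for t s x
    using S_bound[of "t - s" x]
    by (simp add: slow_kernel_def scaleR_matrix_vector_assoc[symmetric]
        bounded_bilinear.minus_left[OF bounded_bilinear_matrix_vector_mult])
  show "norm (fast_kernel t s *v x) \<le> (if s \<le> t \<and> t \<le> 0 then 1 / \<epsilon> * exp (\<gamma>f / \<epsilon> * (t - s)) else 0) * norm x" for t s x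
    using divide_right_mono[OF mexp_fast_matrix_bound[of "t - s" x], of \<epsilon>] pos
    by (simp add: fast_kernel_def scaleR_matrix_vector_assoc[symmetric])
  define b where "b = \<gamma> / \<epsilon>"
  have b: "b > 0" using pos by (simp add: b_def)
  have gf: "\<gamma> + \<gamma>f < 0" using gap pos by simp
  have 1: "integrable lborel (\<lambda>s. (if t < s \<and> s \<le> 0 then exp (\<gamma>s * (t - s)) else 0) * exp (b * \<bar>s\<bar>)) \<and>
      (\<integral>s. (if t < s \<and> s \<le> 0 then exp (\<gamma>s * (t - s)) else 0) * exp (b * \<bar>s\<bar>) \<partial>lborel) \<le> exp (b * \<bar>t\<bar>) / (\<gamma>s + b)"
    (is "integrable lborel ?k \<and> _") for t
  proof -
    \<comment> \<open>On the support \<open>s \<le> 0\<close>, so the weight is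
      \<open>exp (- b * s)\<close>; the range is then enlarged from \<open>(t, 0]\<close> to
      \<open>[t, \<infinity>)\<close>, where the integral is explicit.\<close>
    have k: "?k s \<le> exp (\<gamma>s * t) * (indicator {t..} s * exp (- (\<gamma>s + b) * s))" for s
      by (auto simp: indicator_def exp_add[symmetric] algebra_simps)
    have k0: "0 \<le> ?k s" for s by simp
    have km: "?k \<in> borel_measurable borel" by measurable
    have "\<gamma>s + b > 0" using b pos by simp
    note integral_bound_by_has_bochner_integral[OF has_bochner_integral_exp_atLeast[OF this] km k0 k]
    moreover have "exp (\<gamma>s * t) * (exp (- (\<gamma>s + b) * t) / (\<gamma>s + b)) = exp (- b * t) / (\<gamma>s + b)"
      by (simp add: exp_add[symmetric] algebra_simps)
    moreover have "exp (- b * t) / (\<gamma>s + b) \<le> exp (b * \<bar>t\<bar>) / (\<gamma>s + b)"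
      using b pos by (intro divide_right_mono) (auto simp: minus_le_iff abs_if)
    ultimately show ?thesis by auto
  qed
  then show "integrable lborel (\<lambda>s. (if t < s \<and> s \<le> 0 then exp (\<gamma>s * (t - s)) else 0) * exp (\<gamma> / \<epsilon> * \<bar>s\<bar>))" for t
    by (simp add: b_def)
  have "\<epsilon> * K / (\<gamma> + \<epsilon> * \<gamma>s) = K / (\<gamma>s + b)"
    using pos by (simp add: b_def field_simps)
  then show "K * (\<integral>s. (if t < s \<and> s \<le> 0 then exp (\<gamma>s * (t - s)) else 0) * exp (\<gamma> / \<epsilon> * \<bar>s\<bar>) \<partial>lborel)
      \<le> \<epsilon> * K / (\<gamma> + \<epsilon> * \<gamma>s) * exp (\<gamma> / \<epsilon> * \<bar>t\<bar>)" for t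
    using mult_left_mono[OF conjunct2[OF 1[of t]], of K] pos by (simp add: b_def)
  \<comment> \<open>The margin by which the fast decay beats the growth allowed by the weight; its
    positivity is what makes the integral over the infinite past converge.\<close>
  define m where "m = - (\<gamma>f + \<gamma>) / \<epsilon>"
  have m: "m > 0" "\<gamma>f / \<epsilon> = - (m + b)" using pos gf by (auto simp: m_def b_def field_simps)
  have 2: "integrable lborel (\<lambda>s. (if s \<le> t \<and> t \<le> 0 then 1 / \<epsilon> * exp (\<gamma>f / \<epsilon> * (t - s)) else 0) * exp (b * \<bar>s\<bar>)) \<and>
      (\<integral>s. (if s \<le> t \<and> t \<le> 0 then 1 / \<epsilon> * exp (\<gamma>f / \<epsilon> * (t - s)) else 0) * exp (b * \<bar>s\<bar>) \<partial>lborel)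
        \<le> 1 / \<epsilon> * (exp (b * \<bar>t\<bar>) / m)"
    (is "integrable lborel ?k \<and> _") for t
  proof -
    have k: "?k s \<le> (1 / \<epsilon> * exp (\<gamma>f / \<epsilon> * t)) * (indicator {..t} s * exp (m * s))" for s
      using pos unfolding m(2) by (auto simp: indicator_def exp_add[symmetric] algebra_simps divide_simps)
    have k0: "0 \<le> ?k s" for s using pos by simp
    have km: "?k \<in> borel_measurable borel" by measurable
    note integral_bound_by_has_bochner_integral[OF has_bochner_integral_exp_atMost[OF m(1)] km k0 k]
    moreover have "(1 / \<epsilon> * exp (\<gamma>f / \<epsilon> * t)) * (exp (m * t) / m) = 1 / \<epsilon> * (exp (- b * t) / m)"
      unfolding m(2) by (simp add: exp_add[symmetric] algebra_simps)
    moreover have "1 / \<epsilon> * (exp (- b * t) / m) \<le> 1 / \<epsilon> * (exp (b * \<bar>t\<bar>) / m)"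
      using b pos m by (intro mult_left_mono divide_right_mono) (auto simp: minus_le_iff abs_if)
    ultimately show ?thesis by auto
  qed
  then show "integrable lborel (\<lambda>s. (if s \<le> t \<and> t \<le> 0 then 1 / \<epsilon> * exp (\<gamma>f / \<epsilon> * (t - s)) else 0) * exp (\<gamma> / \<epsilon> * \<bar>s\<bar>))" for t
    by (simp only: b_def)
  have "- (K / (\<gamma> + \<gamma>f)) = K * (1 / \<epsilon> / m)"
    using pos gf by (simp add: m_def divide_simps) (simp add: algebra_simps)
  then show "K * (\<integral>s. (if s \<le> t \<and> t \<le> 0 then 1 / \<epsilon> * exp (\<gamma>f / \<epsilon> * (t - s)) else 0) * exp (\<gamma> / \<epsilon> * \<bar>s\<bar>) \<partial>lborel)
      \<le> - (K / (\<gamma> + \<gamma>f)) * exp (\<gamma> / \<epsilon> * \<bar>t\<bar>)" for t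
    using mult_left_mono[OF conjunct2[OF 2[of t]], of K] pos by (simp add: b_def)
  have "\<epsilon> * K / (\<gamma> + \<epsilon> * \<gamma>s) \<le> \<epsilon> * K / \<gamma>"
    using pos by (intro divide_left_mono) (auto intro!: mult_pos_pos add_pos_pos)
  then show "\<epsilon> * K / (\<gamma> + \<epsilon> * \<gamma>s) + - (K / (\<gamma> + \<gamma>f)) < 1" using small by linarith
  show "- (K / (\<gamma> + \<gamma>f)) \<ge> 0" using gf pos by (simp add: divide_nonneg_neg divide_nonpos_pos zero_le_divide_iff divide_le_0_iff)
qed (use pos in auto)

end

section \<open>Flow and slow manifold\<close>

lemma closed_interval_continuous_imp_continuous:
  fixes z :: "real \<Rightarrow> 'a::topological_space"
  assumes "\<And>a b. continuous_on {a..b} z"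
  shows "continuous_on X z"
proof -
  have "isCont z t" for t
    using continuous_on_interior[OF assms[of "t - 1" "t + 1"], of t] by simp
  then show ?thesis by (simp add: continuous_at_imp_continuous_on)
qed

text \<open>The distance to the graph is an infimum over all \<open>x\<close>. By continuity of
  \<open>h w\<close> a countable dense set of \<open>x\<close> gives the same value, and a countable
  infimum of random variables is measurable.\<close>

lemma random_set_graph:
  fixes h :: "'w \<Rightarrow> 'x::{second_countable_topology, metric_space} \<Rightarrow> 'y::{second_countable_topology, metric_space}"
  assumes h: "\<And>x. (\<lambda>w. h w x) \<in> borel_measurable M"
    and c: "\<And>w. w \<in> space M \<Longrightarrow> continuous_on UNIV (h w)"
    and A: "\<And>w. w \<in> space M \<Longrightarrow> A w = {(x, h w x) | x. True}"
  shows "random_set M A"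
  unfolding random_set_def
proof (intro conjI ballI allI)
  fix w assume w: "w \<in> space M"
  have "A w = {p. snd p = h w (fst p)}" using A[OF w] by auto
  moreover have "closed {p. snd p = h w (fst p)}"
    by (intro closed_Collect_eq continuous_intros continuous_on_compose2[OF c[OF w]]) auto
  ultimately show "closed (A w)" by simp
  show "A w \<noteq> {}" using A[OF w] by auto
next
  fix z :: "'x \<times> 'y"
  obtain D :: "'x set" where D: "countable D" "\<And>X. open X \<Longrightarrow> X \<noteq> {} \<Longrightarrow> \<exists>d\<in>D. d \<in> X"
    using countable_dense_exists by blast
  have D0: "D \<noteq> {}" using D(2)[of UNIV] by auto
  have "(\<lambda>w. INF x\<in>D. dist z (x, h w x)) \<in> borel_measurable M"
    using D(1) h by (intro borel_measurable_cINF_real) (auto intro!: borel_measurable_dist borel_measurable_Pair)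
  moreover have "infdist z (A w) = (INF x\<in>D. dist z (x, h w x))" if w: "w \<in> space M" for w
  proof -
    have Aw: "A w = range (\<lambda>x. (x, h w x))" using A[OF w] by auto
    have bdd: "bdd_below ((\<lambda>x. dist z (x, h w x)) ` X)" for X
      by (auto intro!: bdd_belowI2[of _ 0])
    have "infdist z (A w) = (INF x. dist z (x, h w x))"
      unfolding infdist_def Aw by (simp add: image_image)
    moreover have "(INF x. dist z (x, h w x)) \<le> (INF x\<in>D. dist z (x, h w x))"
      using D0 bdd by (intro cINF_superset_mono) auto
    moreover have "(INF x\<in>D. dist z (x, h w x)) \<le> (INF x. dist z (x, h w x))"
    proof (rule cINF_greatest)
      fix x
      show "(INF x\<in>D. dist z (x, h w x)) \<le> dist z (x, h w x)"
      proof (rule field_le_epsilon)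
        fix e :: real assume "e > 0"
        have "continuous_on UNIV (\<lambda>x. dist z (x, h w x))"
          by (intro continuous_intros c w)
        then have "open {y. dist z (y, h w y) < dist z (x, h w x) + e}"
          by (intro open_Collect_less) (auto intro: continuous_intros)
        moreover have "x \<in> {y. dist z (y, h w y) < dist z (x, h w x) + e}" using \<open>e > 0\<close> by simp
        ultimately obtain d where d: "d \<in> D" "dist z (d, h w d) < dist z (x, h w x) + e"
          using D(2)[of "{y. dist z (y, h w y) < dist z (x, h w x) + e}"] by blast
        have "(INF x\<in>D. dist z (x, h w x)) \<le> dist z (d, h w d)"
          using d(1) by (intro cINF_lower bdd)
        then show "(INF x\<in>D. dist z (x, h w x)) \<le> dist z (x, h w x) + e" using d(2) by simp
      qed
    qed simp
    ultimately show ?thesis by simp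
  qed
  ultimately show "(\<lambda>w. infdist z (A w)) \<in> borel_measurable M"
    by (simp cong: measurable_cong)
qed

context slow_fast_system
begin

section \<open>Existence, uniqueness and cocycle property of the flow\<close>

abbreviation solves :: "(real \<Rightarrow> real^'n) \<Rightarrow> (real^'m) \<times> (real^'n) \<Rightarrow> (real \<Rightarrow> (real^'m) \<times> (real^'n)) \<Rightarrow> bool" where
  "solves \<equiv> solution S F g1 g2 \<sigma> \<alpha> \<epsilon>"

abbreviation \<phi> :: "real \<Rightarrow> (real \<Rightarrow> real^'n) \<Rightarrow> (real^'m) \<times> (real^'n) \<Rightarrow> (real^'m) \<times> (real^'n)" where
  "\<phi> \<equiv> flow S F g1 g2 \<sigma> \<alpha> \<epsilon>"

lemma solves_continuous:
  assumes "solves w z0 z"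
  shows "continuous_on X z"
proof (rule closed_interval_continuous_imp_continuous)
  fix a b
  show "continuous_on {a..b} z"
    by (rule has_integral_increments_continuous_on[of a b "\<lambda>u. vector_field w u (z u)"])
      (use assms in \<open>simp add: solution_iff\<close>)
qed

text \<open>Uniqueness is phrased in the Euclidean norm: one factor 2 comes from adding two
  components, the other from \<open>sum_norm z \<le> 2 * norm z\<close>.\<close>

lemma vector_field_norm_lipschitz:
  "norm (vector_field w s a - vector_field w s b) \<le> (4 * L) * norm (a - b)"
proof -
  have "norm (vector_field w s a - vector_field w s b) \<le> sum_norm (vector_field w s a - vector_field w s b)"
    by (rule norm_le_sum_norm)
  also have "\<dots> \<le> L * sum_norm (a - b) + L * sum_norm (a - b)"
    unfolding sum_norm_def[of "vector_field w s a - vector_field w s b"]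
    unfolding fst_diff snd_diff by (rule add_mono[OF vector_field_lipschitz])
  also have "\<dots> \<le> L * (2 * norm (a - b)) + L * (2 * norm (a - b))"
    using L_pos sum_norm_le_norm[of "a - b"] by (intro add_mono mult_left_mono) auto
  finally show ?thesis by (simp add: mult_ac)
qed

lemma solves_unique:
  assumes "solves w z0 z" "solves w z0 z'"
  shows "z = z'"
proof
  fix t
  show "z t = z' t"
    by (rule integrated_ode_unique[where G="vector_field w" and L="4 * L" and a="min t 0" and b="max t 0",
          OF vector_field_norm_lipschitz])
      (use assms in \<open>auto simp: solution_iff\<close>)
qed

definition trajectory :: "(real \<Rightarrow> real^'n) \<Rightarrow> (real^'m) \<times> (real^'n) \<Rightarrow> real \<Rightarrow> (real^'m) \<times> (real^'n)" where
  "trajectory w z0 = picard.fixed_point (\<lambda>_. z0) (vector_field w)"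

lemma trajectory_solves:
  assumes w: "w \<in> space M"
  shows "solves w z0 (trajectory w z0)"
proof -
  let ?z = "trajectory w z0" and ?p = "\<lambda>t. exp (4 * L * \<bar>t\<bar>)"
  let ?b = "\<lambda>s. vector_field w s (?z s)"
  note f = vector_field_admissible[OF w]
  have c: "(\<lambda>_. z0) \<in> borel_measurable borel" "weighted_bounded ?p (\<lambda>_::real. z0)"
  proof -
    have "sum_norm z0 \<le> sum_norm z0 * ?p t" for t
      using mult_left_mono[of 1 "?p t" "sum_norm z0"] L_pos by simp
    then show "weighted_bounded ?p (\<lambda>_::real. z0)" unfolding weighted_bounded_def by blast
  qed simp
  have z: "?z \<in> borel_measurable borel" "weighted_bounded ?p ?z" "?z t = picard.kop (\<lambda>_. z0) (vector_field w) ?z t" for t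
    unfolding trajectory_def by (fact picard.fixed_point[OF f c])+
  obtain D where D: "D \<ge> 0" "\<And>s. norm (fst (?b s)) \<le> D * ?p s" "\<And>s. norm (snd (?b s)) \<le> D * ?p s"
    using picard.field_bound[OF f z(2)] by blast
  have b: "bounded ((\<lambda>s. fst (?b s)) ` {l..r})" "bounded ((\<lambda>s. snd (?b s)) ` {l..r})" for l r
    using exp_bound_imp_bounded[OF D(2,1)] exp_bound_imp_bounded[OF D(3,1)] L_pos by simp_all
  note m = picard.measurable_field(2,3)[OF f z(1)]
  note i = picard.kop_integrable[OF f z(1,2)]
  have "(?b has_integral ?z t - ?z s) {s..t}" if "s \<le> t" for s t
  proof -
    \<comment> \<open>With \<open>A = 0\<close> the exponential is the identity and the mild
      equation is the plain integral equation; the linear part of the system is here contained in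
      \<open>vector_field\<close>.\<close>
    have "((\<lambda>q. (0 :: real^'m^'m) *v fst (?z q) + fst (?b q)) has_integral fst (?z t) - fst (?z s)) {s..t}"
    proof (rule mild_imp_integrated[where \<iota>=oriented_indicator and x="fst z0", OF m(1) b(1) that])
      show "integrable lborel (\<lambda>q. oriented_indicator r q *\<^sub>R (mexp ((r - q) *\<^sub>R (0 :: real^'m^'m)) *v fst (?b q)))" for r
        using i(1)[of r] by (simp add: mexp_0 scaleR_matrix_vector_assoc[symmetric])
      show "fst (?z r) = mexp (r *\<^sub>R (0 :: real^'m^'m)) *v fst z0
          + (\<integral>q. oriented_indicator r q *\<^sub>R (mexp ((r - q) *\<^sub>R (0 :: real^'m^'m)) *v fst (?b q)) \<partial>lborel)" for r
        by (subst z(3)) (simp add: picard.kop_def mexp_0 scaleR_matrix_vector_assoc[symmetric])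
    qed (rule oriented_indicator_diff)
    moreover
    have "((\<lambda>q. (0 :: real^'n^'n) *v snd (?z q) + snd (?b q)) has_integral snd (?z t) - snd (?z s)) {s..t}"
    proof (rule mild_imp_integrated[where \<iota>=oriented_indicator and x="snd z0", OF m(2) b(2) that])
      show "integrable lborel (\<lambda>q. oriented_indicator r q *\<^sub>R (mexp ((r - q) *\<^sub>R (0 :: real^'n^'n)) *v snd (?b q)))" for r
        using i(2)[of r] by (simp add: mexp_0 scaleR_matrix_vector_assoc[symmetric])
      show "snd (?z r) = mexp (r *\<^sub>R (0 :: real^'n^'n)) *v snd z0
          + (\<integral>q. oriented_indicator r q *\<^sub>R (mexp ((r - q) *\<^sub>R (0 :: real^'n^'n)) *v snd (?b q)) \<partial>lborel)" for r
        by (subst z(3)) (simp add: picard.kop_def mexp_0 scaleR_matrix_vector_assoc[symmetric])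
    qed (rule oriented_indicator_diff)
    ultimately have "((\<lambda>q. (fst (?b q), snd (?b q))) has_integral (fst (?z t) - fst (?z s), snd (?z t) - snd (?z s))) {s..t}"
      by (intro has_integral_Pair) simp_all
    then show ?thesis by (simp add: minus_prod_def)
  qed
  moreover have "?z 0 = z0"
  proof -
    have "oriented_indicator 0 s = 0" for s by (simp add: oriented_indicator_def)
    then show ?thesis by (subst z(3)) (simp add: picard.kop_def prod_eq_iff)
  qed
  ultimately show ?thesis by (simp add: solution_iff)
qed

text \<open>Replaces the definite description in \<open>flow\<close> by a limit of iterates, whose
  measurability is accessible.\<close>

lemma flow_eq_trajectory:
  assumes "w \<in> space M"
  shows "\<phi> t w z0 = trajectory w z0 t"
proof -
  have "(THE z. solves w z0 z) = trajectory w z0"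
    using trajectory_solves[OF assms] solves_unique by blast
  then show ?thesis by (simp add: flow_def)
qed

text \<open>Shifting a solution in time solves the equation driven by the shifted path, since shifts
  of the noise compose; uniqueness does the rest.\<close>

lemma trajectory_shift:
  assumes w: "w \<in> space M"
  shows "trajectory w z0 (t + s) = trajectory (path_shift s w) (trajectory w z0 s) t"
proof -
  let ?z = "trajectory w z0"
  have "solves (path_shift s w) (?z s) (\<lambda>t. ?z (t + s))"
    unfolding solution_iff
  proof (intro conjI allI impI)
    fix a b :: real assume "a \<le> b"
    then have "((\<lambda>u. vector_field w u (?z u)) has_integral ?z (b + s) - ?z (a + s)) {a + s..b + s}"
      using trajectory_solves[OF w, of z0] by (simp add: solution_iff)
    from has_integral_shift_real_ivl[OF this, of s]
    show "((\<lambda>u. vector_field (path_shift s w) u (?z (u + s))) has_integral ?z (b + s) - ?z (a + s)) {a..b}"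
      by (simp add: vector_field_def nonlinearity_def path_shift_add)
  qed simp
  from solves_unique[OF this trajectory_solves[OF shift_space[OF w]]]
  show ?thesis by metis
qed

lemma flow_random_dynamical_system: "random_dynamical_system M path_shift \<phi>"
  unfolding random_dynamical_system_def
proof (intro conjI ballI allI)
  \<comment> \<open>The initial value is made part of the parameter, so joint measurability in path,
    initial value and time comes from a single parametrised fixed point.\<close>
  let ?N = "M \<Otimes>\<^sub>M (borel :: ((real^'m) \<times> (real^'n)) measure)"
  have "(\<lambda>p. (fst (fst p), fst (snd p), snd (snd p))) \<in> measurable (?N \<Otimes>\<^sub>M (borel \<Otimes>\<^sub>M borel))
      (M \<Otimes>\<^sub>M ((borel :: real measure) \<Otimes>\<^sub>M (borel :: ((real^'m) \<times> (real^'n)) measure)))"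
    by measurable
  from measurable_compose[OF this vector_field_measurable]
  have v: "(\<lambda>(v, s, z). vector_field (fst v) s z) \<in> borel_measurable (?N \<Otimes>\<^sub>M (borel \<Otimes>\<^sub>M borel))"
    by (simp add: split_beta')
  have "(\<lambda>(v, t). snd v) \<in> borel_measurable (?N \<Otimes>\<^sub>M (borel :: real measure))"
    by measurable
  from picard.fixed_point_measurable_param[OF this v]
  have T: "(\<lambda>(v, t). trajectory (fst v) (snd v) t) \<in> borel_measurable (?N \<Otimes>\<^sub>M borel)"
    by (simp add: trajectory_def)
  have "(\<lambda>p. (snd p, fst p)) \<in> measurable ((borel :: real measure) \<Otimes>\<^sub>M ?N) (?N \<Otimes>\<^sub>M borel)"
    by measurable
  from measurable_compose[OF this T]
  have T': "(\<lambda>(t, w, z). trajectory w z t) \<in> borel_measurable (borel \<Otimes>\<^sub>M ?N)"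
    by (simp add: split_beta')
  have "(\<lambda>(t, w, z). \<phi> t w z) \<in> borel_measurable (borel \<Otimes>\<^sub>M ?N) \<longleftrightarrow>
      (\<lambda>(t, w, z). trajectory w z t) \<in> borel_measurable (borel \<Otimes>\<^sub>M ?N)"
    by (rule measurable_cong) (auto simp: space_pair_measure flow_eq_trajectory)
  with T' show "(\<lambda>(t, w, z). \<phi> t w z) \<in> borel_measurable (borel \<Otimes>\<^sub>M ?N)" by blast
  fix w z assume w: "w \<in> space M"
  show "\<phi> 0 w z = z"
    using trajectory_solves[OF w, of z] by (simp add: flow_eq_trajectory[OF w] solution_iff)
  show "\<phi> (t + s) w z = \<phi> t (path_shift s w) (\<phi> s w z)" for t s
    using trajectory_shift[OF w] by (simp add: flow_eq_trajectory w shift_space)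
qed

section \<open>The Lyapunov-Perron fixed point and its uniqueness\<close>

definition slow_data :: "real^'m \<Rightarrow> real \<Rightarrow> (real^'m) \<times> (real^'n)" where
  "slow_data x t = (if t \<le> 0 then (mexp (t *\<^sub>R S) *v x, 0) else 0)"

lemma slow_data_measurable: "slow_data x \<in> borel_measurable borel"
proof -
  have "(\<lambda>t. mexp (t *\<^sub>R S) *v x) \<in> borel_measurable borel"
    by (intro measurable_matrix_vector_mult mexp_measurable) measurable
  then show ?thesis unfolding slow_data_def by measurable
qed

lemma slow_data_diff: "sum_norm (slow_data x t - slow_data y t) \<le> norm (x - y) * exp (\<gamma> / \<epsilon> * \<bar>t\<bar>)"
proof (cases "t \<le> 0")
  case True
  have "sum_norm (slow_data x t - slow_data y t) = norm (mexp (t *\<^sub>R S) *v (x - y))"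
    using True by (simp add: slow_data_def sum_norm_def matrix_vector_mult_diff_distrib)
  also have "\<dots> \<le> exp (\<gamma>s * t) * norm (x - y)" by (rule S_bound[OF True])
  also have "\<dots> \<le> exp (\<gamma> / \<epsilon> * \<bar>t\<bar>) * norm (x - y)"
  proof (rule mult_right_mono)
    have "\<gamma>s * t \<le> 0" using True pos by (simp add: mult_nonneg_nonpos)
    also have "0 \<le> \<gamma> / \<epsilon> * \<bar>t\<bar>" using pos by (intro mult_nonneg_nonneg) auto
    finally show "exp (\<gamma>s * t) \<le> exp (\<gamma> / \<epsilon> * \<bar>t\<bar>)" by (simp only: exp_le_cancel_iff)
  qed simp
  finally show ?thesis by (simp add: mult.commute)
qed (simp add: slow_data_def)

lemma slow_data_weighted_bounded: "weighted_bounded (\<lambda>t. exp (\<gamma> / \<epsilon> * \<bar>t\<bar>)) (slow_data x)"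
proof -
  have "slow_data 0 t = 0" for t by (simp add: slow_data_def zero_prod_def)
  then show ?thesis
    unfolding weighted_bounded_def using slow_data_diff[of x _ 0] by (intro exI[of _ "norm x"]) simp
qed

text \<open>Only the slow component of the data is prescribed; the fast component of
  \<open>slow_data\<close> is zero because the requirement of bounded weighted norm at minus
  infinity selects it.\<close>

definition lp_solution :: "(real \<Rightarrow> real^'n) \<Rightarrow> real^'m \<Rightarrow> real \<Rightarrow> (real^'m) \<times> (real^'n)" where
  "lp_solution w x = lyapunov_perron.fixed_point (slow_data x) (nonlinearity w)"

definition manifold_map :: "(real \<Rightarrow> real^'n) \<Rightarrow> real^'m \<Rightarrow> real^'n" where
  "manifold_map w x = snd (lp_solution w x 0)"

lemma lp_solution:
  assumes "w \<in> space M"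
  shows "lp_solution w x \<in> borel_measurable borel"
    "weighted_bounded (\<lambda>t. exp (\<gamma> / \<epsilon> * \<bar>t\<bar>)) (lp_solution w x)"
    "lp_solution w x t = lyapunov_perron.kop (slow_data x) (nonlinearity w) (lp_solution w x) t"
  unfolding lp_solution_def
  by (fact lyapunov_perron.fixed_point[OF nonlinearity_admissible[OF assms] slow_data_measurable slow_data_weighted_bounded])+

lemma lp_solution_0:
  assumes "w \<in> space M"
  shows "lp_solution w x 0 = (x, manifold_map w x)"
proof -
  \<comment> \<open>At \<open>t = 0\<close> the range \<open>0 < s \<le> 0\<close> is empty, so the
    slow initial value is attained exactly, whereas the fast value is an integral over the whole
    past.\<close>
  have "slow_kernel 0 = (\<lambda>_. 0)" by (auto simp: slow_kernel_def fun_eq_iff)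
  then have "fst (lp_solution w x 0) = x"
    by (subst lp_solution(3)[OF assms]) (simp add: lyapunov_perron.kop_def slow_data_def mexp_0)
  then show ?thesis by (simp add: manifold_map_def prod_eq_iff)
qed

lemma slow_kernel_mult:
  "slow_kernel t s *v y = (if t < s \<and> s \<le> 0 then - 1 else 0) *\<^sub>R (mexp ((t - s) *\<^sub>R S) *v y)"
  unfolding slow_kernel_def by (simp only: scaleR_matrix_vector_assoc)

lemma fast_kernel_mult:
  assumes "t \<le> 0"
  shows "fast_kernel t s *v y = (if s \<le> t then 1 else 0) *\<^sub>R (mexp ((t - s) *\<^sub>R fast_matrix) *v ((1 / \<epsilon>) *\<^sub>R y))"
  using assms by (simp add: fast_kernel_def scaleR_matrix_vector_assoc[symmetric] matrix_vector_mult_scaleR)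

lemma lp_solution_solves:
  assumes w: "w \<in> space M" and st: "s \<le> t" "t \<le> 0"
  shows "((\<lambda>u. vector_field w u (lp_solution w x u)) has_integral lp_solution w x t - lp_solution w x s) {s..t}"
proof -
  let ?z = "lp_solution w x"
  let ?n = "\<lambda>s. nonlinearity w s (?z s)"
  note f = nonlinearity_admissible[OF w] and z = lp_solution[OF w, of x]
  obtain D where D: "D \<ge> 0" "\<And>s. norm (fst (?n s)) \<le> D * exp (\<gamma> / \<epsilon> * \<bar>s\<bar>)"
    "\<And>s. norm (snd (?n s)) \<le> D * exp (\<gamma> / \<epsilon> * \<bar>s\<bar>)"
    using lyapunov_perron.field_bound[OF f z(2)] by blast
  have g: "\<gamma> / \<epsilon> \<ge> 0" using pos by simp
  have b1: "bounded ((\<lambda>s. fst (?n s)) ` {l..r})" for l r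
    by (rule exp_bound_imp_bounded[OF D(2,1) g])
  have b2: "bounded ((\<lambda>s. (1 / \<epsilon>) *\<^sub>R snd (?n s)) ` {l..r})" for l r
    using bounded_scaling[OF exp_bound_imp_bounded[OF D(3,1) g, of l r], of "1 / \<epsilon>"] by (simp add: image_image)
  note m = lyapunov_perron.measurable_field(2,3)[OF f z(1)]
  note i = lyapunov_perron.kop_integrable[OF f z(1,2)]
  have "((\<lambda>q. S *v fst (?z q) + fst (?n q)) has_integral fst (?z t) - fst (?z s)) {s..t}"
  proof (rule mild_imp_integrated[where \<iota>="\<lambda>t s. if t < s \<and> s \<le> 0 then - 1 else 0" and x=x, OF m(1) b1 st(1)])
    fix r assume "r \<in> {s..t}"
    then have r: "r \<le> 0" using st by simp
    show "integrable lborel (\<lambda>q. (if r < q \<and> q \<le> 0 then - 1 else 0) *\<^sub>R (mexp ((r - q) *\<^sub>R S) *v fst (?n q)))"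
      using i(1)[of r] by (simp only: slow_kernel_mult)
    show "fst (?z r) = mexp (r *\<^sub>R S) *v x
        + (\<integral>q. (if r < q \<and> q \<le> 0 then - 1 else 0) *\<^sub>R (mexp ((r - q) *\<^sub>R S) *v fst (?n q)) \<partial>lborel)"
      by (subst z(3)) (simp only: lyapunov_perron.kop_def slow_kernel_mult, simp add: slow_data_def r)
  next
    fix a b q assume "s \<le> a" "a \<le> b" "b \<le> t"
    then show "(if b < q \<and> q \<le> 0 then - 1 else 0) - (if a < q \<and> q \<le> 0 then - 1 else 0) = (indicator {a<..b} q :: real)"
      using st by (auto simp: indicator_def)
  qed
  moreover
  have "((\<lambda>q. fast_matrix *v snd (?z q) + (1 / \<epsilon>) *\<^sub>R snd (?n q)) has_integral snd (?z t) - snd (?z s)) {s..t}"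
  \<comment> \<open>The range of integration starts at minus infinity, hence no initial vector:
    \<open>x=0\<close>.\<close>
  proof (rule mild_imp_integrated[where \<iota>="\<lambda>t s. if s \<le> t then 1 else 0" and x=0, OF _ b2 st(1)])
    show "(\<lambda>q. (1 / \<epsilon>) *\<^sub>R snd (?n q)) \<in> borel_measurable borel"
      using m(2) by measurable
    fix r assume "r \<in> {s..t}"
    then have r: "r \<le> 0" using st by simp
    show "integrable lborel (\<lambda>q. (if q \<le> r then 1 else 0) *\<^sub>R (mexp ((r - q) *\<^sub>R fast_matrix) *v ((1 / \<epsilon>) *\<^sub>R snd (?n q))))"
      using i(2)[of r] by (simp only: fast_kernel_mult[OF r])
    show "snd (?z r) = mexp (r *\<^sub>R fast_matrix) *v 0
        + (\<integral>q. (if q \<le> r then 1 else 0) *\<^sub>R (mexp ((r - q) *\<^sub>R fast_matrix) *v ((1 / \<epsilon>) *\<^sub>R snd (?n q))) \<partial>lborel)"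
      by (subst z(3)) (simp only: lyapunov_perron.kop_def fast_kernel_mult[OF r], simp add: slow_data_def r)
  next
    fix a b q assume "s \<le> a" "a \<le> b" "b \<le> t"
    then show "(if q \<le> b then 1 else 0) - (if q \<le> a then 1 else 0) = (indicator {a<..b} q :: real)"
      by (auto simp: indicator_def)
  qed
  ultimately have "((\<lambda>u. vector_field w u (?z u)) has_integral (fst (?z t) - fst (?z s), snd (?z t) - snd (?z s))) {s..t}"
    unfolding vector_field_def by (rule has_integral_Pair)
  then show ?thesis by (simp add: minus_prod_def)
qed

text \<open>Both functions solve the same equation backwards from a common value at 0. The agreement
  stops there: \<open>lp_solution\<close> is cut off for positive times.\<close>

lemma trajectory_manifold_map:
  assumes w: "w \<in> space M" and "t \<le> 0"
  shows "trajectory w (x, manifold_map w x) t = lp_solution w x t"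
  by (rule integrated_ode_unique[where G="vector_field w" and L="4 * L" and a=t and b=0, OF vector_field_norm_lipschitz])
    (use trajectory_solves[OF w, of "(x, manifold_map w x)"] lp_solution_0[OF w] lp_solution_solves[OF w] assms(2)
      in \<open>auto simp: solution_iff\<close>)

text \<open>The fast component is determined by letting the initial time of the variation of constants
  formula tend to \<open>-\<infinity>\<close>: since \<open>\<gamma> + \<gamma>f < 0\<close>, the contribution of the initial value vanishes
  although the solution may grow like \<open>exp (\<gamma> \<bar>t\<bar> / \<epsilon>)\<close>.\<close>

lemma bounded_solution_eq_lp_solution:
  assumes w: "w \<in> space M" and z: "solves w z0 z"
    and D: "\<And>t. t \<le> 0 \<Longrightarrow> sum_norm (z t) \<le> D * exp (\<gamma> / \<epsilon> * \<bar>t\<bar>)" and "t \<le> 0"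
  shows "z t = lp_solution w (fst z0) t"
proof -
  \<comment> \<open>The solution continues for positive times without any weighted bound; cutting it
    off there matches the cut-off of the kernels and makes it a candidate for the fixed
    point.\<close>
  define y where "y t = (if t \<le> 0 then z t else 0)" for t
  let ?n = "\<lambda>s. nonlinearity w s (y s)"
  note f = nonlinearity_admissible[OF w]
  have zm [measurable]: "z \<in> borel_measurable borel"
    by (intro borel_measurable_continuous_onI solves_continuous[OF z])
  have m1: "(\<lambda>t. fst (z t)) \<in> borel_measurable borel" and m2: "(\<lambda>t. snd (z t)) \<in> borel_measurable borel"
    by (intro borel_measurable_continuous_onI continuous_intros solves_continuous[OF z])+
  have ym: "y \<in> borel_measurable borel" unfolding y_def by measurable
  have D0: "D \<ge> 0" using order_trans[OF sum_norm_nonneg D[of 0]] by simp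
  have ywb: "weighted_bounded (\<lambda>t. exp (\<gamma> / \<epsilon> * \<bar>t\<bar>)) y"
    unfolding weighted_bounded_def using D D0 by (intro exI[of _ D]) (simp add: y_def)
  obtain C where C: "C \<ge> 0" "\<And>s. norm (fst (?n s)) \<le> C * exp (\<gamma> / \<epsilon> * \<bar>s\<bar>)"
    "\<And>s. norm (snd (?n s)) \<le> C * exp (\<gamma> / \<epsilon> * \<bar>s\<bar>)"
    using lyapunov_perron.field_bound[OF f ywb] by blast
  have g: "\<gamma> / \<epsilon> \<ge> 0" using pos by simp
  have b1: "bounded ((\<lambda>s. fst (?n s)) ` {l..r})" for l r
    by (rule exp_bound_imp_bounded[OF C(2,1) g])
  have b2: "bounded ((\<lambda>s. (1 / \<epsilon>) *\<^sub>R snd (?n s)) ` {l..r})" for l r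
    using bounded_scaling[OF exp_bound_imp_bounded[OF C(3,1) g, of l r], of "1 / \<epsilon>"] by (simp add: image_image)
  note m = lyapunov_perron.measurable_field(2,3)[OF f ym]
  have m2': "(\<lambda>q. (1 / \<epsilon>) *\<^sub>R snd (?n q)) \<in> borel_measurable borel"
    using m(2) by measurable
  note i = lyapunov_perron.kop_integrable[OF f ym ywb]
  have h: "((\<lambda>u. vector_field w u (y u)) has_integral z t - z s) {s..t}" if "s \<le> t" "t \<le> 0" for s t
  proof (rule has_integral_eq)
    show "((\<lambda>u. vector_field w u (z u)) has_integral z t - z s) {s..t}"
      using z that by (simp add: solution_iff)
  qed (use that in \<open>simp add: y_def\<close>)
  have h1: "((\<lambda>q. S *v fst (z q) + fst (?n q)) has_integral fst (z t) - fst (z s)) {s..t}" if "s \<le> t" "t \<le> 0" for s t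
  proof (rule has_integral_eq)
    show "((\<lambda>u. fst (vector_field w u (y u))) has_integral fst (z t) - fst (z s)) {s..t}"
      using has_integral_linear[OF h[OF that] bounded_linear_fst] by (simp add: o_def)
  qed (use that in \<open>simp add: y_def vector_field_def\<close>)
  have h2: "((\<lambda>q. fast_matrix *v snd (z q) + (1 / \<epsilon>) *\<^sub>R snd (?n q)) has_integral snd (z t) - snd (z s)) {s..t}"
    if "s \<le> t" "t \<le> 0" for s t
  proof (rule has_integral_eq)
    show "((\<lambda>u. snd (vector_field w u (y u))) has_integral snd (z t) - snd (z s)) {s..t}"
      using has_integral_linear[OF h[OF that] bounded_linear_snd] by (simp add: o_def)
  qed (use that in \<open>simp add: y_def vector_field_def\<close>)
  have z0: "z 0 = z0" using z by (simp add: solution_iff)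
  have slow: "(\<integral>q. slow_kernel t q *v fst (?n q) \<partial>lborel) = fst (z t) - mexp (t *\<^sub>R S) *v fst z0" if t: "t \<le> 0" for t
  proof -
    \<comment> \<open>The slow equation is integrated from \<open>t\<close> up to 0, where the value
      is prescribed; multiplication by \<open>mexp (t *\<^sub>R S)\<close> then moves the base point
      from 0 to \<open>t\<close>.\<close>
    have "((\<lambda>q. mexp ((0 - q) *\<^sub>R S) *v fst (?n q)) has_integral fst (z 0) - mexp ((0 - t) *\<^sub>R S) *v fst (z t)) {t..0}"
      by (rule integrated_imp_mild[OF m(1) b1 t m1]) (rule h1)
    from has_integral_linear[OF this matrix_vector_mul_bounded_linear[of "mexp (t *\<^sub>R S)"]]
    have 1: "((\<lambda>q. mexp ((t - q) *\<^sub>R S) *v fst (?n q)) has_integral mexp (t *\<^sub>R S) *v fst z0 - fst (z t)) {t..0}"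
      unfolding o_def matrix_vector_mult_diff_distrib matrix_vector_mul_assoc mexp_add[symmetric]
      by (simp add: mexp_0 z0)
    have e: "indicator {t<..0} q *\<^sub>R (mexp ((t - q) *\<^sub>R S) *v fst (?n q)) = - (slow_kernel t q *v fst (?n q))" for q
      by (simp add: slow_kernel_mult indicator_def)
    have "((\<lambda>q. mexp ((t - q) *\<^sub>R S) *v fst (?n q)) has_integral
        (\<integral>q. - (slow_kernel t q *v fst (?n q)) \<partial>lborel)) {t..0}"
      unfolding e[symmetric] by (rule half_open_has_integral) (unfold e, use i(1)[of t] in simp)
    from has_integral_unique[OF this 1] show ?thesis by (simp add: algebra_simps)
  qed
  have fast: "(\<integral>q. fast_kernel t q *v snd (?n q) \<partial>lborel) = snd (z t)" if t: "t \<le> 0" for t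
  proof -
    let ?h = "\<lambda>q. mexp ((t - q) *\<^sub>R fast_matrix) *v ((1 / \<epsilon>) *\<^sub>R snd (?n q))"
    let ?J = "\<lambda>n q. indicator {t - real n<..t} q *\<^sub>R ?h q"
    have hm: "?h \<in> borel_measurable borel"
      by (intro measurable_matrix_vector_mult mexp_measurable m2') measurable
    have ih: "integrable lborel (\<lambda>q. (if q \<le> t then 1 else 0) *\<^sub>R ?h q)"
      using i(2)[of t] by (simp only: fast_kernel_mult[OF t])
    have Jm: "?J n \<in> borel_measurable lborel" for n
      using hm by measurable
    have J_le: "norm (?J n q) \<le> norm ((if q \<le> t then 1 else 0) *\<^sub>R ?h q)" for n q
      by (simp add: indicator_def)
    have iJ: "integrable lborel (?J n)" for n
      by (rule Bochner_Integration.integrable_bound[OF ih Jm]) (use J_le in simp)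
    \<comment> \<open>The windows \<open>(t - n, t]\<close> exhaust the past, and the full fast
      integrand, integrable by the weighted bound on \<open>y\<close>, dominates them.\<close>
    have "(\<lambda>n. \<integral>q. ?J n q \<partial>lborel) \<longlonglongrightarrow> (\<integral>q. (if q \<le> t then 1 else 0) *\<^sub>R ?h q \<partial>lborel)"
    proof (rule integral_dominated_convergence[where w="\<lambda>q. norm ((if q \<le> t then 1 else 0) *\<^sub>R ?h q)"])
      show "AE q in lborel. (\<lambda>n. ?J n q) \<longlonglongrightarrow> (if q \<le> t then 1 else 0) *\<^sub>R ?h q"
      proof (rule AE_I2, rule tendsto_eventually)
        fix q
        obtain N :: nat where N: "t - q < N" using reals_Archimedean2 by blast
        show "eventually (\<lambda>n. ?J n q = (if q \<le> t then 1 else 0) *\<^sub>R ?h q) sequentially"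
          by (rule eventually_sequentiallyI[of N]) (use N in \<open>auto simp: indicator_def\<close>)
      qed
      show "AE q in lborel. norm (?J n q) \<le> norm ((if q \<le> t then 1 else 0) *\<^sub>R ?h q)" for n
        using J_le by (intro AE_I2)
    qed (rule borel_measurable_integrable[OF ih] Jm integrable_norm[OF ih])+
    moreover have "(\<integral>q. ?J n q \<partial>lborel) = snd (z t) - mexp (real n *\<^sub>R fast_matrix) *v snd (z (t - real n))" for n
    proof (rule has_integral_unique[OF half_open_has_integral[OF iJ]])
      have "((\<lambda>q. ?h q) has_integral snd (z t) - mexp ((t - (t - real n)) *\<^sub>R fast_matrix) *v snd (z (t - real n))) {t - real n..t}"
        by (rule integrated_imp_mild[OF m2' b2 _ m2]) (use t in \<open>auto intro!: h2\<close>)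
      then show "(?h has_integral snd (z t) - mexp (real n *\<^sub>R fast_matrix) *v snd (z (t - real n))) {t - real n..t}"
        by simp
    qed
    ultimately have 1: "(\<lambda>n. snd (z t) - mexp (real n *\<^sub>R fast_matrix) *v snd (z (t - real n)))
        \<longlonglongrightarrow> (\<integral>q. fast_kernel t q *v snd (?n q) \<partial>lborel)"
      by (simp only: fast_kernel_mult[OF t])
    have "(\<lambda>n. mexp (real n *\<^sub>R fast_matrix) *v snd (z (t - real n))) \<longlonglongrightarrow> 0"
    proof (rule Lim_null_comparison)
      define c where "c = - (\<gamma> + \<gamma>f) / \<epsilon>"
      have c: "c > 0" using gap pos by (simp add: c_def)
      have "norm (mexp (real n *\<^sub>R fast_matrix) *v snd (z (t - real n))) \<le> D * exp (\<gamma> / \<epsilon> * \<bar>t\<bar>) * exp (- c) ^ n" for n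
      proof -
        have "norm (mexp (real n *\<^sub>R fast_matrix) *v snd (z (t - real n))) \<le> exp (\<gamma>f / \<epsilon> * real n) * norm (snd (z (t - real n)))"
          by (rule mexp_fast_matrix_bound) simp
        also have "norm (snd (z (t - real n))) \<le> D * exp (\<gamma> / \<epsilon> * \<bar>t - real n\<bar>)"
          using D[of "t - real n"] t norm_ge_zero[of "fst (z (t - real n))"] unfolding sum_norm_def by linarith
        also have "exp (\<gamma>f / \<epsilon> * real n) * (D * exp (\<gamma> / \<epsilon> * \<bar>t - real n\<bar>))
            = D * exp (\<gamma> / \<epsilon> * \<bar>t\<bar>) * exp (- c * real n)"
        proof -
          have "\<gamma>f / \<epsilon> * real n + \<gamma> / \<epsilon> * \<bar>t - real n\<bar> = \<gamma> / \<epsilon> * \<bar>t\<bar> + - c * real n"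
            using t pos by (simp add: c_def field_simps)
          then have "exp (\<gamma>f / \<epsilon> * real n) * exp (\<gamma> / \<epsilon> * \<bar>t - real n\<bar>) = exp (\<gamma> / \<epsilon> * \<bar>t\<bar>) * exp (- c * real n)"
            by (simp only: exp_add[symmetric])
          then show ?thesis by (simp only: mult.left_commute[of _ D] mult.assoc)
        qed
        also have "exp (- c * real n) = exp (- c) ^ n"
          by (simp add: exp_of_nat_mult[symmetric] mult.commute)
        finally show ?thesis by simp
      qed
      then show "eventually (\<lambda>n. norm (mexp (real n *\<^sub>R fast_matrix) *v snd (z (t - real n)))
          \<le> D * exp (\<gamma> / \<epsilon> * \<bar>t\<bar>) * exp (- c) ^ n) sequentially" by simp
      show "(\<lambda>n. D * exp (\<gamma> / \<epsilon> * \<bar>t\<bar>) * exp (- c) ^ n) \<longlonglongrightarrow> 0"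
        by (intro tendsto_mult_right_zero LIMSEQ_realpow_zero) (use c in auto)
    qed
    from tendsto_diff[OF tendsto_const this, of "snd (z t)"]
    show ?thesis using 1 LIMSEQ_unique by fastforce
  qed
  have "y t = lyapunov_perron.kop (slow_data (fst z0)) (nonlinearity w) y t" for t
  proof (cases "t \<le> 0")
    case True
    then show ?thesis
      by (simp add: lyapunov_perron.kop_def slow fast slow_data_def y_def[of t] prod_eq_iff)
  next
    case False
    then have "slow_kernel t = (\<lambda>_. 0)" "fast_kernel t = (\<lambda>_. 0)"
      by (auto simp: slow_kernel_def fast_kernel_def fun_eq_iff)
    then show ?thesis using False by (simp add: lyapunov_perron.kop_def slow_data_def y_def[of t] zero_prod_def)
  qed
  from lyapunov_perron.fixed_point_unique[OF f ym ywb lp_solution(1,2)[OF w] this lp_solution(3)[OF w], of t]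
  show ?thesis using \<open>t \<le> 0\<close> by (simp add: y_def)
qed

section \<open>Graph representation, Lipschitz bound, measurability and invariance\<close>

lemma slow_manifold_eq:
  assumes w: "w \<in> space M"
  shows "slow_manifold \<phi> (- \<gamma> / \<epsilon>) w = {(x, manifold_map w x) | x. True}"
proof (intro set_eqI iffI)
  fix z0
  assume "z0 \<in> slow_manifold \<phi> (- \<gamma> / \<epsilon>) w"
  then have "(\<lambda>t. trajectory w z0 t) \<in> C_minus (- \<gamma> / \<epsilon>)"
    by (simp add: slow_manifold_def flow_eq_trajectory[OF w])
  then obtain C1 C2 where C: "\<And>t. t \<le> 0 \<Longrightarrow> norm (exp (- (- \<gamma> / \<epsilon>) * t) *\<^sub>R fst (trajectory w z0 t)) \<le> C1"
    "\<And>t. t \<le> 0 \<Longrightarrow> norm (exp (- (- \<gamma> / \<epsilon>) * t) *\<^sub>R snd (trajectory w z0 t)) \<le> C2"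
    unfolding C_minus_def bdd_above_def by auto
  \<comment> \<open>For \<open>t \<le> 0\<close> the factor in \<open>C_minus\<close>, with \<beta>
    = -\<gamma>/\<epsilon>, is the reciprocal of the weight, so membership becomes a weighted bound
    on the past.\<close>
  have "sum_norm (trajectory w z0 t) \<le> (C1 + C2) * exp (\<gamma> / \<epsilon> * \<bar>t\<bar>)" if "t \<le> 0" for t
  proof -
    have "exp (\<gamma> / \<epsilon> * t) * sum_norm (trajectory w z0 t) \<le> C1 + C2"
      using add_mono[OF C(1)[OF that] C(2)[OF that]] by (simp add: sum_norm_def distrib_left)
    from mult_left_mono[OF this, of "exp (- (\<gamma> / \<epsilon> * t))"] that
    show ?thesis by (simp add: exp_minus_inverse mult.assoc[symmetric] exp_add[symmetric] mult.commute)
  qed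
  from bounded_solution_eq_lp_solution[OF w trajectory_solves[OF w] this, of 0]
  have "trajectory w z0 0 = (fst z0, manifold_map w (fst z0))"
    by (simp add: lp_solution_0[OF w])
  moreover have "trajectory w z0 0 = z0"
    using trajectory_solves[OF w, of z0] by (simp add: solution_iff)
  ultimately show "z0 \<in> {(x, manifold_map w x) | x. True}" by auto
next
  fix z0
  assume "z0 \<in> {(x, manifold_map w x) | x. True}"
  then obtain x where x: "z0 = (x, manifold_map w x)" by auto
  obtain D where D: "\<And>t. sum_norm (lp_solution w x t) \<le> D * exp (\<gamma> / \<epsilon> * \<bar>t\<bar>)"
    using lp_solution(2)[OF w] unfolding weighted_bounded_def by blast
  have le: "exp (\<gamma> / \<epsilon> * t) * sum_norm (trajectory w z0 t) \<le> D" if "t \<le> 0" for t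
  proof -
    have "exp (\<gamma> / \<epsilon> * t) * sum_norm (trajectory w z0 t) \<le> exp (\<gamma> / \<epsilon> * t) * (D * exp (\<gamma> / \<epsilon> * \<bar>t\<bar>))"
      using D[of t] by (simp add: x trajectory_manifold_map[OF w that])
    also have "\<dots> = D * (exp (\<gamma> / \<epsilon> * t) * exp (- (\<gamma> / \<epsilon> * t)))"
      using that by simp
    also have "\<dots> = D" by (simp only: exp_minus_inverse mult_1_right)
    finally show ?thesis .
  qed
  have "norm (exp (- (- \<gamma> / \<epsilon>) * t) *\<^sub>R fst (trajectory w z0 t)) \<le> D"
    "norm (exp (- (- \<gamma> / \<epsilon>) * t) *\<^sub>R snd (trajectory w z0 t)) \<le> D" if "t \<le> 0" for t
  proof -
    have nn: "exp (\<gamma> / \<epsilon> * t) * norm (fst (trajectory w z0 t)) \<ge> 0" "exp (\<gamma> / \<epsilon> * t) * norm (snd (trajectory w z0 t)) \<ge> 0"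
      by (simp_all only: mult_nonneg_nonneg exp_ge_zero norm_ge_zero)
    then show "norm (exp (- (- \<gamma> / \<epsilon>) * t) *\<^sub>R fst (trajectory w z0 t)) \<le> D"
      "norm (exp (- (- \<gamma> / \<epsilon>) * t) *\<^sub>R snd (trajectory w z0 t)) \<le> D"
      using le[OF that] nn unfolding sum_norm_def distrib_left norm_scaleR abs_exp_cancel minus_divide_left[symmetric] minus_minus
      by linarith+
  qed
  then show "z0 \<in> slow_manifold \<phi> (- \<gamma> / \<epsilon>) w"
    unfolding slow_manifold_def C_minus_def flow_eq_trajectory[OF w]
    using solves_continuous[OF trajectory_solves[OF w]]
    by (auto intro!: bdd_aboveI2[of _ _ D])
qed

lemma rate_pos: "- (K / (\<gamma> + \<gamma>f)) * (1 / (1 - \<rho> K \<gamma> \<gamma>s \<gamma>f \<epsilon>)) \<ge> 0"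
  using lyapunov_perron.q by (intro mult_nonneg_nonneg) (auto simp: \<rho>_def)

text \<open>The two fixed points differ by at most \<open>norm (x - y) / (1 - \<rho> K \<gamma>
  \<gamma>s \<gamma>f \<epsilon>)\<close> in the weighted norm. Inserting this once more into the
  fast component, where the data agree, multiplies it by the fast share; at time 0 the weight is
  1.\<close>

lemma manifold_map_lipschitz:
  assumes w: "w \<in> space M"
  shows "(- (K / (\<gamma> + \<gamma>f)) * (1 / (1 - \<rho> K \<gamma> \<gamma>s \<gamma>f \<epsilon>)))-lipschitz_on UNIV (manifold_map w)"
proof (rule lipschitz_onI)
  fix x y
  note f = nonlinearity_admissible[OF w] and X = lp_solution[OF w, of x] and Y = lp_solution[OF w, of y]
  note d = lyapunov_perron.fixed_point_diff[OF f X(1,2) Y(1,2) X(3) Y(3) slow_data_diff]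
  have "norm (manifold_map w x - manifold_map w y)
      \<le> - (K / (\<gamma> + \<gamma>f)) * (norm (x - y) / (1 - (\<epsilon> * K / (\<gamma> + \<epsilon> * \<gamma>s) + - (K / (\<gamma> + \<gamma>f)))))"
    using lyapunov_perron.kop_diff(2)[OF f X(1,2) Y(1,2) d, of "slow_data x" 0 "slow_data y"]
    unfolding X(3)[symmetric] Y(3)[symmetric] by (simp add: manifold_map_def slow_data_def)
  then show "dist (manifold_map w x) (manifold_map w y)
      \<le> - (K / (\<gamma> + \<gamma>f)) * (1 / (1 - \<rho> K \<gamma> \<gamma>s \<gamma>f \<epsilon>)) * dist x y"
    by (simp add: dist_norm \<rho>_def)
qed (rule rate_pos)

lemma manifold_map_measurable: "(\<lambda>w. manifold_map w x) \<in> borel_measurable M"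
proof -
  have "(\<lambda>(w, t). slow_data x t) \<in> borel_measurable (M \<Otimes>\<^sub>M borel)"
    using measurable_compose[OF measurable_snd slow_data_measurable] by (simp add: split_beta')
  from lyapunov_perron.fixed_point_measurable_param[OF this nonlinearity_measurable]
  have "(\<lambda>(w, t). lp_solution w x t) \<in> borel_measurable (M \<Otimes>\<^sub>M borel)"
    by (simp add: lp_solution_def)
  from measurable_compose[OF _ this, of "\<lambda>w. (w, 0)" M]
  have "(\<lambda>w. lp_solution w x 0) \<in> borel_measurable M" by simp
  then show ?thesis
    unfolding manifold_map_def
    by (rule measurable_compose) (intro borel_measurable_continuous_onI continuous_intros)
qed

text \<open>Seen from time \<open>s\<close>, the past consists of the old past and the compact piece
  over \<open>[0, s]\<close>. The exponential factor only decreases under the shift, so the old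
  bound survives, and the new piece is bounded by continuity.\<close>

lemma slow_manifold_invariant:
  assumes w: "w \<in> space M" and "s \<ge> 0" and z: "z \<in> slow_manifold \<phi> (- \<gamma> / \<epsilon>) w"
  shows "\<phi> s w z \<in> slow_manifold \<phi> (- \<gamma> / \<epsilon>) (path_shift s w)"
proof -
  let ?b = "\<gamma> / \<epsilon>"
  let ?z = "trajectory w z"
  have b: "?b > 0" using pos by simp
  have c: "continuous_on X ?z" for X by (rule solves_continuous[OF trajectory_solves[OF w]])
  have "(\<lambda>t. ?z t) \<in> C_minus (- \<gamma> / \<epsilon>)"
    using z by (simp add: slow_manifold_def flow_eq_trajectory[OF w])
  then obtain C1 C2 where C: "\<And>t. t \<le> 0 \<Longrightarrow> norm (exp (- (- \<gamma> / \<epsilon>) * t) *\<^sub>R fst (?z t)) \<le> C1"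
    "\<And>t. t \<le> 0 \<Longrightarrow> norm (exp (- (- \<gamma> / \<epsilon>) * t) *\<^sub>R snd (?z t)) \<le> C2"
    unfolding C_minus_def bdd_above_def by auto
  have "bounded (?z ` {0..s})"
    by (intro compact_imp_bounded compact_continuous_image c) auto
  then obtain B where B: "\<And>t. t \<in> {0..s} \<Longrightarrow> norm (?z t) \<le> B" unfolding bounded_iff by blast
  \<comment> \<open>\<open>pr\<close> stands for either projection, so that both components of
    \<open>C_minus\<close> follow from one estimate; \<open>B\<close> covers the new piece and
    \<open>C\<close> the old past.\<close>
  have bnd: "norm (exp (?b * t) *\<^sub>R pr (?z (t + s))) \<le> B + \<bar>C\<bar>"
    if "t \<le> 0" "\<And>z. norm (pr z) \<le> norm z" "\<And>t. t \<le> 0 \<Longrightarrow> norm (exp (?b * t) *\<^sub>R pr (?z t)) \<le> C"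
    for t C and pr :: "_ \<Rightarrow> 'q::real_normed_vector"
  proof -
    have B0: "B \<ge> 0" using order_trans[OF norm_ge_zero B[of 0]] \<open>s \<ge> 0\<close> by simp
    show ?thesis
    proof (cases "t + s \<le> 0")
      case True
      have "exp (?b * t) * norm (pr (?z (t + s))) \<le> exp (?b * (t + s)) * norm (pr (?z (t + s)))"
      proof (rule mult_right_mono)
        have "?b * t \<le> ?b * (t + s)" using b \<open>s \<ge> 0\<close> by (intro mult_left_mono) auto
        then show "exp (?b * t) \<le> exp (?b * (t + s))" by (simp only: exp_le_cancel_iff)
      qed simp
      also have "\<dots> \<le> C" using that(3)[OF True] by simp
      finally show ?thesis using B0 by simp
    next
      case False
      have "exp (?b * t) * norm (pr (?z (t + s))) \<le> 1 * B"
        using b that(1) False order_trans[OF that(2) B[of "t + s"]]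
      proof (intro mult_mono)
        have "?b * t \<le> 0" using b that(1) by (intro mult_nonneg_nonpos) auto
        then show "exp (?b * t) \<le> 1" by (simp only: exp_le_one_iff)
      qed auto
      then show ?thesis by simp
    qed
  qed
  have eb: "- (- \<gamma> / \<epsilon>) = ?b" by simp
  have le: "norm (fst z) \<le> norm z" "norm (snd z) \<le> norm z" for z :: "(real^'m) \<times> (real^'n)"
    by (metis norm_fst_le prod.collapse, metis norm_snd_le prod.collapse)
  have "(\<lambda>t. ?z (t + s)) \<in> C_minus (- \<gamma> / \<epsilon>)"
    unfolding C_minus_def
  proof (intro CollectI conjI)
    show "continuous_on {..0} (\<lambda>t. ?z (t + s))"
      by (rule continuous_on_compose2[OF c[of UNIV]]) (auto intro: continuous_intros)
    show "bdd_above ((\<lambda>t. norm (exp (- (- \<gamma> / \<epsilon>) * t) *\<^sub>R fst (?z (t + s)))) ` {..0})"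
      unfolding eb using bnd[OF _ le(1) C(1)[unfolded eb]] by (intro bdd_aboveI2[of _ _ "B + \<bar>C1\<bar>"]) blast
    show "bdd_above ((\<lambda>t. norm (exp (- (- \<gamma> / \<epsilon>) * t) *\<^sub>R snd (?z (t + s)))) ` {..0})"
      unfolding eb using bnd[OF _ le(2) C(2)[unfolded eb]] by (intro bdd_aboveI2[of _ _ "B + \<bar>C2\<bar>"]) blast
  qed
  then show ?thesis
    by (simp add: slow_manifold_def flow_eq_trajectory w shift_space trajectory_shift)
qed

lemma slow_manifold_lipschitz_invariant_manifold:
  "lipschitz_invariant_manifold M path_shift \<phi> (slow_manifold \<phi> (- \<gamma> / \<epsilon>)) manifold_map"
  unfolding lipschitz_invariant_manifold_def invariant_random_set_def
proof (intro conjI allI ballI impI)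
  show "random_set M (slow_manifold \<phi> (- \<gamma> / \<epsilon>))"
    by (rule random_set_graph[OF manifold_map_measurable
        lipschitz_on_continuous_on[OF manifold_map_lipschitz] slow_manifold_eq])
  show "\<phi> t w ` slow_manifold \<phi> (- \<gamma> / \<epsilon>) w \<subseteq> slow_manifold \<phi> (- \<gamma> / \<epsilon>) (path_shift t w)"
    if "t \<ge> 0" "w \<in> space M" for t w
    using slow_manifold_invariant[OF that(2,1)] by blast
  show "\<exists>C. C-lipschitz_on UNIV (manifold_map w)" if "w \<in> space M" for w
    using manifold_map_lipschitz[OF that] by blast
qed (rule slow_manifold_eq manifold_map_measurable, assumption?)+

end

theorem theorem1:
  fixes S :: "real ^ 'm ^ 'm" and F :: "real ^ 'n ^ 'n"
    and g1 :: "(real ^ 'm) \<times> (real ^ 'n) \<Rightarrow> real ^ 'm"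
    and g2 :: "(real ^ 'm) \<times> (real ^ 'n) \<Rightarrow> real ^ 'n"
    and \<sigma> \<alpha> \<gamma>s \<gamma>f K \<gamma> :: real
    and P :: "(real \<Rightarrow> real ^ 'n) measure"
  assumes "\<sigma> > 0" and "1 < \<alpha>" and "\<alpha> < 2"
    and S_spec: "\<And>c. eigenvalue S c \<Longrightarrow> Re c \<ge> 0"
    and F_spec: "\<And>c. eigenvalue F c \<Longrightarrow> Re c < 0"
    and g_zero: "g1 (0, 0) = 0" "g2 (0, 0) = 0"
    and A1: "\<gamma>s > 0" "\<gamma>f < 0"
      "\<And>t x. t \<le> 0 \<Longrightarrow> norm (mexp (t *\<^sub>R S) *v x) \<le> exp (\<gamma>s * t) * norm x"
      "\<And>t y. t \<ge> 0 \<Longrightarrow> norm (mexp (t *\<^sub>R F) *v y) \<le> exp (\<gamma>f * t) * norm y"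
    and A2: "K > 0"
      "\<And>x1 y1 x2 y2. norm (g1 (x1, y1) - g1 (x2, y2)) \<le> K * (norm (x1 - x2) + norm (y1 - y2))"
      "\<And>x1 y1 x2 y2. norm (g2 (x1, y1) - g2 (x2, y2)) \<le> K * (norm (x1 - x2) + norm (y1 - y2))"
    and A3: "K < - \<gamma>f"
    and gap: "\<gamma> > 0" "K < - (\<gamma> + \<gamma>f)"
    and noise: "stable_levy_law \<alpha> P"
  shows "\<exists>\<epsilon>0>0. \<forall>\<epsilon>. 0 < \<epsilon> \<and> \<epsilon> < \<epsilon>0 \<longrightarrow>
    (\<forall>\<Omega>. admissible_paths S F g1 g2 \<sigma> \<alpha> \<epsilon> P \<Omega> \<longrightarrow>
      (let M = restrict_space P \<Omega>; \<phi> = flow S F g1 g2 \<sigma> \<alpha> \<epsilon> in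
        random_dynamical_system M path_shift \<phi> \<and>
        (\<exists>h. lipschitz_invariant_manifold M path_shift \<phi> (slow_manifold \<phi> (- \<gamma> / \<epsilon>)) h \<and>
          (\<forall>w\<in>\<Omega>. (- (K / (\<gamma> + \<gamma>f)) * (1 / (1 - \<rho> K \<gamma> \<gamma>s \<gamma>f \<epsilon>)))-lipschitz_on UNIV (h w)))))"
proof (intro exI conjI allI impI)
  have "\<gamma> + \<gamma>f < 0" "K / (\<gamma> + \<gamma>f) > - 1"
    using gap A2(1) by (auto simp: field_simps)
  then have r: "1 + K / (\<gamma> + \<gamma>f) > 0" by simp
  \<comment> \<open>This fixes \<open>\<epsilon>0\<close>: it is the condition
    \<open>\<epsilon> * K / \<gamma> < 1 + K / (\<gamma> + \<gamma>f)\<close> solved for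
    \<open>\<epsilon>\<close>, and the gap condition makes it positive.\<close>
  then show "\<gamma> * (1 + K / (\<gamma> + \<gamma>f)) / K > 0" using gap(1) A2(1) by simp
  fix \<epsilon> \<Omega>
  assume \<epsilon>: "0 < \<epsilon> \<and> \<epsilon> < \<gamma> * (1 + K / (\<gamma> + \<gamma>f)) / K"
    and adm: "admissible_paths S F g1 g2 \<sigma> \<alpha> \<epsilon> P \<Omega>"
  have \<Omega>: "\<Omega> \<in> sets P" "\<And>t. path_shift t ` \<Omega> = \<Omega>"
    and w: "\<And>w. w \<in> \<Omega> \<Longrightarrow> \<exists>I. has_past_integral (ou_kernel \<epsilon> F) w I"
      "\<And>w. w \<in> \<Omega> \<Longrightarrow> cadlag (\<lambda>t. \<eta> \<alpha> \<epsilon> F (path_shift t w))"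
      "\<And>w. w \<in> \<Omega> \<Longrightarrow> ((\<lambda>t. (1 / t) *\<^sub>R \<eta> \<alpha> \<epsilon> F (path_shift t w)) \<longlongrightarrow> 0) at_top"
      "\<And>w. w \<in> \<Omega> \<Longrightarrow> ((\<lambda>t. (1 / t) *\<^sub>R \<eta> \<alpha> \<epsilon> F (path_shift t w)) \<longlongrightarrow> 0) at_bot"
    using adm unfolding admissible_paths_def by simp_all
  have sp: "space (restrict_space P \<Omega>) = \<Omega>"
    using sets.sets_into_space[OF \<Omega>(1)] by (auto simp: space_restrict_space)
  interpret slow_fast_system S F g1 g2 \<sigma> \<alpha> \<epsilon> \<gamma>s \<gamma>f K \<gamma> "restrict_space P \<Omega>"
  proof
    show "\<epsilon> * K / \<gamma> < 1 + K / (\<gamma> + \<gamma>f)"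
      using conjunct2[OF \<epsilon>] gap(1) A2(1) by (simp add: pos_less_divide_eq pos_divide_less_eq mult.commute)
    show "(\<lambda>w. w t) \<in> borel_measurable (restrict_space P \<Omega>)" for t
      by (intro measurable_restrict_space1 stable_levy_law_coordinate_measurable[OF noise])
    show "norm (g1 p - g1 q) \<le> K * sum_norm (p - q)" "norm (g2 p - g2 q) \<le> K * sum_norm (p - q)" for p q
      using A2(2,3)[of "fst p" "snd p" "fst q" "snd q"] by (simp_all add: sum_norm_def)
    show "path_shift t w \<in> space (restrict_space P \<Omega>)" if "w \<in> space (restrict_space P \<Omega>)" for t w
      using that \<Omega>(2)[of t] unfolding sp by blast
  qed (use A1 A2(1) gap g_zero \<epsilon> w in \<open>simp_all add: sp\<close>)
  have "\<forall>v\<in>\<Omega>. (- (K / (\<gamma> + \<gamma>f)) * (1 / (1 - \<rho> K \<gamma> \<gamma>s \<gamma>f \<epsilon>)))-lipschitz_on UNIV (manifold_map v)"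
    using manifold_map_lipschitz unfolding sp by blast
  then show "let M = restrict_space P \<Omega>; \<phi> = flow S F g1 g2 \<sigma> \<alpha> \<epsilon> in
        random_dynamical_system M path_shift \<phi> \<and>
        (\<exists>h. lipschitz_invariant_manifold M path_shift \<phi> (slow_manifold \<phi> (- \<gamma> / \<epsilon>)) h \<and>
          (\<forall>w\<in>\<Omega>. (- (K / (\<gamma> + \<gamma>f)) * (1 / (1 - \<rho> K \<gamma> \<gamma>s \<gamma>f \<epsilon>)))-lipschitz_on UNIV (h w)))"
    unfolding Let_def using flow_random_dynamical_system slow_manifold_lipschitz_invariant_manifold by blast
qed

end
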